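(* Fix $\rho_1,\rho_2\in[0,1)$ and let $P_\infty$ be the $\infty$-pCN kernel $$P_\infty(x_0,dy)=\int_{\mathcal X}\frac{e^{-\Phi(y)}\,Q_1(z,dy)}{\int e^{-\Phi(u)}Q_1(z,du)}\,Q_2(x_0,dz),\qquad Q_i(x,\cdot)=\mathcal N(\rho_ix,(1-\rho_i^2)\mathcal C),\ i=1,2.$$ Assume $\Phi:\mathcal X\to\mathbb R$ is globally Lipschitz with respect to $\|\cdot\|$ with constant $L_\Phi$. Let $V$ be any one of the functions $V(x)=\|x\|^k$ with $k\in\mathbb N$; $V(x)=\exp(v\|x\|)$ with $v>0$; or $V(x)=\exp(v\|x\|^2)$ with $v>0$ sufficiently small. Then there exists $\varepsilon^*\in(0,1)$ so that for any $\varepsilon\in(0,\varepsilon^* )$ there are $\lambda\in(0,1)$ and $n_1\in\mathbb N$ such that for all Borel probability measures $\nu_1,\nu_2$ on $\mathcal X$, $$W_{\tilde d_\varepsilon}(\nu_1P_\infty^n,\nu_2P_\infty^n)\le\lambda^n\,W_{\tilde d_\varepsilon}(\nu_1,\nu_2)\quad\text{for all } n\ge n_1,$$ where $\tilde d_\varepsilon(x,\tilde x)=\sqrt{d_\varepsilon(x,\tilde x)\,(1+V(x)+V(\tilde x))}$ and $d_\varepsilon(x,\tilde x)=1\wedge\varepsilon^{-1}\|x-\tilde x\|$.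
   Context: $\mathcal X$ is a separable Hilbert space with norm $\|\cdot\|$; $\mathcal N(m,\mathcal K)$ denotes the Gaussian measure on $\mathcal X$ with mean $m$ and covariance operator $\mathcal K$; $\mathcal C$ is a linear, symmetric, strictly positive-definite, trace-class operator on $\mathcal X$. For a Markov kernel $P$ and a measure $\nu$, $\nu P(A)=\int P(x,A)\,\nu(dx)$, and $P^n$ is the $n$-step kernel. $W_{\tilde d}(\nu_1,\nu_2)=\inf_\pi\int\tilde d(x,y)\,\pi(dx,dy)$, the infimum over all couplings $\pi$ of $\nu_1,\nu_2$. "$v$ sufficiently small" means $0<v\le v_0$ for some $v_0>0$. *)

theory Defs
  imports "HOL-Probability.Probability"
begin

section \<open>Operators on a Hilbert space\<close>

definition orthonormal_basis :: "'a::real_inner set \<Rightarrow> bool" where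
  "orthonormal_basis E \<longleftrightarrow>
     pairwise orthogonal E \<and> (\<forall>e\<in>E. norm e = 1) \<and> closure (span E) = UNIV"

definition symmetric_operator :: "('a::real_inner \<Rightarrow> 'a) \<Rightarrow> bool" where
  "symmetric_operator T \<longleftrightarrow> (\<forall>x y. T x \<bullet> y = x \<bullet> T y)"

definition strictly_positive_operator :: "('a::real_inner \<Rightarrow> 'a) \<Rightarrow> bool" where
  "strictly_positive_operator T \<longleftrightarrow> (\<forall>x. x \<noteq> 0 \<longrightarrow> 0 < T x \<bullet> x)"

text \<open>
  An operator \<open>T\<close> is trace class if \<open>|T|\<close> has finite trace. For symmetric positive \<open>T\<close> one has
  \<open>|T| = T\<close>, and the trace does not depend on the orthonormal basis. The definition below is only
  to be used for symmetric positive operators.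
\<close>

definition positive_trace_class :: "('a::real_inner \<Rightarrow> 'a) \<Rightarrow> bool" where
  "positive_trace_class T \<longleftrightarrow>
     bounded_linear T \<and> (\<exists>E. orthonormal_basis E \<and> (\<lambda>e. T e \<bullet> e) summable_on E)"

section \<open>Gaussian measures\<close>

definition normal_law :: "real \<Rightarrow> real \<Rightarrow> real measure" where
  "normal_law a \<sigma> =
     (if \<sigma> = 0 then return borel a else density lborel (\<lambda>t. ennreal (normal_density a \<sigma> t)))"

definition gaussian_measure :: "'a::real_inner measure \<Rightarrow> bool" where
  "gaussian_measure \<mu> \<longleftrightarrow> prob_space \<mu> \<and> sets \<mu> = sets borel \<and>
     (\<forall>u. \<exists>a \<sigma>. 0 \<le> \<sigma> \<and> distr \<mu> borel (\<lambda>x. x \<bullet> u) = normal_law a \<sigma>)"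

definition has_mean :: "'a::real_inner measure \<Rightarrow> 'a \<Rightarrow> bool" where
  "has_mean \<mu> m \<longleftrightarrow> (\<forall>u. (LINT x|\<mu>. x \<bullet> u) = m \<bullet> u)"

definition has_covariance :: "'a::real_inner measure \<Rightarrow> 'a \<Rightarrow> ('a \<Rightarrow> 'a) \<Rightarrow> bool" where
  "has_covariance \<mu> m K \<longleftrightarrow>
     (\<forall>u w. (LINT x|\<mu>. ((x - m) \<bullet> u) * ((x - m) \<bullet> w)) = K u \<bullet> w)"

text \<open>
  The description determines a unique Borel measure on a separable Hilbert space whenever \<open>K\<close> is
  symmetric, nonnegative and trace class.
\<close>

definition gaussian :: "'a::real_inner \<Rightarrow> ('a \<Rightarrow> 'a) \<Rightarrow> 'a measure" where
  "gaussian m K = (THE \<mu>. gaussian_measure \<mu> \<and> has_mean \<mu> m \<and> has_covariance \<mu> m K)"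

section \<open>Kernels\<close>

definition pcn_proposal :: "('a::real_inner \<Rightarrow> 'a) \<Rightarrow> real \<Rightarrow> 'a \<Rightarrow> 'a measure" where
  "pcn_proposal C \<rho> x = gaussian (\<rho> *\<^sub>R x) (\<lambda>u. (1 - \<rho>\<^sup>2) *\<^sub>R C u)"

definition tilted :: "('a \<Rightarrow> real) \<Rightarrow> 'a measure \<Rightarrow> 'a measure" where
  "tilted \<Phi> \<mu> = density \<mu> (\<lambda>y. ennreal (exp (- \<Phi> y)) / (\<integral>\<^sup>+u. ennreal (exp (- \<Phi> u)) \<partial>\<mu>))"

definition pcn_infinity ::
  "('a::real_inner \<Rightarrow> 'a) \<Rightarrow> ('a \<Rightarrow> real) \<Rightarrow> real \<Rightarrow> real \<Rightarrow> 'a \<Rightarrow> 'a measure" where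
  "pcn_infinity C \<Phi> \<rho>1 \<rho>2 x0 =
     pcn_proposal C \<rho>2 x0 \<bind> (\<lambda>z. tilted \<Phi> (pcn_proposal C \<rho>1 z))"

fun kernel_power :: "('a::topological_space \<Rightarrow> 'a measure) \<Rightarrow> nat \<Rightarrow> 'a \<Rightarrow> 'a measure" where
  "kernel_power P 0 x = return borel x"
| "kernel_power P (Suc n) x = kernel_power P n x \<bind> P"

section \<open>Wasserstein distance\<close>

definition couplings ::
  "'a::topological_space measure \<Rightarrow> 'a measure \<Rightarrow> ('a \<times> 'a) measure set" where
  "couplings \<nu>1 \<nu>2 = {\<pi>. prob_space \<pi> \<and> sets \<pi> = sets (borel \<Otimes>\<^sub>M borel) \<and>
     distr \<pi> borel fst = \<nu>1 \<and> distr \<pi> borel snd = \<nu>2}"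

text \<open>The value \<open>\<infinity>\<close> occurs, e.g. if one of the measures does not integrate the cost.\<close>

definition wasserstein ::
  "('a::topological_space \<Rightarrow> 'a \<Rightarrow> real) \<Rightarrow> 'a measure \<Rightarrow> 'a measure \<Rightarrow> ennreal" where
  "wasserstein d \<nu>1 \<nu>2 =
     (INF \<pi>\<in>couplings \<nu>1 \<nu>2. \<integral>\<^sup>+p. ennreal (d (fst p) (snd p)) \<partial>\<pi>)"

definition d_eps :: "real \<Rightarrow> 'a::real_normed_vector \<Rightarrow> 'a \<Rightarrow> real" where
  "d_eps \<epsilon> x y = min 1 (norm (x - y) / \<epsilon>)"

definition d_tilde ::
  "('a::real_normed_vector \<Rightarrow> real) \<Rightarrow> real \<Rightarrow> 'a \<Rightarrow> 'a \<Rightarrow> real" where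
  "d_tilde V \<epsilon> x y = sqrt (d_eps \<epsilon> x y * (1 + V x + V y))"

end

theory Submission
  imports Defs
begin

text \<open>
  Write \<open>\<gamma> = N(0, C)\<close>. Since \<open>Q\<^sub>i(x, \<cdot>)\<close> is the law of \<open>\<rho>\<^sub>i x + sqrt (1 - \<rho>\<^sub>i\<^sup>2) \<xi>\<close> under \<open>\<gamma>\<close>, one step of
  the chain from \<open>x\<close> leads to \<open>\<rho> x + T w\<close> with \<open>\<rho> = \<rho>\<^sub>1 \<rho>\<^sub>2 < 1\<close>, where \<open>T\<close> is linear and the pair \<open>w\<close> of
  Gaussian innovations has a density \<open>p\<^sub>x\<close> with respect to \<open>\<gamma> \<otimes> \<gamma>\<close>. The starting point thus enters the
  displacement only through a contraction, and it enters the law of the innovations only mildly: the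
  Lipschitz property of \<open>\<Phi>\<close> gives \<open>exp (- c \<parallel>x - y\<parallel>) p\<^sub>x \<le> p\<^sub>y\<close>. This suggests a coupling: with probability
  \<open>a = exp (- c r)\<close>, \<open>r = \<parallel>x - y\<parallel>\<close>, both chains use the same innovation and their distance shrinks to \<open>\<rho> r\<close>;
  otherwise the second chain draws its innovation independently from what is left of \<open>p\<^sub>y\<close>.

  The distance \<open>h r = 1 - exp (- c' r)\<close> with \<open>c' = 2 c / (1 - \<rho>)\<close> is adapted to this coupling. One step
  turns it into at most \<open>a h (\<rho> r) + (1 - a) = h (\<kappa> r)\<close> with \<open>\<kappa> = (1 + \<rho>) / 2 < 1\<close>; hence \<open>h\<close> never
  increases in mean, and it contracts strictly and uniformly on bounded sets. The two facts replace both
  the local contraction and the smallness of bounded sets in a weak Harris theorem, and since \<open>h\<close> is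
  equivalent to \<open>d_eps \<epsilon>\<close> for each \<open>\<epsilon>\<close>, any \<open>\<epsilon>\<close> can be treated.

  Far away from the origin the weight \<open>V\<close> contracts instead. All admissible \<open>V\<close> have the form
  \<open>f \<parallel>x\<parallel>\<close> with \<open>f\<close> convex and increasing, so \<open>V (\<rho> x + T w) \<le> \<rho> V x + (1 - \<rho>) f (\<parallel>T w\<parallel> / (1 - \<rho>))\<close>, where
  the last term has a mean bounded in \<open>x\<close> by the square-exponential integrability of \<open>\<gamma>\<close>. By the
  Cauchy-Schwarz inequality, \<open>sqrt (h (1 + \<beta> V x + \<beta> V y))\<close> is contracted in one step once \<open>\<beta>\<close> is small
  (\<open>weighted_gap_contraction\<close>). Iterating the coupling and comparing this distance with \<open>d_tilde V \<epsilon>\<close>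
  costs a constant factor only, which a slightly larger rate absorbs for all large \<open>n\<close>
  (\<open>wasserstein_geometric_decay\<close>).

  Before this, the Gaussian measure has to be shown to exist and to be unique.
  Uniqueness is the Cramer-Wold principle (\<open>measure_eqI_projections\<close>). For existence, a Cholesky
  factorization along an orthonormal basis writes \<open>C u \<bullet> u\<close> as \<open>\<Sum>\<^sub>j (g\<^sub>j \<bullet> u)\<^sup>2\<close> with \<open>\<Sum>\<^sub>j \<parallel>g\<^sub>j\<parallel>\<^sup>2\<close> bounded by the
  trace, and \<open>\<gamma>\<close> is the law of \<open>\<Sum>\<^sub>j \<omega>\<^sub>j g\<^sub>j\<close> for independent standard normal \<open>\<omega>\<^sub>j\<close>
  (\<open>random_series_exists\<close>). Integrability follows from Jensen's inequality along the same basis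
  (\<open>Fernique_bound\<close>).
\<close>

section \<open>One-dimensional normal laws\<close>

lemma prob_space_std_normal: "prob_space std_normal_distribution"
  using real_dist_normal_dist by (simp add: real_distribution_def)

lemma normal_law_affine:
  assumes "0 \<le> \<sigma>"
  shows "normal_law a \<sigma> = distr std_normal_distribution borel (\<lambda>t. a + \<sigma> * t)"
proof (cases "\<sigma> = 0")
  case True
  interpret prob_space std_normal_distribution by (rule prob_space_std_normal)
  show ?thesis unfolding normal_law_def using True
    by (simp add: distr_const)
next
  case False
  interpret prob_space std_normal_distribution by (rule prob_space_std_normal)
  have "distributed std_normal_distribution lborel (\<lambda>t. t) std_normal_density"
    by (auto simp: distributed_def intro!: distr_id2)
  from normal_density_affine[OF this, of \<sigma> a] False assms
  have "distr std_normal_distribution lborel (\<lambda>t. a + \<sigma> * t) = density lborel (normal_density a \<sigma>)"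
    by (auto simp: distributed_def)
  moreover have "distr std_normal_distribution lborel (\<lambda>t. a + \<sigma> * t)
     = distr std_normal_distribution borel (\<lambda>t. a + \<sigma> * t)"
    by (intro distr_cong) auto
  ultimately show ?thesis using False by (simp add: normal_law_def)
qed

lemma char_normal_law:
  assumes "0 \<le> \<sigma>"
  shows "char (normal_law a \<sigma>) t = iexp (t * a) * exp (- (\<sigma> * t)\<^sup>2 / 2)"
proof -
  have "char (normal_law a \<sigma>) t = (CLINT x|std_normal_distribution. iexp (t * a) * iexp ((t * \<sigma>) * x))"
    unfolding char_def normal_law_affine[OF assms]
    by (subst integral_distr) (auto simp: exp_add[symmetric] algebra_simps)
  also have "\<dots> = iexp (t * a) * char std_normal_distribution (t * \<sigma>)"
    unfolding char_def by simp
  also have "\<dots> = iexp (t * a) * exp (- (\<sigma> * t)\<^sup>2 / 2)"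
    by (simp add: char_std_normal_distribution mult.commute exp_of_real[symmetric])
  finally show ?thesis .
qed

lemma integrable_std_normal_moments:
  shows "integrable std_normal_distribution (\<lambda>x. x)" "integrable std_normal_distribution (\<lambda>x. x\<^sup>2)"
    "(LINT x|std_normal_distribution. x) = 0" "(LINT x|std_normal_distribution. x\<^sup>2) = 1"
  using integrable_std_normal_distribution_moment[of 1] integrable_std_normal_distribution_moment[of 2]
    integral_std_normal_distribution_moment_odd[of 1] std_normal_distribution_even_moments(1)[of 1]
  by auto

section \<open>Measures are determined by their one-dimensional projections\<close>

inductive_set cylinders :: "'a::real_inner set set" where
  cylinders_UNIV: "UNIV \<in> cylinders"
| cylinders_restrict: "W \<in> cylinders \<Longrightarrow> A \<in> sets (borel :: real measure) \<Longrightarrow> W \<inter> {x. x \<bullet> f \<in> A} \<in> cylinders"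

text \<open>
  Adding the half-space conditions one at a time makes every statement about cylinders, including
  stability under intersection, a one-step induction.
\<close>

lemma Int_stable_cylinders: "Int_stable cylinders"
proof (rule Int_stableI)
  fix U W :: "'a set" assume U: "U \<in> cylinders" and W: "W \<in> cylinders"
  from W show "U \<inter> W \<in> cylinders"
    by induction (use U in \<open>auto simp: Int_assoc[symmetric] intro: cylinders_restrict\<close>)
qed

lemma cylinders_borel:
  fixes W :: "'a::{real_inner, second_countable_topology} set"
  assumes "W \<in> cylinders" shows "W \<in> sets borel"
  using assms by induction auto

text \<open>
  Duality with countably many test vectors, which is what makes balls measurable with respect to
  countably many functionals.
\<close>

lemma norm_le_iff_dense:
  fixes D :: "'a::real_inner set"
  assumes D: "\<And>X. open X \<Longrightarrow> X \<noteq> {} \<Longrightarrow> \<exists>d\<in>D. d \<in> X" and "0 \<le> r"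
  shows "norm y \<le> r \<longleftrightarrow> (\<forall>d\<in>D. y \<bullet> d \<le> r * norm d)"
proof
  assume "norm y \<le> r"
  then show "\<forall>d\<in>D. y \<bullet> d \<le> r * norm d"
    by (meson mult_right_mono norm_cauchy_schwarz norm_ge_zero order_trans)
next
  assume *: "\<forall>d\<in>D. y \<bullet> d \<le> r * norm d"
  have "closed {d. y \<bullet> d \<le> r * norm d}"
    by (intro closed_Collect_le continuous_intros)
  then have "{d. y \<bullet> d \<le> r * norm d} = UNIV"
    using D[of "- {d. y \<bullet> d \<le> r * norm d}"] * by (auto simp: open_closed)
  then have "y \<bullet> y \<le> r * norm y" by auto
  then show "norm y \<le> r" using assms(2)
    by (cases "norm y = 0") (auto simp: dot_square_norm power2_eq_square)
qed

lemma sigma_sets_cylinders: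
  "sets (borel :: 'a::{real_inner, second_countable_topology} measure) = sigma_sets UNIV cylinders"
proof
  let ?M = "sigma UNIV (cylinders :: 'a set set)"
  have sM: "sets ?M = sigma_sets UNIV cylinders" "space ?M = UNIV"
    by auto
  interpret M: sigma_algebra UNIV "sigma_sets UNIV (cylinders :: 'a set set)"
    by (rule sigma_algebra_sigma_sets) auto
  obtain D :: "'a set" where D: "countable D" "\<And>X. open X \<Longrightarrow> X \<noteq> {} \<Longrightarrow> \<exists>d\<in>D. d \<in> X"
    using countable_dense_exists by blast
  have half: "{x. x \<bullet> f \<le> c} \<in> sigma_sets UNIV cylinders" for f :: 'a and c
    using cylinders_restrict[OF cylinders_UNIV, of "{..c}" f] by auto
  have cb: "cball a r \<in> sigma_sets UNIV cylinders" if "0 \<le> r" for a :: 'a and r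
  proof -
    have "cball a r = (\<Inter>d\<in>D. {x. x \<bullet> d \<le> r * norm d + a \<bullet> d})"
    proof -
      have "x \<in> cball a r \<longleftrightarrow> x \<in> (\<Inter>d\<in>D. {x. x \<bullet> d \<le> r * norm d + a \<bullet> d})" for x
        using norm_le_iff_dense[OF D(2) that, of "x - a"]
        by (simp add: dist_norm norm_minus_commute inner_diff_left algebra_simps)
      then show ?thesis by blast
    qed
    also have "\<dots> \<in> sigma_sets UNIV cylinders"
      using half D by (cases "D = {}") (auto intro!: M.countable_INT'')
    finally show ?thesis .
  qed
  show "sets (borel :: 'a measure) \<subseteq> sigma_sets UNIV cylinders"
    unfolding sets_borel
  proof (rule sigma_sets_mono, safe)
    fix U :: "'a set" assume U: "open U"
    let ?I = "{(a, r). a \<in> D \<and> r \<in> \<rat> \<and> 0 \<le> r \<and> cball a r \<subseteq> U}"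
    have cI: "countable ?I"
      by (rule countable_subset[of _ "D \<times> \<rat>"]) (use D countable_rat in auto)
    have "U = (\<Union>(a, r)\<in>?I. cball a r)"
    proof safe
      fix x assume "x \<in> U"
      with U obtain e where e: "0 < e" "ball x e \<subseteq> U"
        using openE by blast
      obtain q where q: "q \<in> \<rat>" "e / 3 < q" "q < e / 2"
        using Rats_dense_in_real[of "e/3" "e/2"] e by auto
      obtain d where d: "d \<in> D" "d \<in> ball x (e/3)"
        using D(2)[of "ball x (e/3)"] e by auto
      have "cball d q \<subseteq> ball x e"
      proof
        fix z assume "z \<in> cball d q"
        then show "z \<in> ball x e" using d q dist_triangle[of x z d] by auto
      qed
      then have "(d, q) \<in> ?I" "x \<in> cball d q" using d q e by (auto simp: dist_commute)
      then show "x \<in> (\<Union>(a, r)\<in>?I. cball a r)" by blast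
    qed auto
    also have "\<dots> \<in> sigma_sets UNIV cylinders"
      using cb by (intro M.countable_UN'' cI) auto
    finally show "U \<in> sigma_sets UNIV cylinders" .
  qed
  show "sigma_sets UNIV cylinders \<subseteq> sets (borel :: 'a measure)"
    using sets.sigma_sets_subset[of cylinders "borel :: 'a measure"] cylinders_borel by auto
qed


lemma complex_integral_eqI:
  assumes "integrable M f" "integrable N g"
    and "(LINT x|M. Re (f x)) = (LINT x|N. Re (g x))" "(LINT x|M. Im (f x)) = (LINT x|N. Im (g x))"
  shows "(CLINT x|M. f x) = (CLINT x|N. g x)"
  using assms by (intro complex_eqI) auto

text \<open>
  Levy's uniqueness theorem for the law of \<open>X\<close> under the finite measure with density \<open>w\<close>. Its complex
  characteristic function is encoded by real cosines with a phase, sine being the phase \<open>- pi / 2\<close>; the total mass is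
  the case \<open>t = c = 0\<close>, so both measures can be normalized by the same constant.
\<close>

lemma weighted_law_eqI:
  fixes w X :: "'a \<Rightarrow> real"
  assumes mu: "prob_space \<mu>" "prob_space \<nu>" and sets: "sets \<mu> = sets M" "sets \<nu> = sets M"
    and [measurable]: "w \<in> borel_measurable M" "X \<in> borel_measurable M"
    and w: "\<And>x. 0 \<le> w x" "\<And>x. w x \<le> B"
    and eq: "\<And>t c. (LINT x|\<mu>. w x * cos (t * X x + c)) = (LINT x|\<nu>. w x * cos (t * X x + c))"
    and A[measurable]: "A \<in> sets borel"
  shows "(LINT x|\<mu>. w x * indicator A (X x)) = (LINT x|\<nu>. w x * indicator A (X x))"
proof -
  note [measurable_cong] = sets
  interpret m: prob_space \<mu> by fact
  interpret n: prob_space \<nu> by fact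
  have iw: "integrable \<mu> (\<lambda>x. w x * g x)" "integrable \<nu> (\<lambda>x. w x * g x)"
    if [measurable]: "g \<in> borel_measurable M" and "\<And>x. \<bar>g x\<bar> \<le> 1" for g :: "'a \<Rightarrow> real"
  proof -
    have "\<bar>w x * g x\<bar> \<le> B" for x
      using w[of x] that(2)[of x] by (simp add: abs_mult) (metis abs_ge_zero mult_left_le order_trans)
    then show "integrable \<mu> (\<lambda>x. w x * g x)" "integrable \<nu> (\<lambda>x. w x * g x)"
      by (auto intro!: m.integrable_const_bound[where B=B] n.integrable_const_bound[where B=B])
  qed
  have iw1: "integrable \<mu> w" "integrable \<nu> w" using iw[of "\<lambda>_. 1"] by auto
  define m where "m = (LINT x|\<mu>. w x)"
  have m': "m = (LINT x|\<nu>. w x)" using eq[of 0 0] by (simp add: m_def)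
  have m0: "0 \<le> m" unfolding m_def using w by simp
  show ?thesis
  proof (cases "m = 0")
    case True
    have "AE x in \<mu>. w x = 0" "AE x in \<nu>. w x = 0"
      using True m' w iw1 integral_nonneg_eq_0_iff_AE[of \<mu> w] integral_nonneg_eq_0_iff_AE[of \<nu> w]
      by (simp_all add: m_def)
    then have "(LINT x|\<mu>. w x * indicator A (X x)) = (LINT x|\<mu>. 0)"
       "(LINT x|\<nu>. w x * indicator A (X x)) = (LINT x|\<nu>. 0)"
      by (intro integral_cong_AE; auto)+
    then show ?thesis by simp
  next
    case False
    with m0 have m: "0 < m" by simp
    define L where "L \<mu>' = distr (density \<mu>' (\<lambda>x. ennreal (w x / m))) borel X" for \<mu>'
    have rd: "real_distribution (L \<mu>')" 
      if [measurable_cong]: "sets \<mu>' = sets M" and "m = (LINT x|\<mu>'. w x)" "integrable \<mu>' w" for \<mu>'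
    proof -
      have "(\<integral>\<^sup>+x. ennreal (w x / m) \<partial>\<mu>') = ennreal (LINT x|\<mu>'. w x / m)"
        using that w m by (intro nn_integral_eq_integral) auto
      moreover have "emeasure (density \<mu>' (\<lambda>x. ennreal (w x / m))) (space \<mu>') = (\<integral>\<^sup>+x. ennreal (w x / m) \<partial>\<mu>')"
        by (subst emeasure_density) (auto intro!: nn_integral_cong)
      ultimately have "prob_space (density \<mu>' (\<lambda>x. ennreal (w x / m)))"
        using that m by (intro prob_spaceI) simp
      then show ?thesis unfolding L_def
        by (auto simp: real_distribution_def real_distribution_axioms_def intro!: prob_space.prob_space_distr)
    qed
    have char: "char (L \<mu>') t = (CLINT x|\<mu>'. (w x / m) *\<^sub>R iexp (t * X x))"
      if [measurable_cong]: "sets \<mu>' = sets M" for \<mu>' t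
      unfolding char_def L_def using w m
      by (simp add: integral_distr integral_density)
    have "L \<mu> = L \<nu>"
    proof (rule Levy_uniqueness)
      show "real_distribution (L \<mu>)" "real_distribution (L \<nu>)"
        using rd sets iw1 m_def m' by auto
      show "char (L \<mu>) = char (L \<nu>)"
      proof
        fix t
        have b: "norm ((w x / m) *\<^sub>R iexp (t * X x)) \<le> B / m" for x
          using w[of x] m by (simp add: divide_right_mono)
        have sin: "w x / m * sin (t * X x) = (1/m) * (w x * cos (t * X x + (- pi / 2)))"
          and cos: "w x / m * cos (t * X x) = (1/m) * (w x * cos (t * X x + 0))" for x
          by (simp_all add: cos_diff)
        have "(LINT x|\<mu>. w x / m * cos (t * X x)) = (LINT x|\<nu>. w x / m * cos (t * X x))"
          "(LINT x|\<mu>. w x / m * sin (t * X x)) = (LINT x|\<nu>. w x / m * sin (t * X x))"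
          unfolding sin cos integral_mult_right_zero eq by auto
        then show "char (L \<mu>) t = char (L \<nu>) t"
          unfolding char[OF sets(1)] char[OF sets(2)]
          by (intro complex_integral_eqI m.integrable_const_bound[where B="B/m"] 
              n.integrable_const_bound[where B="B/m"] AE_I2 b)
             (auto simp: Re_exp Im_exp)
      qed
    qed
    have "measure (L \<mu>') A = (1/m) * (LINT x|\<mu>'. w x * indicator A (X x))" 
      if [measurable_cong]: "sets \<mu>' = sets M" and i: "integrable \<mu>' (\<lambda>x. w x * indicator A (X x))" for \<mu>'
    proof -
      have "emeasure (L \<mu>') A = (\<integral>\<^sup>+x. ennreal ((1/m) * (w x * indicator A (X x))) \<partial>\<mu>')"
        unfolding L_def using w m
        by (subst emeasure_distr) (auto simp: emeasure_density intro!: nn_integral_cong split: split_indicator)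
      also have "\<dots> = ennreal (LINT x|\<mu>'. (1/m) * (w x * indicator A (X x)))"
        using w m i by (intro nn_integral_eq_integral) auto
      finally show ?thesis using w m by (simp add: measure_def integral_nonneg_AE)
    qed
    from this[OF sets(1)] this[OF sets(2)]
    have "measure (L \<mu>) A = (1/m) * (LINT x|\<mu>. w x * indicator A (X x))"
      "measure (L \<nu>) A = (1/m) * (LINT x|\<nu>. w x * indicator A (X x))"
      using iw[of "\<lambda>x. indicator A (X x)"] by simp_all
    with \<open>L \<mu> = L \<nu>\<close> m show ?thesis by simp
  qed
qed

text \<open>
  The Cramer-Wold principle. Conditions \<open>x \<bullet> f \<in> A\<close> are imposed one after the other while the
  agreement of all \<open>\<integral>\<^sub>W cos (x \<bullet> u + c)\<close> is maintained. To pass from \<open>W\<close> to \<open>W \<inter> {x. x \<bullet> f \<in> A}\<close>, Levy's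
  theorem is applied to the projection on \<open>f\<close> under the weight \<open>1 + cos (x \<bullet> u + c)\<close> on \<open>W\<close>: the constant \<open>1\<close> makes
  the weight nonnegative, and the products of cosines that arise are sums of cosines of new projections.
\<close>

theorem measure_eqI_projections:
  fixes \<mu> \<nu> :: "'a::{real_inner, second_countable_topology} measure"
  assumes mu: "prob_space \<mu>" "prob_space \<nu>" and sets: "sets \<mu> = sets borel" "sets \<nu> = sets borel"
    and proj: "\<And>u. distr \<mu> borel (\<lambda>x. x \<bullet> u) = distr \<nu> borel (\<lambda>x. x \<bullet> u)"
  shows "\<mu> = \<nu>"
proof -
  note [measurable_cong] = sets
  interpret m: prob_space \<mu> by fact
  interpret n: prob_space \<nu> by fact
  have ii: "integrable \<mu> f" "integrable \<nu> f" 
    if "f \<in> borel_measurable borel" "\<And>x. \<bar>f x\<bar> \<le> b" for b and f :: "'a \<Rightarrow> real"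
    using that by (auto intro!: m.integrable_const_bound[where B=b] n.integrable_const_bound[where B=b])
  have main: "(LINT x|\<mu>. indicator W x * cos (x \<bullet> u + c)) = (LINT x|\<nu>. indicator W x * cos (x \<bullet> u + c))"
    if "W \<in> cylinders" for W :: "'a set" and u c
    using that
  proof (induction arbitrary: u c)
    case cylinders_UNIV
    have "(LINT x|\<mu>. cos (x \<bullet> u + c)) = (LINT t|distr \<mu> borel (\<lambda>x. x \<bullet> u). cos (t + c))"
      by (subst integral_distr) auto
    also have "\<dots> = (LINT x|\<nu>. cos (x \<bullet> u + c))"
      unfolding proj by (subst integral_distr) auto
    finally show ?case by simp
  next
    case (cylinders_restrict W A f)
    have [measurable]: "W \<in> sets borel" "A \<in> sets borel"
      using cylinders_borel cylinders_restrict by auto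
    have key: "(LINT x|\<mu>. indicator W x * (1 + cos (x \<bullet> u + c)) * indicator A (x \<bullet> f))
      = (LINT x|\<nu>. indicator W x * (1 + cos (x \<bullet> u + c)) * indicator A (x \<bullet> f))" for u c
    proof (rule weighted_law_eqI[OF mu sets, where B=2])
      show "0 \<le> indicator W x * (1 + cos (x \<bullet> u + c))" for x
        using cos_ge_minus_one[of "x \<bullet> u + c"] by (auto simp: indicator_def simp del: cos_ge_minus_one)
      show "indicator W x * (1 + cos (x \<bullet> u + c)) \<le> 2" for x
        using cos_le_one[of "x \<bullet> u + c"] by (auto split: split_indicator)
      fix t d
      have e: "indicator W x * (1 + cos (x \<bullet> u + c)) * cos (t * (x \<bullet> f) + d)
        = indicator W x * cos (x \<bullet> (t *\<^sub>R f) + d) +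
          ((1/2) * (indicator W x * cos (x \<bullet> (u - t *\<^sub>R f) + (c - d))) 
         + (1/2) * (indicator W x * cos (x \<bullet> (u + t *\<^sub>R f) + (c + d))))" for x
      proof -
        have "cos (x \<bullet> u + c) * cos (t * (x \<bullet> f) + d) =
          (cos (x \<bullet> u + c - (t * (x \<bullet> f) + d)) + cos (x \<bullet> u + c + (t * (x \<bullet> f) + d))) / 2"
          by (rule cos_times_cos)
        then show ?thesis by (simp add: indicator_def inner_diff_right inner_add_right algebra_simps)
      qed
      have I: "integrable \<mu> (\<lambda>x. indicator W x * cos (x \<bullet> v + c))" "integrable \<nu> (\<lambda>x. indicator W x * cos (x \<bullet> v + c))" for v c
        by (intro ii[of _ 1]; auto split: split_indicator)+
      show "(LINT x|\<mu>. indicator W x * (1 + cos (x \<bullet> u + c)) * cos (t * (x \<bullet> f) + d)) =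
          (LINT x|\<nu>. indicator W x * (1 + cos (x \<bullet> u + c)) * cos (t * (x \<bullet> f) + d))"
        unfolding e using I cylinders_restrict.IH by (simp del: inner_scaleR_right)
    qed auto
    have c2: "\<bar>1 + cos y\<bar> \<le> 2" for y :: real
      using cos_ge_minus_one[of y] cos_le_one[of y] by linarith
    have I: "integrable \<mu> (\<lambda>x. indicator W x * (1 + cos (x \<bullet> u + c)) * indicator A (x \<bullet> f))"
       "integrable \<nu> (\<lambda>x. indicator W x * (1 + cos (x \<bullet> u + c)) * indicator A (x \<bullet> f))" for u c
      using c2 by (intro ii[of _ 2]; simp add: indicator_def)+
    \<comment> \<open>The added constant is removed again with the choice \<open>u = 0\<close>, \<open>c = 0\<close>, where the weight is \<open>2\<close> on \<open>W\<close>.\<close>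
    have e: "indicator (W \<inter> {x. x \<bullet> f \<in> A}) x * cos (x \<bullet> u + c) =
      indicator W x * (1 + cos (x \<bullet> u + c)) * indicator A (x \<bullet> f) - 
      (1/2) * (indicator W x * (1 + cos (x \<bullet> 0 + 0)) * indicator A (x \<bullet> f))" for x :: 'a
      by (auto split: split_indicator)
    note I0 = I[of 0 0] and key0 = key[of 0 0]
    show ?case unfolding e
      by (subst (1 2) Bochner_Integration.integral_diff)
         (simp_all only: I I0 integrable_mult_right integral_mult_right_zero key key0)
  qed
  have "emeasure \<mu> W = emeasure \<nu> W" if "W \<in> cylinders" for W
    using main[OF that, of 0 0] cylinders_borel[OF that]
    by (simp add: m.emeasure_eq_measure n.emeasure_eq_measure sets)
  then show ?thesis
    using sets sigma_sets_cylinders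
    by (intro measure_eqI_generator_eq[OF Int_stable_cylinders, of UNIV _ _ "\<lambda>_. UNIV"])
       (auto intro: cylinders_UNIV)
qed

section \<open>Cholesky factorization of a covariance operator\<close>

definition psd_operator :: "('a::real_inner \<Rightarrow> 'a) \<Rightarrow> bool" where
  "psd_operator R \<longleftrightarrow> linear R \<and> symmetric_operator R \<and> (\<forall>x. 0 \<le> R x \<bullet> x)"

lemma psd_operatorD:
  assumes "psd_operator R"
  shows "linear R" "R x \<bullet> y = R y \<bullet> x" "0 \<le> R x \<bullet> x"
  using assms by (auto simp: psd_operator_def symmetric_operator_def inner_commute)

text \<open>
  The quadratic form of \<open>R\<close> is nonnegative along the line \<open>u + t w\<close>, hence its discriminant is not positive.
\<close>

lemma psd_Cauchy_Schwarz:
  assumes R: "psd_operator R"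
  shows "(R u \<bullet> w)\<^sup>2 \<le> (R u \<bullet> u) * (R w \<bullet> w)"
proof -
  note lin = psd_operatorD(1)[OF R]
  have q: "0 \<le> R w \<bullet> w * t\<^sup>2 + 2 * t * (R u \<bullet> w) + R u \<bullet> u" for t
  proof -
    have "R (u + t *\<^sub>R w) \<bullet> (u + t *\<^sub>R w) = R w \<bullet> w * t\<^sup>2 + 2 * t * (R u \<bullet> w) + R u \<bullet> u"
      using psd_operatorD(2)[OF R, of w u]
      by (simp add: linear_add[OF lin] linear_scale[OF lin] inner_add_left inner_add_right algebra_simps power2_eq_square)
    then show ?thesis using psd_operatorD(3)[OF R, of "u + t *\<^sub>R w"] by simp
  qed
  show ?thesis
  proof (cases "R w \<bullet> w = 0")
    case True
    have "R u \<bullet> w = 0"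
    proof (rule ccontr)
      assume "R u \<bullet> w \<noteq> 0"
      with q[of "- (R u \<bullet> u + 1) / (2 * (R u \<bullet> w))"] True show False
        by (simp add: field_simps)
    qed
    then show ?thesis using True by simp
  next
    case False
    then have p: "0 < R w \<bullet> w" using psd_operatorD(3)[OF R, of w] by simp
    have "0 \<le> R w \<bullet> w * (R w \<bullet> w * (- (R u \<bullet> w) / (R w \<bullet> w))\<^sup>2 + 2 * (- (R u \<bullet> w) / (R w \<bullet> w)) * (R u \<bullet> w) + R u \<bullet> u)"
      by (intro mult_nonneg_nonneg q) (use p in auto)
    also have "\<dots> = (R u \<bullet> u) * (R w \<bullet> w) - (R u \<bullet> w)\<^sup>2"
      using p by (simp add: field_simps power2_eq_square)
    finally show ?thesis by simp
  qed
qed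

lemma psd_kernel:
  assumes "psd_operator R" "R e \<bullet> e = 0" shows "R e = 0"
  using psd_Cauchy_Schwarz[OF assms(1), of e "R e"] assms(2) by simp

text \<open>
  Gaussian elimination along the vectors \<open>e 0, e 1, \<dots>\<close>: each step subtracts the rank-one form that
  agrees with the current one on \<open>e n\<close>, which puts \<open>e n\<close> into the kernel. If \<open>e n\<close> is already in the kernel, the quotient
  has denominator \<open>0\<close> and therefore value \<open>0\<close>, so that nothing is subtracted.
\<close>

primrec cholesky_rest :: "('a::real_inner \<Rightarrow> 'a) \<Rightarrow> (nat \<Rightarrow> 'a) \<Rightarrow> nat \<Rightarrow> 'a \<Rightarrow> 'a" where
  "cholesky_rest C e 0 = C"
| "cholesky_rest C e (Suc n) = (\<lambda>u. cholesky_rest C e n u -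
     ((cholesky_rest C e n (e n) \<bullet> u) / (cholesky_rest C e n (e n) \<bullet> e n)) *\<^sub>R cholesky_rest C e n (e n))"

definition cholesky :: "('a::real_inner \<Rightarrow> 'a) \<Rightarrow> (nat \<Rightarrow> 'a) \<Rightarrow> nat \<Rightarrow> 'a" where
  "cholesky C e n = (1 / sqrt (cholesky_rest C e n (e n) \<bullet> e n)) *\<^sub>R cholesky_rest C e n (e n)"

lemma psd_cholesky_step:
  assumes R: "psd_operator R"
  shows "psd_operator (\<lambda>u. R u - ((R e \<bullet> u) / (R e \<bullet> e)) *\<^sub>R R e)"
  unfolding psd_operator_def symmetric_operator_def
proof (intro conjI allI)
  note lin = psd_operatorD(1)[OF R]
  show "linear (\<lambda>u. R u - ((R e \<bullet> u) / (R e \<bullet> e)) *\<^sub>R R e)"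
    by (rule linearI) (simp_all add: linear_add[OF lin] linear_scale[OF lin] inner_add_right 
        add_divide_distrib scaleR_left_distrib scaleR_right_diff_distrib)
  show "(R x - ((R e \<bullet> x) / (R e \<bullet> e)) *\<^sub>R R e) \<bullet> y = x \<bullet> (R y - ((R e \<bullet> y) / (R e \<bullet> e)) *\<^sub>R R e)" for x y
    using psd_operatorD(2)[OF R, of x y] by (simp add: inner_diff_left inner_diff_right inner_commute)
  show "0 \<le> (R x - ((R e \<bullet> x) / (R e \<bullet> e)) *\<^sub>R R e) \<bullet> x" for x
  proof (cases "R e \<bullet> e = 0")
    case True then show ?thesis using psd_operatorD(3)[OF R, of x] by simp
  next
    case False
    then have p: "0 < R e \<bullet> e" using psd_operatorD(3)[OF R, of e] by simp
    then show ?thesis using psd_Cauchy_Schwarz[OF R, of e x] 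
      by (simp add: inner_diff_left field_simps power2_eq_square)
  qed
qed

lemma psd_cholesky_rest: "psd_operator C \<Longrightarrow> psd_operator (cholesky_rest C e n)"
  by (induction n) (auto intro: psd_cholesky_step)

lemma cholesky_rest_kernel:
  assumes "psd_operator C" "k < n"
  shows "cholesky_rest C e n (e k) = 0"
  using assms(2)
proof (induction n)
  case (Suc n)
  let ?R = "cholesky_rest C e n"
  note R = psd_cholesky_rest[OF assms(1), of e n]
  show ?case
  proof (cases "k = n")
    case True
    then show ?thesis using psd_kernel[OF R, of "e n"] by (cases "?R (e n) \<bullet> e n = 0") auto
  next
    case False
    then have "?R (e k) = 0" using Suc by simp
    then show ?thesis using psd_operatorD(2)[OF R, of "e n" "e k"] by simp
  qed
qed simp

lemma cholesky_decomposition: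
  assumes "psd_operator C"
  shows "C u \<bullet> w = (\<Sum>j<n. (cholesky C e j \<bullet> u) * (cholesky C e j \<bullet> w)) + cholesky_rest C e n u \<bullet> w"
proof (induction n)
  case (Suc n)
  let ?R = "cholesky_rest C e n"
  have "0 \<le> ?R (e n) \<bullet> e n" using psd_operatorD(3)[OF psd_cholesky_rest[OF assms]] .
  then have "(cholesky C e n \<bullet> u) * (cholesky C e n \<bullet> w) = ((?R (e n) \<bullet> u) / (?R (e n) \<bullet> e n)) * (?R (e n) \<bullet> w)"
    by (simp add: cholesky_def)
  then show ?case using Suc by (simp add: inner_diff_left)
qed simp

text \<open>
  The remainder vanishes eventually at each vector of the span, and it is dominated by the bounded
  form of \<open>C\<close>; so it tends to \<open>0\<close> on the closure of the span.
\<close>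

lemma cholesky_sums:
  fixes e :: "nat \<Rightarrow> 'a::real_inner"
  assumes C: "psd_operator C" "bounded_linear C" and e: "closure (span (range e)) = UNIV"
  shows "(\<lambda>j. (cholesky C e j \<bullet> u)\<^sup>2) sums (C u \<bullet> u)"
proof -
  let ?R = "cholesky_rest C e"
  note R = psd_cholesky_rest[OF C(1), of e]
  obtain B where B: "0 < B" "\<And>x. norm (C x) \<le> norm x * B"
    using bounded_linear.pos_bounded[OF C(2)] by blast
  have le: "?R n x \<bullet> x \<le> B * (norm x)\<^sup>2" for n x
  proof -
    have "?R n x \<bullet> x \<le> C x \<bullet> x"
      using cholesky_decomposition[OF C(1), of x x e n] by (simp add: sum_nonneg)
    also have "\<dots> \<le> norm (C x) * norm x" by (rule norm_cauchy_schwarz)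
    also have "\<dots> \<le> (norm x * B) * norm x" by (intro mult_right_mono B) auto
    finally show ?thesis by (simp add: power2_eq_square mult_ac)
  qed
  have ev: "\<exists>N. \<forall>n\<ge>N. ?R n v = 0" if "v \<in> span (range e)" for v
    using that
  proof (induction rule: span_induct_alt)
    case base then show ?case using linear_0[OF psd_operatorD(1)[OF R]] by auto
  next
    case (step c x y)
    then obtain k N where "x = e k" "\<forall>n\<ge>N. ?R n y = 0" by auto
    then have "\<forall>n\<ge>max N (Suc k). ?R n (c *\<^sub>R x + y) = 0"
      using cholesky_rest_kernel[OF C(1)] psd_operatorD(1)[OF R]
      by (auto simp: linear_add linear_scale)
    then show ?case by blast
  qed
  have "(\<lambda>n. ?R n u \<bullet> u) \<longlonglongrightarrow> 0"
  proof (rule LIMSEQ_I)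
    fix r :: real assume r: "0 < r"
    define d where "d = sqrt (r / (2 * B))"
    have d: "0 < d" "B * d\<^sup>2 < r" using r B by (auto simp: d_def field_simps)
    obtain v where v: "v \<in> span (range e)" "dist v u < d"
      using e d closure_approachable[of u "span (range e)"] by auto
    then obtain N where N: "\<And>n. n \<ge> N \<Longrightarrow> ?R n v = 0" using ev by blast
    show "\<exists>N. \<forall>n\<ge>N. norm (?R n u \<bullet> u - 0) < r"
    proof (intro exI allI impI)
      fix n assume n: "N \<le> n"
      \<comment> \<open>By symmetry a vector \<open>v\<close> of the kernel can be subtracted in both arguments of the form.\<close>
      have "?R n u = ?R n (u - v)" using N[OF n] linear_diff[OF psd_operatorD(1)[OF R]] by simp
      then have "?R n u \<bullet> u = ?R n (u - v) \<bullet> (u - v)"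
        using N[OF n] psd_operatorD(2)[OF R, of n "u - v" v] by (simp add: inner_diff_right)
      also have "\<dots> \<le> B * (norm (u - v))\<^sup>2" by (rule le)
      also have "\<dots> \<le> B * d\<^sup>2"
        using v B d by (intro mult_left_mono power_mono) (auto simp: dist_norm norm_minus_commute)
      finally show "norm (?R n u \<bullet> u - 0) < r"
        using d psd_operatorD(3)[OF R, of n u] by simp
    qed
  qed
  then have "(\<lambda>n. C u \<bullet> u - ?R n u \<bullet> u) \<longlonglongrightarrow> C u \<bullet> u - 0" by (intro tendsto_intros)
  moreover have "(\<Sum>j<n. (cholesky C e j \<bullet> u)\<^sup>2) = C u \<bullet> u - ?R n u \<bullet> u" for n
    using cholesky_decomposition[OF C(1), of u u e n] by (simp add: power2_eq_square)
  ultimately show ?thesis unfolding sums_def by simp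
qed

text \<open>
  Elimination applied to the identity along an orthonormal sequence returns the sequence itself.
  Vectors equal to \<open>0\<close> are allowed, so that finite bases can be padded.
\<close>

lemma Parseval_sums:
  fixes e :: "nat \<Rightarrow> 'a::real_inner"
  assumes ortho: "\<And>i j. i \<noteq> j \<Longrightarrow> e i \<bullet> e j = 0" and nrm: "\<And>i. e i \<noteq> 0 \<Longrightarrow> norm (e i) = 1"
    and dense: "closure (span (range e)) = UNIV"
  shows "(\<lambda>k. (e k \<bullet> x)\<^sup>2) sums (norm x)\<^sup>2"
proof -
  have id: "psd_operator (\<lambda>x::'a. x)" "bounded_linear (\<lambda>x::'a. x)"
    by (auto simp: psd_operator_def symmetric_operator_def linear_iff bounded_linear_ident)
  have R: "n \<le> m \<Longrightarrow> cholesky_rest (\<lambda>x. x) e n (e m) = e m" for n m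
    by (induction n arbitrary: m) (auto simp: ortho)
  have "cholesky (\<lambda>x. x) e n = e n" for n
    using nrm[of n] by (cases "e n = 0") (auto simp: cholesky_def R norm_eq_sqrt_inner)
  then show ?thesis
    using cholesky_sums[OF id dense, of x] by (simp add: dot_square_norm)
qed

text \<open>
  A summable family has only countably many nonzero terms, and strict positivity makes every
  \<open>C e \<bullet> e\<close> nonzero: a basis along which the trace converges is countable. It is enumerated with zeros in
  the unused places.
\<close>

lemma trace_class_basis_sequence:
  fixes C :: "'a::real_inner \<Rightarrow> 'a"
  assumes pos: "strictly_positive_operator C" and tr: "positive_trace_class C"
  obtains e :: "nat \<Rightarrow> 'a" where "\<And>i j. i \<noteq> j \<Longrightarrow> e i \<bullet> e j = 0" "\<And>i. e i \<noteq> 0 \<Longrightarrow> norm (e i) = 1"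
    "closure (span (range e)) = UNIV" "summable (\<lambda>i. C (e i) \<bullet> e i)"
proof -
  obtain E where E: "orthonormal_basis E" "(\<lambda>e. C e \<bullet> e) summable_on E" and C: "bounded_linear C"
    using tr by (auto simp: positive_trace_class_def)
  have nE: "e \<noteq> 0" if "e \<in> E" for e using E that by (auto simp: orthonormal_basis_def)
  have posE: "0 < C e \<bullet> e" if "e \<in> E" for e
    using pos nE[OF that] by (auto simp: strictly_positive_operator_def)
  have "countable {e\<in>E. C e \<bullet> e \<noteq> 0}" by (rule summable_countable_real[OF E(2)])
  moreover have "{e\<in>E. C e \<bullet> e \<noteq> 0} = E" using posE by force
  ultimately have cE: "countable E" by simp
  define I where "I = to_nat_on E ` E"
  define e where "e n = (if n \<in> I then from_nat_into E n else 0)" for n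
  have eI: "e (to_nat_on E x) = x" if "x \<in> E" for x
    using that cE by (auto simp: e_def I_def)
  have eE: "\<exists>x\<in>E. e n = x \<and> n = to_nat_on E x" if "e n \<noteq> 0" for n
    using that cE by (auto simp: e_def I_def split: if_splits)
  show ?thesis
  proof
    show "e i \<bullet> e j = 0" if "i \<noteq> j" for i j
    proof (cases "e i = 0 \<or> e j = 0")
      case False
      then obtain x y where "x \<in> E" "y \<in> E" "e i = x" "e j = y" "i = to_nat_on E x" "j = to_nat_on E y"
        using eE by blast
      then show ?thesis using that E by (auto simp: orthonormal_basis_def pairwise_def orthogonal_def)
    qed auto
    show "norm (e i) = 1" if "e i \<noteq> 0" for i
      using eE[OF that] E by (auto simp: orthonormal_basis_def)
    have "E \<subseteq> range e" using eI by (metis rangeI subsetI)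
    then have "closure (span E) \<subseteq> closure (span (range e))"
      by (intro closure_mono span_mono)
    then show "closure (span (range e)) = UNIV"
      using E by (auto simp: orthonormal_basis_def)
    have "((\<lambda>i. C (e i) \<bullet> e i) \<circ> to_nat_on E) summable_on E"
      using E(2) by (rule summable_on_cong[THEN iffD1, rotated]) (auto simp: eI)
    then have "(\<lambda>i. C (e i) \<bullet> e i) summable_on I"
      unfolding I_def using cE by (subst summable_on_reindex) (auto intro: inj_on_to_nat_on)
    then have "(\<lambda>i. C (e i) \<bullet> e i) summable_on UNIV"
      by (rule summable_on_cong_neutral[THEN iffD1, rotated -1]) 
        (auto simp: e_def linear_0[OF bounded_linear.linear[OF C]])
    then show "summable (\<lambda>i. C (e i) \<bullet> e i)" by (rule summable_on_imp_summable)
  qed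
qed

text \<open>
  By Parseval, \<open>\<Sum>\<^sub>j \<parallel>g\<^sub>j\<parallel>\<^sup>2 = \<Sum>\<^sub>k \<Sum>\<^sub>j (g\<^sub>j \<bullet> e\<^sub>k)\<^sup>2\<close>, and the inner sum is at most \<open>C e\<^sub>k \<bullet> e\<^sub>k\<close>.
\<close>

lemma cholesky_norm_summable:
  fixes e :: "nat \<Rightarrow> 'a::real_inner"
  assumes C: "psd_operator C" and ortho: "\<And>i j. i \<noteq> j \<Longrightarrow> e i \<bullet> e j = 0" and nrm: "\<And>i. e i \<noteq> 0 \<Longrightarrow> norm (e i) = 1"
    and dense: "closure (span (range e)) = UNIV"
    and tr: "summable (\<lambda>i. C (e i) \<bullet> e i)"
  shows "summable (\<lambda>j. (norm (cholesky C e j))\<^sup>2)"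
proof (rule summableI_nonneg_bounded)
  fix n
  have s: "(\<lambda>k. (e k \<bullet> cholesky C e j)\<^sup>2) sums (norm (cholesky C e j))\<^sup>2" for j
    by (rule Parseval_sums[OF ortho nrm dense])
  have "(\<lambda>k. \<Sum>j<n. (e k \<bullet> cholesky C e j)\<^sup>2) sums (\<Sum>j<n. (norm (cholesky C e j))\<^sup>2)"
    by (intro sums_sum s)
  moreover have "(\<Sum>j<n. (e k \<bullet> cholesky C e j)\<^sup>2) \<le> C (e k) \<bullet> e k" for k
    using cholesky_decomposition[OF C, of "e k" "e k" e n] psd_operatorD(3)[OF psd_cholesky_rest[OF C, of e n], of "e k"]
    by (simp add: power2_eq_square inner_commute)
  ultimately show "(\<Sum>j<n. (norm (cholesky C e j))\<^sup>2) \<le> (\<Sum>k. C (e k) \<bullet> e k)"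
    using tr by (metis (no_types, lifting) sums_le summable_sums)
qed simp

section \<open>Gaussian measures are determined by mean and covariance\<close>

lemma prob_space_normal_law: "0 \<le> \<sigma> \<Longrightarrow> prob_space (normal_law a \<sigma>)"
  unfolding normal_law_affine
  by (intro prob_space.prob_space_distr prob_space_std_normal) auto

lemma sets_normal_law[simp, measurable_cong]: "sets (normal_law a \<sigma>) = sets borel"
  by (simp add: normal_law_def)

lemma normal_law_moments:
  assumes "0 \<le> \<sigma>"
  shows "integrable (normal_law a \<sigma>) (\<lambda>x. x)" "(LINT x|normal_law a \<sigma>. x) = a"
    "integrable (normal_law a \<sigma>) (\<lambda>x. (x - a)\<^sup>2)" "(LINT x|normal_law a \<sigma>. (x - a)\<^sup>2) = \<sigma>\<^sup>2"
proof -
  let ?N = std_normal_distribution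
  interpret N: prob_space ?N by (rule prob_space_std_normal)
  note m = integrable_std_normal_moments
  have d: "integrable (normal_law a \<sigma>) f \<longleftrightarrow> integrable ?N (\<lambda>t. f (a + \<sigma> * t))"
    "(LINT x|normal_law a \<sigma>. f x) = (LINT t|?N. f (a + \<sigma> * t))"
    if "f \<in> borel_measurable borel" for f :: "real \<Rightarrow> real"
    unfolding normal_law_affine[OF assms]
    by (rule integrable_distr_eq; use that in measurable) (rule integral_distr; use that in measurable)
  have i1: "integrable ?N (\<lambda>t. a + \<sigma> * t)"
    by (intro Bochner_Integration.integrable_add integrable_mult_right m N.integrable_const)
  then show "integrable (normal_law a \<sigma>) (\<lambda>x. x)" by (subst d) auto
  have "(LINT t|?N. a + \<sigma> * t) = (LINT t|?N. a) + (LINT t|?N. \<sigma> * t)"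
    by (intro Bochner_Integration.integral_add integrable_mult_right m N.integrable_const)
  also have "\<dots> = a" by (simp only: N.prob_space lebesgue_integral_const integral_mult_right_zero m) simp
  finally show "(LINT x|normal_law a \<sigma>. x) = a" by (subst d) auto
  have e: "(a + \<sigma> * t - a)\<^sup>2 = \<sigma>\<^sup>2 * t\<^sup>2" for t by (simp add: power_mult_distrib)
  have "integrable ?N (\<lambda>t. \<sigma>\<^sup>2 * t\<^sup>2)" by (intro integrable_mult_right m)
  then show "integrable (normal_law a \<sigma>) (\<lambda>x. (x - a)\<^sup>2)" by (subst d) (simp, simp only: e)
  have "(LINT t|?N. \<sigma>\<^sup>2 * t\<^sup>2) = \<sigma>\<^sup>2" by (simp only: integral_mult_right_zero m mult_1_right)
  then show "(LINT x|normal_law a \<sigma>. (x - a)\<^sup>2) = \<sigma>\<^sup>2" by (subst d) (simp, simp only: e)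
qed

lemma projection_moments:
  fixes \<mu> :: "'a::{real_inner, second_countable_topology} measure"
  assumes [measurable_cong]: "sets \<mu> = sets borel" and "0 \<le> \<sigma>"
    and law: "distr \<mu> borel (\<lambda>x. x \<bullet> u) = normal_law a \<sigma>"
  shows "(LINT x|\<mu>. x \<bullet> u) = a" "integrable \<mu> (\<lambda>x. (x \<bullet> u - a)\<^sup>2)" "(LINT x|\<mu>. (x \<bullet> u - a)\<^sup>2) = \<sigma>\<^sup>2"
proof -
  have "(LINT x|\<mu>. x \<bullet> u) = (LINT t|distr \<mu> borel (\<lambda>x. x \<bullet> u). t)"
    by (subst integral_distr) auto
  then show "(LINT x|\<mu>. x \<bullet> u) = a" using law normal_law_moments[OF assms(2)] by simp
  have "integrable (distr \<mu> borel (\<lambda>x. x \<bullet> u)) (\<lambda>t. (t - a)\<^sup>2)"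
    using law normal_law_moments[OF assms(2)] by simp
  then show "integrable \<mu> (\<lambda>x. (x \<bullet> u - a)\<^sup>2)"
    by (subst (asm) integrable_distr_eq) auto
  have "(LINT x|\<mu>. (x \<bullet> u - a)\<^sup>2) = (LINT t|distr \<mu> borel (\<lambda>x. x \<bullet> u). (t - a)\<^sup>2)"
    by (subst integral_distr) auto
  then show "(LINT x|\<mu>. (x \<bullet> u - a)\<^sup>2) = \<sigma>\<^sup>2" using law normal_law_moments[OF assms(2)] by simp
qed

text \<open>
  The laws of the projections carry the mean and, by polarization, the covariance; conversely mean and
  covariance fix the two parameters of each projection, so uniqueness reduces to the Cramer-Wold principle.
\<close>

lemma gaussian_eqI:
  fixes \<mu> :: "'a::{real_inner, second_countable_topology} measure"
  assumes K: "psd_operator K" and \<mu>: "prob_space \<mu>" "sets \<mu> = sets borel"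
    and law: "\<And>u. distr \<mu> borel (\<lambda>x. x \<bullet> u) = normal_law (m \<bullet> u) (sqrt (K u \<bullet> u))"
  shows "gaussian m K = \<mu>"
proof -
  note Kp = psd_operatorD(3)[OF K]
  have sK: "0 \<le> sqrt (K u \<bullet> u)" for u using Kp by simp
  note mom = projection_moments[OF \<mu>(2) sK law]
  have cov: "has_covariance \<mu> m K"
    unfolding has_covariance_def
  proof safe
    fix u w
    have e: "((x - m) \<bullet> u) * ((x - m) \<bullet> w) =
      (1/4) * ((x \<bullet> (u + w) - m \<bullet> (u + w))\<^sup>2 - (x \<bullet> (u - w) - m \<bullet> (u - w))\<^sup>2)" for x
      by (simp add: inner_diff_left inner_add_right inner_diff_right power2_eq_square algebra_simps)
    have "(LINT x|\<mu>. ((x - m) \<bullet> u) * ((x - m) \<bullet> w)) = (1/4) * (K (u + w) \<bullet> (u + w) - K (u - w) \<bullet> (u - w))"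
      unfolding e using mom Kp by (subst integral_mult_right_zero) simp
    also have "\<dots> = K u \<bullet> w"
      using psd_operatorD(1)[OF K] psd_operatorD(2)[OF K, of u w]
      by (simp add: linear_add linear_diff inner_add_left inner_diff_left inner_add_right inner_diff_right)
    finally show "(LINT x|\<mu>. ((x - m) \<bullet> u) * ((x - m) \<bullet> w)) = K u \<bullet> w" .
  qed
  have \<mu>g: "gaussian_measure \<mu> \<and> has_mean \<mu> m \<and> has_covariance \<mu> m K"
    using \<mu> law sK mom(1) cov unfolding gaussian_measure_def has_mean_def by (metis (no_types, lifting))
  show ?thesis unfolding gaussian_def
  proof (rule the_equality[where P="\<lambda>\<mu>. gaussian_measure \<mu> \<and> has_mean \<mu> m \<and> has_covariance \<mu> m K", OF \<mu>g])
    fix \<nu> assume \<nu>: "gaussian_measure \<nu> \<and> has_mean \<nu> m \<and> has_covariance \<nu> m K"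
    then have \<nu>': "prob_space \<nu>" "sets \<nu> = sets borel" by (auto simp: gaussian_measure_def)
    show "\<nu> = \<mu>"
    proof (rule measure_eqI_projections[OF \<nu>'(1) \<mu>(1) \<nu>'(2) \<mu>(2)])
      fix u
      obtain a \<sigma> where a: "0 \<le> \<sigma>" "distr \<nu> borel (\<lambda>x. x \<bullet> u) = normal_law a \<sigma>"
        using \<nu> unfolding gaussian_measure_def by blast
      note n = projection_moments[OF \<nu>'(2) a]
      have "a = m \<bullet> u" using n(1) \<nu> by (simp add: has_mean_def)
      moreover have "\<sigma>\<^sup>2 = K u \<bullet> u"
      proof -
        have "K u \<bullet> u = (LINT x|\<nu>. ((x - m) \<bullet> u) * ((x - m) \<bullet> u))"
          using \<nu> by (simp add: has_covariance_def)
        also have "\<dots> = (LINT x|\<nu>. (x \<bullet> u - a)\<^sup>2)"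
          by (simp add: \<open>a = m \<bullet> u\<close> power2_eq_square inner_diff_left)
        finally show ?thesis using n(3) by simp
      qed
      ultimately show "distr \<nu> borel (\<lambda>x. x \<bullet> u) = distr \<mu> borel (\<lambda>x. x \<bullet> u)"
        unfolding law using a by (metis real_sqrt_unique)
    qed
  qed
qed

section \<open>Random series with normal coefficients\<close>

definition normal_sequence :: "(nat \<Rightarrow> real) measure" where
  "normal_sequence = (\<Pi>\<^sub>M i\<in>UNIV. std_normal_distribution)"

lemma prob_space_normal_sequence: "prob_space normal_sequence"
  unfolding normal_sequence_def by (intro prob_space_PiM prob_space_std_normal)

lemma measurable_normal_sequence[measurable]: "(\<lambda>\<omega>. \<omega> i) \<in> borel_measurable normal_sequence"
proof -
  have "(\<lambda>\<omega>. \<omega> i) \<in> normal_sequence \<rightarrow>\<^sub>M std_normal_distribution"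
    unfolding normal_sequence_def by (rule measurable_component_singleton) simp
  then show ?thesis by (simp add: measurable_cong_sets[OF refl sets_density])
qed

lemma distr_normal_sequence: "distr normal_sequence borel (\<lambda>\<omega>. \<omega> i) = std_normal_distribution"
proof -
  have "distr normal_sequence borel (\<lambda>\<omega>. \<omega> i) = distr normal_sequence std_normal_distribution (\<lambda>\<omega>. \<omega> i)"
    by (rule distr_cong) auto
  also have "\<dots> = std_normal_distribution"
    unfolding normal_sequence_def by (rule distr_PiM_component) (auto intro: prob_space_std_normal)
  finally show ?thesis .
qed

lemma indep_normal_sequence: "prob_space.indep_vars normal_sequence (\<lambda>_. borel) (\<lambda>i \<omega>. \<omega> i) UNIV"
proof -
  interpret prob_space normal_sequence by (rule prob_space_normal_sequence)
  have "distr normal_sequence (\<Pi>\<^sub>M i\<in>UNIV. borel) (\<lambda>\<omega>. \<lambda>i\<in>UNIV. \<omega> i) = distr normal_sequence normal_sequence (\<lambda>\<omega>. \<omega>)"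
    by (intro distr_cong) (auto simp: normal_sequence_def intro!: sets_PiM_cong)
  then show ?thesis
    by (subst indep_vars_iff_distr_eq_PiM)
       (simp_all add: distr_normal_sequence normal_sequence_def[symmetric])
qed

lemma normal_sequence_combination:
  assumes F: "finite F"
  shows "distr normal_sequence borel (\<lambda>\<omega>. \<Sum>j\<in>F. c j * \<omega> j) = normal_law 0 (sqrt (\<Sum>j\<in>F. (c j)\<^sup>2))"
proof (rule Levy_uniqueness)
  interpret prob_space normal_sequence by (rule prob_space_normal_sequence)
  have s: "0 \<le> sqrt (\<Sum>j\<in>F. (c j)\<^sup>2)" by (simp add: sum_nonneg)
  show "real_distribution (distr normal_sequence borel (\<lambda>\<omega>. \<Sum>j\<in>F. c j * \<omega> j))"
    by (intro real_distribution_distr) measurable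
  show "real_distribution (normal_law 0 (sqrt (\<Sum>j\<in>F. (c j)\<^sup>2)))"
    using prob_space_normal_law[OF s] by (simp add: real_distribution_def real_distribution_axioms_def)
  show "char (distr normal_sequence borel (\<lambda>\<omega>. \<Sum>j\<in>F. c j * \<omega> j)) = char (normal_law 0 (sqrt (\<Sum>j\<in>F. (c j)\<^sup>2)))"
  proof
    fix t
    have "indep_vars (\<lambda>_. borel) (\<lambda>i \<omega>. c i * \<omega> i) UNIV"
      by (rule indep_vars_compose2[OF indep_normal_sequence]) auto
    then have ind: "indep_vars (\<lambda>_. borel) (\<lambda>i \<omega>. c i * \<omega> i) F"
      by (rule indep_vars_subset) auto
    have one: "char (distr normal_sequence borel (\<lambda>\<omega>. c i * \<omega> i)) t = of_real (exp (- (c i * t)\<^sup>2 / 2))" for i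
    proof -
      have "char (distr normal_sequence borel (\<lambda>\<omega>. c i * \<omega> i)) t = char (distr normal_sequence borel (\<lambda>\<omega>. \<omega> i)) (t * c i)"
        unfolding char_def by (simp add: integral_distr mult.assoc)
      then show ?thesis
        by (simp add: distr_normal_sequence char_std_normal_distribution mult.commute)
    qed
    show "char (distr normal_sequence borel (\<lambda>\<omega>. \<Sum>j\<in>F. c j * \<omega> j)) t = char (normal_law 0 (sqrt (\<Sum>j\<in>F. (c j)\<^sup>2))) t"
      unfolding char_distr_sum[OF ind] one char_normal_law[OF s]
      using F by (simp add: power_mult_distrib sum_nonneg sum_distrib_right sum_negf sum_divide_distrib flip: of_real_prod exp_sum)
  qed
qed

lemma normal_sequence_second_moment:
  assumes F: "finite F"
  shows "integrable normal_sequence (\<lambda>\<omega>. (\<Sum>j\<in>F. c j * \<omega> j)\<^sup>2)"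
    "(LINT \<omega>|normal_sequence. (\<Sum>j\<in>F. c j * \<omega> j)\<^sup>2) = (\<Sum>j\<in>F. (c j)\<^sup>2)"
proof -
  let ?X = "\<lambda>\<omega>. \<Sum>j\<in>F. c j * \<omega> j"
  have s: "0 \<le> sqrt (\<Sum>j\<in>F. (c j)\<^sup>2)" by (simp add: sum_nonneg)
  note law = normal_sequence_combination[OF F, of c] and m = normal_law_moments[OF s, of 0]
  have "integrable (distr normal_sequence borel ?X) (\<lambda>x. x\<^sup>2)" using m law by simp
  then show "integrable normal_sequence (\<lambda>\<omega>. (?X \<omega>)\<^sup>2)"
    by (subst (asm) integrable_distr_eq) auto
  have "(LINT \<omega>|normal_sequence. (?X \<omega>)\<^sup>2) = (LINT x|distr normal_sequence borel ?X. x\<^sup>2)"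
    by (subst integral_distr) auto
  then show "(LINT \<omega>|normal_sequence. (?X \<omega>)\<^sup>2) = (\<Sum>j\<in>F. (c j)\<^sup>2)"
    using m law by (simp add: sum_nonneg)
qed

text \<open>
  Polarization of the second moments of \<open>\<omega> i\<close>, \<open>\<omega> j\<close> and \<open>\<omega> i + \<omega> j\<close>.
\<close>

lemma normal_sequence_cross_moment:
  "integrable normal_sequence (\<lambda>\<omega>. \<omega> i * \<omega> j)"
  "(LINT \<omega>|normal_sequence. \<omega> i * \<omega> j) = (if i = j then 1 else 0)"
proof -
  have sq: "integrable normal_sequence (\<lambda>\<omega>. (\<omega> i)\<^sup>2)" "(LINT \<omega>|normal_sequence. (\<omega> i)\<^sup>2) = 1" for i
    using normal_sequence_second_moment[of "{i}" "\<lambda>_. 1"] by simp_all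
  have "integrable normal_sequence (\<lambda>\<omega>. \<omega> i * \<omega> j) \<and> (LINT \<omega>|normal_sequence. \<omega> i * \<omega> j) = (if i = j then 1 else 0)"
  proof (cases "i = j")
    case True then show ?thesis using sq[of j] by (simp add: power2_eq_square)
  next
    case False
    have e: "\<omega> i * \<omega> j = (1/2) * ((\<omega> i + \<omega> j)\<^sup>2 - (\<omega> i)\<^sup>2 - (\<omega> j)\<^sup>2)" for \<omega> :: "nat \<Rightarrow> real"
      by (simp add: power2_eq_square algebra_simps)
    have "integrable normal_sequence (\<lambda>\<omega>. (\<omega> i + \<omega> j)\<^sup>2)" "(LINT \<omega>|normal_sequence. (\<omega> i + \<omega> j)\<^sup>2) = 2"
      using normal_sequence_second_moment[of "{i, j}" "\<lambda>_. 1"] False by simp_all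
    then show ?thesis unfolding e using sq False by simp
  qed
  then show "integrable normal_sequence (\<lambda>\<omega>. \<omega> i * \<omega> j)"
    "(LINT \<omega>|normal_sequence. \<omega> i * \<omega> j) = (if i = j then 1 else 0)" by auto
qed

lemma random_sum_second_moment:
  fixes g :: "nat \<Rightarrow> 'a::real_inner"
  assumes F: "finite F"
  shows "integrable normal_sequence (\<lambda>\<omega>. (norm (\<Sum>j\<in>F. \<omega> j *\<^sub>R g j))\<^sup>2)"
    "(LINT \<omega>|normal_sequence. (norm (\<Sum>j\<in>F. \<omega> j *\<^sub>R g j))\<^sup>2) = (\<Sum>j\<in>F. (norm (g j))\<^sup>2)"
proof -
  have e: "(norm (\<Sum>j\<in>F. \<omega> j *\<^sub>R g j))\<^sup>2 = (\<Sum>i\<in>F. \<Sum>j\<in>F. (\<omega> i * \<omega> j) * (g i \<bullet> g j))" for \<omega> :: "nat \<Rightarrow> real"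
    by (simp add: dot_square_norm[symmetric] inner_sum_left inner_sum_right sum_distrib_left mult_ac) 
      (simp add: inner_commute mult_ac)
  show "integrable normal_sequence (\<lambda>\<omega>. (norm (\<Sum>j\<in>F. \<omega> j *\<^sub>R g j))\<^sup>2)"
    unfolding e by (intro Bochner_Integration.integrable_sum integrable_mult_left normal_sequence_cross_moment)
  show "(LINT \<omega>|normal_sequence. (norm (\<Sum>j\<in>F. \<omega> j *\<^sub>R g j))\<^sup>2) = (\<Sum>j\<in>F. (norm (g j))\<^sup>2)"
    unfolding e using F
    by (simp add: Bochner_Integration.integral_sum Bochner_Integration.integrable_sum normal_sequence_cross_moment sum.delta if_distrib[of "\<lambda>x. x * _"] dot_square_norm cong: if_cong)
qed

lemma summable_sparse_tails:
  fixes f :: "nat \<Rightarrow> real"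
  assumes "summable f"
  obtains r :: "nat \<Rightarrow> nat" where "mono r" "\<And>k. k \<le> r k" "\<And>k n. \<bar>sum f {r k..<n}\<bar> \<le> (1/4) ^ k"
proof -
  have "\<exists>N. \<forall>m\<ge>N. \<forall>n. norm (sum f {m..<n}) < (1/4) ^ k" for k :: nat
    using assms[unfolded summable_Cauchy, rule_format, of "(1/4)^k"] by auto
  then obtain N where N: "\<And>k m n. m \<ge> N k \<Longrightarrow> norm (sum f {m..<n}) < (1/4) ^ k" by metis
  show ?thesis
  proof (rule that[of "\<lambda>k. k + sum N {..k}"])
    show "mono (\<lambda>k. k + sum N {..k})" by (intro monoI add_mono sum_mono2) auto
    show "\<bar>sum f {k + sum N {..k}..<n}\<bar> \<le> (1/4) ^ k" for k n
    proof -
      have "N k \<le> sum N {..k}" by (intro member_le_sum) auto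
      then show ?thesis using N[of k "k + sum N {..k}" n] by simp
    qed
  qed simp
qed

lemma Cauchy_if_increments_summable:
  fixes X :: "nat \<Rightarrow> 'a::real_normed_vector"
  assumes "summable (\<lambda>k. norm (X (Suc k) - X k))"
  shows "Cauchy X"
proof (rule CauchyI')
  fix e :: real assume "0 < e"
  with assms obtain N where N: "\<And>m n. m \<ge> N \<Longrightarrow> norm (\<Sum>k\<in>{m..<n}. norm (X (Suc k) - X k)) < e"
    unfolding summable_Cauchy by blast
  show "\<exists>M. \<forall>m\<ge>M. \<forall>n>m. dist (X m) (X n) < e"
  proof (intro exI allI impI)
    fix m n assume mn: "N \<le> m" "m < n"
    have "dist (X m) (X n) = norm (\<Sum>k\<in>{m..<n}. X (Suc k) - X k)"
      using mn by (simp add: sum_Suc_diff' dist_norm norm_minus_commute)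
    also have "\<dots> \<le> (\<Sum>k\<in>{m..<n}. norm (X (Suc k) - X k))" by (rule norm_sum)
    finally show "dist (X m) (X n) < e" using N[OF mn(1), of n] by simp
  qed
qed

text \<open>
  Along a subsequence with tails of size \<open>4\<^sup>-\<^sup>k\<close>, the increments \<open>Y\<^sub>k\<close> satisfy \<open>E \<Sum>\<^sub>k 2\<^sup>k \<parallel>Y\<^sub>k\<parallel>\<^sup>2 < \<infinity>\<close>; almost
  surely the sum is finite, and \<open>2 \<parallel>Y\<^sub>k\<parallel> \<le> 2\<^sup>-\<^sup>k + 2\<^sup>k \<parallel>Y\<^sub>k\<parallel>\<^sup>2\<close> makes the increments summable.
\<close>

lemma random_series_Cauchy:
  fixes g :: "nat \<Rightarrow> 'a::{real_inner, second_countable_topology}"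
  assumes r: "mono r" "\<And>k n. \<bar>\<Sum>j\<in>{r k..<n}. (norm (g j))\<^sup>2\<bar> \<le> (1/4) ^ k"
  shows "AE \<omega> in normal_sequence. Cauchy (\<lambda>k. \<Sum>j<r k. \<omega> j *\<^sub>R g j)"
proof -
  let ?Y = "\<lambda>k \<omega>. \<Sum>j\<in>{r k..<r (Suc k)}. \<omega> j *\<^sub>R g j"
  have "(\<integral>\<^sup>+\<omega>. (\<Sum>k. ennreal (2 ^ k * (norm (?Y k \<omega>))\<^sup>2)) \<partial>normal_sequence)
    = (\<Sum>k. \<integral>\<^sup>+\<omega>. ennreal (2 ^ k * (norm (?Y k \<omega>))\<^sup>2) \<partial>normal_sequence)"
    by (intro nn_integral_suminf) measurable
  also have "\<dots> \<le> (\<Sum>k. ennreal ((1/2) ^ k))"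
  proof (intro suminf_le allI)
    fix k
    have "(\<integral>\<^sup>+\<omega>. ennreal (2 ^ k * (norm (?Y k \<omega>))\<^sup>2) \<partial>normal_sequence)
      = ennreal (2 ^ k * (\<Sum>j\<in>{r k..<r (Suc k)}. (norm (g j))\<^sup>2))"
      using random_sum_second_moment[of "{r k..<r (Suc k)}" g]
      by (subst nn_integral_eq_integral) auto
    also have "\<dots> \<le> ennreal (2 ^ k * (1/4) ^ k)"
      using r(2)[of k "r (Suc k)"] by (intro ennreal_leI mult_left_mono) auto
    also have "2 ^ k * (1/4) ^ k = (1/2 :: real) ^ k" by (simp add: power_mult_distrib[symmetric])
    finally show "(\<integral>\<^sup>+\<omega>. ennreal (2 ^ k * (norm (?Y k \<omega>))\<^sup>2) \<partial>normal_sequence) \<le> ennreal ((1/2) ^ k)" .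
  qed auto
  also have "\<dots> < \<infinity>"
    by (subst suminf_ennreal2) (auto intro!: summable_geometric)
  finally have "AE \<omega> in normal_sequence. (\<Sum>k. ennreal (2 ^ k * (norm (?Y k \<omega>))\<^sup>2)) \<noteq> \<infinity>"
    by (intro nn_integral_PInf_AE) auto
  then show ?thesis
  proof (rule AE_mp, intro AE_I2 impI)
    fix \<omega> assume "(\<Sum>k. ennreal (2 ^ k * (norm (?Y k \<omega>))\<^sup>2)) \<noteq> \<infinity>"
    then have s: "summable (\<lambda>k. 2 ^ k * (norm (?Y k \<omega>))\<^sup>2)"
      by (intro summable_suminf_not_top) auto
    have "summable (\<lambda>k. (1/2) ^ k + 2 ^ k * (norm (?Y k \<omega>))\<^sup>2)"
      by (intro summable_add s summable_geometric) auto
    moreover have "norm (?Y k \<omega>) \<le> (1/2) ^ k + 2 ^ k * (norm (?Y k \<omega>))\<^sup>2" for k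
    proof -
      have "2 * y \<le> 1 / a + a * y\<^sup>2" if "0 < a" for a y :: real
      proof -
        have "0 \<le> (a * y - 1)\<^sup>2 / a" using that by simp
        also have "\<dots> = 1 / a + a * y\<^sup>2 - 2 * y" using that by (simp add: field_simps power2_eq_square)
        finally show ?thesis by simp
      qed
      from this[of "2 ^ k" "norm (?Y k \<omega>)"] show ?thesis
        by (simp add: power_one_over) (smt (verit) norm_ge_zero)
    qed
    ultimately have "summable (\<lambda>k. norm (?Y k \<omega>))"
      by (intro summable_comparison_test_ev[of "\<lambda>k. norm (?Y k \<omega>)"]) (auto simp: always_eventually)
    moreover have "?Y k \<omega> = (\<Sum>j<r (Suc k). \<omega> j *\<^sub>R g j) - (\<Sum>j<r k. \<omega> j *\<^sub>R g j)" for k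
      using r(1) sum_diff_nat_ivl[of 0 "r k" "r (Suc k)" "\<lambda>j. \<omega> j *\<^sub>R g j"]
      by (simp add: monoD lessThan_atLeast0)
    ultimately show "Cauchy (\<lambda>k. \<Sum>j<r k. \<omega> j *\<^sub>R g j)"
      by (intro Cauchy_if_increments_summable) simp
  qed
qed

text \<open>
  Partial sums have projections with normal laws of known variance, and their characteristic functions
  pass to the almost sure limit by dominated convergence. On the null set without convergence the series
  is replaced by \<open>0\<close>, so that the limit is measurable everywhere.
\<close>

lemma random_series_exists:
  fixes g :: "nat \<Rightarrow> 'a::{real_inner, polish_space}"
  assumes g: "summable (\<lambda>j. (norm (g j))\<^sup>2)" and q: "\<And>u. (\<lambda>j. (g j \<bullet> u)\<^sup>2) sums q u"
  shows "\<exists>\<mu>. prob_space \<mu> \<and> sets \<mu> = sets borel \<and>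
    (\<forall>u. distr \<mu> borel (\<lambda>x. x \<bullet> u) = normal_law 0 (sqrt (q u)))"
proof -
  interpret prob_space normal_sequence by (rule prob_space_normal_sequence)
  obtain r where r: "mono r" "\<And>k. k \<le> r k" "\<And>k n. \<bar>\<Sum>j\<in>{r k..<n}. (norm (g j))\<^sup>2\<bar> \<le> (1/4) ^ k"
    using summable_sparse_tails[OF g] by blast
  define S where "S k \<omega> = (\<Sum>j<r k. \<omega> j *\<^sub>R g j)" for k and \<omega> :: "nat \<Rightarrow> real"
  have [measurable]: "S k \<in> borel_measurable normal_sequence" for k unfolding S_def by measurable
  define U where "U k \<omega> = (if Cauchy (\<lambda>k. S k \<omega>) then S k \<omega> else 0)" for k \<omega>
  have [measurable]: "U k \<in> borel_measurable normal_sequence" for k unfolding U_def by measurable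
  define X where "X \<omega> = lim (\<lambda>k. U k \<omega>)" for \<omega>
  have lim: "(\<lambda>k. U k \<omega>) \<longlonglongrightarrow> X \<omega>" for \<omega>
  proof -
    have "convergent (\<lambda>k. U k \<omega>)"
      by (cases "Cauchy (\<lambda>k. S k \<omega>)") (auto simp: U_def convergent_const Cauchy_convergent)
    then show ?thesis by (simp add: X_def convergent_LIMSEQ_iff)
  qed
  have [measurable]: "X \<in> borel_measurable normal_sequence"
    by (rule borel_measurable_LIMSEQ_metric[OF _ lim]) simp
  have ae: "AE \<omega> in normal_sequence. Cauchy (\<lambda>k. S k \<omega>)"
    unfolding S_def by (rule random_series_Cauchy[OF r(1,3)])
  have q0: "0 \<le> q u" for u using sums_le[OF _ sums_zero q[of u]] by simp
  have law: "distr normal_sequence borel (\<lambda>\<omega>. X \<omega> \<bullet> u) = normal_law 0 (sqrt (q u))" for u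
  proof (rule Levy_uniqueness)
    have sq: "0 \<le> sqrt (q u)" using q0 by simp
    show "real_distribution (distr normal_sequence borel (\<lambda>\<omega>. X \<omega> \<bullet> u))"
      by (intro real_distribution_distr) measurable
    show "real_distribution (normal_law 0 (sqrt (q u)))"
      using prob_space_normal_law[OF sq] by (simp add: real_distribution_def real_distribution_axioms_def)
    show "char (distr normal_sequence borel (\<lambda>\<omega>. X \<omega> \<bullet> u)) = char (normal_law 0 (sqrt (q u)))"
    proof
      fix t
      have "(\<lambda>k. CLINT \<omega>|normal_sequence. iexp (t * (U k \<omega> \<bullet> u))) \<longlonglongrightarrow> (CLINT \<omega>|normal_sequence. iexp (t * (X \<omega> \<bullet> u)))"
        by (rule integral_dominated_convergence[where w="\<lambda>_. 1"])
           (auto intro!: tendsto_intros lim AE_I2)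
      moreover have "(CLINT \<omega>|normal_sequence. iexp (t * (U k \<omega> \<bullet> u))) = of_real (exp (- (t\<^sup>2 * (\<Sum>j<r k. (g j \<bullet> u)\<^sup>2)) / 2))" for k
      proof -
        have s0: "0 \<le> sqrt (\<Sum>j<r k. (g j \<bullet> u)\<^sup>2)" by (simp add: sum_nonneg)
        have "(CLINT \<omega>|normal_sequence. iexp (t * (U k \<omega> \<bullet> u))) = (CLINT \<omega>|normal_sequence. iexp (t * (S k \<omega> \<bullet> u)))"
          by (rule integral_cong_AE) (use ae in \<open>auto simp: U_def\<close>)
        also have "\<dots> = char (distr normal_sequence borel (\<lambda>\<omega>. \<Sum>j<r k. (g j \<bullet> u) * \<omega> j)) t"
          unfolding char_def by (subst integral_distr) (auto simp: S_def inner_sum_left mult.commute)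
        also have "\<dots> = of_real (exp (- (t\<^sup>2 * (\<Sum>j<r k. (g j \<bullet> u)\<^sup>2)) / 2))"
          unfolding normal_sequence_combination[OF finite_lessThan] char_normal_law[OF s0]
          by (simp add: power_mult_distrib sum_nonneg mult.commute)
        finally show ?thesis .
      qed
      moreover have "(\<lambda>k. of_real (exp (- (t\<^sup>2 * (\<Sum>j<r k. (g j \<bullet> u)\<^sup>2)) / 2)) :: complex) \<longlonglongrightarrow> of_real (exp (- (t\<^sup>2 * q u) / 2))"
      proof -
        have "filterlim r at_top sequentially"
          using r(2) by (intro filterlim_at_top_mono[OF filterlim_ident]) auto
        then have "(\<lambda>k. \<Sum>j<r k. (g j \<bullet> u)\<^sup>2) \<longlonglongrightarrow> q u"
          using q[of u] unfolding sums_def by (rule filterlim_compose[rotated])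
        then show ?thesis by (intro tendsto_intros) auto
      qed
      ultimately have "(CLINT \<omega>|normal_sequence. iexp (t * (X \<omega> \<bullet> u))) = of_real (exp (- (t\<^sup>2 * q u) / 2))"
        by (simp add: LIMSEQ_unique)
      moreover have "char (distr normal_sequence borel (\<lambda>\<omega>. X \<omega> \<bullet> u)) t = (CLINT \<omega>|normal_sequence. iexp (t * (X \<omega> \<bullet> u)))"
        unfolding char_def by (subst integral_distr) auto
      ultimately show "char (distr normal_sequence borel (\<lambda>\<omega>. X \<omega> \<bullet> u)) t = char (normal_law 0 (sqrt (q u))) t"
        unfolding char_normal_law[OF sq] using q0[of u]
        by (simp add: power_mult_distrib mult.commute)
    qed
  qed
  show ?thesis
  proof (intro exI[of _ "distr normal_sequence borel X"] conjI allI)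
    show "prob_space (distr normal_sequence borel X)" by (rule prob_space_distr) simp
    show "distr (distr normal_sequence borel X) borel (\<lambda>x. x \<bullet> u) = normal_law 0 (sqrt (q u))" for u
      using law[of u] by (subst distr_distr) (auto simp: comp_def)
  qed simp
qed

section \<open>The Gaussian reference measure of the proposals\<close>

lemma normal_exp_square:
  "(\<integral>\<^sup>+t. ennreal (exp (t\<^sup>2 / 4)) \<partial>std_normal_distribution) = ennreal (sqrt 2)"
proof -
  have e: "std_normal_density t * exp (t\<^sup>2 / 4) = sqrt 2 * normal_density 0 (sqrt 2) t" for t
    by (simp add: normal_density_def real_sqrt_mult field_simps flip: exp_add)
  have "(\<integral>\<^sup>+t. ennreal (exp (t\<^sup>2 / 4)) \<partial>std_normal_distribution)
    = (\<integral>\<^sup>+t. ennreal (sqrt 2 * normal_density 0 (sqrt 2) t) \<partial>lborel)"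
    by (subst nn_integral_density) (auto simp: e[symmetric] ennreal_mult)
  also have "\<dots> = ennreal (sqrt 2)"
    by (subst nn_integral_eq_integral) auto
  finally show ?thesis .
qed

text \<open>
  Jensen's inequality for the exponential function with weights of total mass at most \<open>1\<close>, the missing mass
  sitting at \<open>0\<close>. The proof bounds \<open>exp\<close> below by its tangent at the weighted mean.
\<close>

lemma exp_weighted_sum_le:
  fixes w y :: "nat \<Rightarrow> real"
  assumes "\<And>i. 0 \<le> w i" "(\<Sum>i<n. w i) \<le> 1"
  shows "exp (\<Sum>i<n. w i * y i) \<le> (1 - (\<Sum>i<n. w i)) + (\<Sum>i<n. w i * exp (y i))"
proof -
  define s where "s = (\<Sum>i<n. w i * y i)"
  let ?W = "\<Sum>i<n. w i"
  have t: "exp s * (1 + z - s) \<le> exp z" for z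
  proof -
    have "exp s * (1 + z - s) \<le> exp s * exp (z - s)"
      by (intro mult_left_mono) (use exp_ge_add_one_self[of "z - s"] in linarith, simp)
    then show ?thesis by (simp flip: exp_add)
  qed
  have "(\<Sum>i<n. w i * (exp s * (1 + y i - s))) = exp s * (\<Sum>i<n. w i + w i * y i - s * w i)"
    by (simp add: sum_distrib_left algebra_simps)
  also have "(\<Sum>i<n. w i + w i * y i - s * w i) = ?W + s - s * ?W"
    by (simp add: sum.distrib sum_subtractf s_def[symmetric] flip: sum_distrib_left)
  finally have "exp s = (1 - ?W) * (exp s * (1 + 0 - s)) + (\<Sum>i<n. w i * (exp s * (1 + y i - s)))"
    by (simp add: algebra_simps)
  also have "\<dots> \<le> (1 - ?W) * exp 0 + (\<Sum>i<n. w i * exp (y i))"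
    using assms by (intro add_mono sum_mono mult_left_mono t) auto
  finally show ?thesis by (simp add: s_def)
qed

text \<open>
  With \<open>s k\<close> the variance of the \<open>k\<close>-th coordinate, \<open>\<parallel>x\<parallel>\<^sup>2 / (4 T)\<close> is the average of the normalized squares
  \<open>(e k \<bullet> x)\<^sup>2 / (4 s k)\<close> with weights \<open>s k / T\<close>. Convexity of \<open>exp\<close> reduces its exponential moment to the
  one-dimensional value \<open>sqrt 2\<close>, coordinate by coordinate.
\<close>

lemma Fernique_bound:
  fixes e :: "nat \<Rightarrow> 'a::{real_inner, second_countable_topology}"
  assumes \<mu>: "prob_space \<mu>" "sets \<mu> = sets borel"
    and parseval: "\<And>x. (\<lambda>k. (e k \<bullet> x)\<^sup>2) sums (norm x)\<^sup>2"
    and law: "\<And>k. distr \<mu> borel (\<lambda>x. x \<bullet> e k) = normal_law 0 (sqrt (s k))"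
    and s: "\<And>k. 0 \<le> s k" "\<And>k. s k = 0 \<Longrightarrow> e k = 0" "summable s" "suminf s \<le> T" "0 < T"
  shows "(\<integral>\<^sup>+x. ennreal (exp ((norm x)\<^sup>2 / (4 * T))) \<partial>\<mu>) \<le> 3"
proof -
  interpret prob_space \<mu> by fact
  note [measurable_cong] = \<mu>(2)
  define F where "F n x = (\<Sum>k<n. (e k \<bullet> x)\<^sup>2) / (4 * T)" for n x
  have W: "(\<Sum>i<n. s i / T) \<le> 1" for n
    using sum_le_suminf[OF s(3), of "{..<n}"] s by (simp flip: sum_divide_distrib)
  have coord: "(\<integral>\<^sup>+x. ennreal (exp ((e k \<bullet> x)\<^sup>2 / (4 * s k))) \<partial>\<mu>) \<le> 2" for k
  proof -
    have "(\<integral>\<^sup>+x. ennreal (exp ((e k \<bullet> x)\<^sup>2 / (4 * s k))) \<partial>\<mu>)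
      = (\<integral>\<^sup>+t. ennreal (exp (t\<^sup>2 / (4 * s k))) \<partial>distr \<mu> borel (\<lambda>x. x \<bullet> e k))"
      by (subst nn_integral_distr) (auto simp: inner_commute)
    also have "\<dots> = (\<integral>\<^sup>+t. ennreal (exp ((sqrt (s k) * t)\<^sup>2 / (4 * s k))) \<partial>std_normal_distribution)"
      unfolding law using s(1)[of k] by (subst normal_law_affine) (simp_all add: nn_integral_distr)
    also have "\<dots> \<le> (\<integral>\<^sup>+t. ennreal (exp (t\<^sup>2 / 4)) \<partial>std_normal_distribution)"
      using s(1)[of k] by (intro nn_integral_mono ennreal_leI) (cases "s k = 0"; simp add: power_mult_distrib)
    also have "\<dots> \<le> 2"
    proof -
      have "sqrt 2 \<le> sqrt 4" by (subst real_sqrt_le_iff) simp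
      then have "ennreal (sqrt 2) \<le> ennreal 2" by (intro ennreal_leI) simp
      then show ?thesis unfolding normal_exp_square by simp
    qed
    finally show ?thesis .
  qed
  have Fn: "(\<integral>\<^sup>+x. ennreal (exp (F n x)) \<partial>\<mu>) \<le> 3" for n
  proof -
    let ?W = "\<Sum>i<n. s i / T"
    have "(\<integral>\<^sup>+x. ennreal (exp (F n x)) \<partial>\<mu>) \<le>
       (\<integral>\<^sup>+x. ennreal (1 - ?W) + (\<Sum>i<n. ennreal (s i / T) * ennreal (exp ((e i \<bullet> x)\<^sup>2 / (4 * s i)))) \<partial>\<mu>)"
    proof (intro nn_integral_mono)
      fix x
      have "F n x = (\<Sum>i<n. (s i / T) * ((e i \<bullet> x)\<^sup>2 / (4 * s i)))"
        unfolding F_def sum_divide_distrib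
      proof (intro sum.cong refl)
        fix i show "(e i \<bullet> x)\<^sup>2 / (4 * T) = s i / T * ((e i \<bullet> x)\<^sup>2 / (4 * s i))"
          using s(2)[of i] s(5) by (cases "s i = 0") auto
      qed
      then have "exp (F n x) \<le> (1 - ?W) + (\<Sum>i<n. (s i / T) * exp ((e i \<bullet> x)\<^sup>2 / (4 * s i)))"
        using exp_weighted_sum_le[of "\<lambda>i. s i / T" n "\<lambda>i. (e i \<bullet> x)\<^sup>2 / (4 * s i)"] s W by simp
      then have "ennreal (exp (F n x)) \<le> ennreal ((1 - ?W) + (\<Sum>i<n. (s i / T) * exp ((e i \<bullet> x)\<^sup>2 / (4 * s i))))"
        by (rule ennreal_leI)
      also have "\<dots> = ennreal (1 - ?W) + (\<Sum>i<n. ennreal (s i / T) * ennreal (exp ((e i \<bullet> x)\<^sup>2 / (4 * s i))))"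
      proof -
        have nn: "0 \<le> s i / T" for i using s by simp
        have "(\<Sum>i<n. ennreal (s i / T) * ennreal (exp ((e i \<bullet> x)\<^sup>2 / (4 * s i)))) =
          (\<Sum>i<n. ennreal ((s i / T) * exp ((e i \<bullet> x)\<^sup>2 / (4 * s i))))"
          by (intro sum.cong refl ennreal_mult[symmetric] nn) simp
        also have "\<dots> = ennreal (\<Sum>i<n. (s i / T) * exp ((e i \<bullet> x)\<^sup>2 / (4 * s i)))"
          by (intro sum_ennreal mult_nonneg_nonneg nn) simp
        finally show ?thesis using W[of n] nn
          by (simp only:) (intro ennreal_plus sum_nonneg mult_nonneg_nonneg; simp)
      qed
      finally show "ennreal (exp (F n x)) \<le> \<dots>" .
    qed
    also have "\<dots> = ennreal (1 - ?W) + (\<Sum>i<n. ennreal (s i / T) * (\<integral>\<^sup>+x. ennreal (exp ((e i \<bullet> x)\<^sup>2 / (4 * s i))) \<partial>\<mu>))"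
      by (subst nn_integral_add) (auto simp: nn_integral_sum nn_integral_cmult emeasure_space_1)
    also have "\<dots> \<le> ennreal (1 - ?W) + (\<Sum>i<n. ennreal (s i / T) * 2)"
      by (intro add_mono sum_mono mult_left_mono coord) auto
    also have "\<dots> = ennreal ((1 - ?W) + 2 * ?W)"
    proof -
      have nn: "0 \<le> s i / T" for i using s by simp
      have "(\<Sum>i<n. ennreal (s i / T) * 2) = ennreal ?W * 2"
        unfolding sum_distrib_right[symmetric] by (subst sum_ennreal) (use nn in auto)
      also have "\<dots> = ennreal (2 * ?W)"
        using nn by (simp add: ennreal_mult sum_nonneg mult.commute)
      finally show ?thesis using W[of n] nn
        by (simp only:) (intro ennreal_plus[symmetric] mult_nonneg_nonneg sum_nonneg; simp)
    qed
    also have "\<dots> \<le> ennreal 3" using W[of n] by (intro ennreal_leI) simp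
    finally show ?thesis by simp
  qed
  have "(\<lambda>n. \<integral>\<^sup>+x. ennreal (exp (F n x)) \<partial>\<mu>) \<longlonglongrightarrow> (\<integral>\<^sup>+x. ennreal (exp ((norm x)\<^sup>2 / (4 * T))) \<partial>\<mu>)"
  proof (rule nn_integral_LIMSEQ)
    show "incseq (\<lambda>n x. ennreal (exp (F n x)))"
      using s(5) unfolding F_def by (intro incseq_SucI le_funI ennreal_leI) (simp add: divide_right_mono)
    show "(\<lambda>x. ennreal (exp (F n x))) \<in> borel_measurable \<mu>" for n unfolding F_def by measurable
    show "(\<lambda>n. ennreal (exp (F n x))) \<longlonglongrightarrow> ennreal (exp ((norm x)\<^sup>2 / (4 * T)))" for x
      unfolding F_def using parseval[of x, unfolded sums_def] s(5) by (intro tendsto_intros tendsto_ennrealI) auto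
  qed
  then show ?thesis by (rule LIMSEQ_le_const2) (use Fn in auto)
qed

theorem reference_gaussian_exists:
  fixes C :: "'a::{real_inner, polish_space} \<Rightarrow> 'a"
  assumes sym: "symmetric_operator C" and pos: "strictly_positive_operator C" and tr: "positive_trace_class C"
  obtains \<gamma> :: "'a measure" and \<tau> :: real where
    "prob_space \<gamma>" "sets \<gamma> = sets borel" "0 < \<tau>" "(\<integral>\<^sup>+x. ennreal (exp (\<tau> * (norm x)\<^sup>2)) \<partial>\<gamma>) < \<infinity>"
    "\<And>\<rho> x. 0 \<le> \<rho> \<Longrightarrow> \<rho> < 1 \<Longrightarrow> pcn_proposal C \<rho> x = distr \<gamma> borel (\<lambda>\<xi>. \<rho> *\<^sub>R x + sqrt (1 - \<rho>\<^sup>2) *\<^sub>R \<xi>)"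
proof -
  have bl: "bounded_linear C" using tr by (simp add: positive_trace_class_def)
  have "0 \<le> C x \<bullet> x" for x
    using pos linear_0[OF bounded_linear.linear[OF bl]] unfolding strictly_positive_operator_def
    by (cases "x = 0") (auto simp: less_imp_le)
  then have psd: "psd_operator C"
    using sym bounded_linear.linear[OF bl] by (simp add: psd_operator_def)
  obtain e :: "nat \<Rightarrow> 'a" where e: "\<And>i j. i \<noteq> j \<Longrightarrow> e i \<bullet> e j = 0" "\<And>i. e i \<noteq> 0 \<Longrightarrow> norm (e i) = 1"
    "closure (span (range e)) = UNIV" "summable (\<lambda>i. C (e i) \<bullet> e i)"
    using trace_class_basis_sequence[OF pos tr] by blast
  obtain \<gamma> :: "'a measure" where \<gamma>: "prob_space \<gamma>" "sets \<gamma> = sets borel"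
    and law: "\<And>u. distr \<gamma> borel (\<lambda>x. x \<bullet> u) = normal_law 0 (sqrt (C u \<bullet> u))"
    using random_series_exists[OF cholesky_norm_summable[OF psd e] cholesky_sums[OF psd bl e(3)]] by blast
  note [measurable_cong] = \<gamma>(2)
  define T where "T = (\<Sum>i. C (e i) \<bullet> e i) + 1"
  have T: "0 < T" "(\<Sum>i. C (e i) \<bullet> e i) \<le> T"
    unfolding T_def using suminf_nonneg[OF e(4)] psd_operatorD(3)[OF psd] by (auto simp: add_nonneg_pos)
  have "(\<integral>\<^sup>+x. ennreal (exp ((norm x)\<^sup>2 / (4 * T))) \<partial>\<gamma>) \<le> 3"
  proof (rule Fernique_bound[OF \<gamma> Parseval_sums[OF e(1-3)] law _ _ e(4) T(2,1)])
    show "0 \<le> C (e k) \<bullet> e k" for k using psd_operatorD(3)[OF psd] .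
    show "C (e k) \<bullet> e k = 0 \<Longrightarrow> e k = 0" for k
      using pos unfolding strictly_positive_operator_def by force
  qed
  then have fin: "(\<integral>\<^sup>+x. ennreal (exp (1 / (4 * T) * (norm x)\<^sup>2)) \<partial>\<gamma>) < \<infinity>"
    using le_less_trans[of _ "3::ennreal" \<infinity>] by simp
  have pcn: "pcn_proposal C \<rho> x = distr \<gamma> borel (\<lambda>\<xi>. \<rho> *\<^sub>R x + sqrt (1 - \<rho>\<^sup>2) *\<^sub>R \<xi>)"
    if \<rho>: "0 \<le> \<rho>" "\<rho> < 1" for \<rho> x
    unfolding pcn_proposal_def
  proof (rule gaussian_eqI)
    have r: "0 \<le> 1 - \<rho>\<^sup>2" using \<rho> by (simp add: power_le_one)
    show "psd_operator (\<lambda>u. (1 - \<rho>\<^sup>2) *\<^sub>R C u)"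
      using psd_operatorD[OF psd] r unfolding psd_operator_def symmetric_operator_def
      by (auto simp: linear_compose_scale_right inner_commute)
    show "prob_space (distr \<gamma> borel (\<lambda>\<xi>. \<rho> *\<^sub>R x + sqrt (1 - \<rho>\<^sup>2) *\<^sub>R \<xi>))"
      by (rule prob_space.prob_space_distr[OF \<gamma>(1)]) measurable
    fix u
    have s: "0 \<le> sqrt (C u \<bullet> u)" using psd_operatorD(3)[OF psd] by simp
    have "distr (distr \<gamma> borel (\<lambda>\<xi>. \<rho> *\<^sub>R x + sqrt (1 - \<rho>\<^sup>2) *\<^sub>R \<xi>)) borel (\<lambda>y. y \<bullet> u)
      = distr (distr \<gamma> borel (\<lambda>\<xi>. \<xi> \<bullet> u)) borel (\<lambda>t. (\<rho> *\<^sub>R x) \<bullet> u + sqrt (1 - \<rho>\<^sup>2) * t)"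
      by (subst (1 2) distr_distr) (auto simp: comp_def inner_add_left)
    also have "\<dots> = distr std_normal_distribution borel (\<lambda>t. (\<rho> *\<^sub>R x) \<bullet> u + sqrt ((1 - \<rho>\<^sup>2) * (C u \<bullet> u)) * t)"
      unfolding law normal_law_affine[OF s]
      by (subst distr_distr) (auto simp: comp_def real_sqrt_mult mult.assoc)
    also have "\<dots> = normal_law ((\<rho> *\<^sub>R x) \<bullet> u) (sqrt (((1 - \<rho>\<^sup>2) *\<^sub>R C u) \<bullet> u))"
      using r psd_operatorD(3)[OF psd, of u] by (subst normal_law_affine) auto
    finally show "distr (distr \<gamma> borel (\<lambda>\<xi>. \<rho> *\<^sub>R x + sqrt (1 - \<rho>\<^sup>2) *\<^sub>R \<xi>)) borel (\<lambda>y. y \<bullet> u)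
      = normal_law ((\<rho> *\<^sub>R x) \<bullet> u) (sqrt (((1 - \<rho>\<^sup>2) *\<^sub>R C u) \<bullet> u))" .
  qed simp
  show ?thesis by (rule that[OF \<gamma> _ fin pcn]) (use T in auto)
qed

section \<open>Wasserstein decay from a contracting coupling kernel\<close>

lemma density_distr_kernel_measurable:
  fixes d :: "'z \<Rightarrow> 'n \<Rightarrow> ennreal" and s :: "'z \<Rightarrow> 'n \<Rightarrow> 'l"
  assumes "sigma_finite_measure N"
    and [measurable]: "(\<lambda>(z, n). d z n) \<in> borel_measurable (M \<Otimes>\<^sub>M N)" "(\<lambda>(z, n). s z n) \<in> M \<Otimes>\<^sub>M N \<rightarrow>\<^sub>M L"
    and one: "\<And>z. z \<in> space M \<Longrightarrow> (\<integral>\<^sup>+n. d z n \<partial>N) = 1"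
  shows "(\<lambda>z. distr (density N (d z)) L (s z)) \<in> M \<rightarrow>\<^sub>M prob_algebra L"
proof -
  interpret N: sigma_finite_measure N by fact
  have [measurable]: "d z \<in> borel_measurable N" "s z \<in> N \<rightarrow>\<^sub>M L" if "z \<in> space M" for z
    using that measurable_Pair2[OF assms(2)] measurable_Pair2[OF assms(3)] by auto
  have p: "prob_space (distr (density N (d z)) L (s z))" if z: "z \<in> space M" for z
  proof (rule prob_space.prob_space_distr)
    have "emeasure (density N (d z)) (space N) = (\<integral>\<^sup>+n. d z n \<partial>N)"
      using z by (subst emeasure_density) (auto intro!: nn_integral_cong)
    then show "prob_space (density N (d z))"
      using z one by (intro prob_spaceI) simp
  qed (use z in simp)
  show ?thesis
  proof (rule measurable_prob_algebraI[OF p])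
    show "(\<lambda>z. distr (density N (d z)) L (s z)) \<in> M \<rightarrow>\<^sub>M subprob_algebra L"
    proof (rule measurable_subprob_algebra)
      fix A assume [measurable]: "A \<in> sets L"
      have "(\<lambda>z. \<integral>\<^sup>+n. d z n * indicator A (s z n) \<partial>N) \<in> borel_measurable M"
        by (rule N.borel_measurable_nn_integral) measurable
      moreover have "emeasure (distr (density N (d z)) L (s z)) A = (\<integral>\<^sup>+n. d z n * indicator A (s z n) \<partial>N)" if z: "z \<in> space M" for z
        using z by (subst emeasure_distr) 
          (auto simp: emeasure_density intro!: nn_integral_cong split: split_indicator)
      ultimately show "(\<lambda>z. emeasure (distr (density N (d z)) L (s z)) A) \<in> borel_measurable M"
        by (simp cong: measurable_cong)
    qed (auto intro!: prob_space_imp_subprob_space p)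
  qed
qed

lemma couplings_bind:
  fixes K :: "'a::topological_space \<Rightarrow> 'a measure"
  assumes \<pi>: "\<pi> \<in> couplings \<nu>1 \<nu>2"
    and K[measurable]: "K \<in> borel \<rightarrow>\<^sub>M prob_algebra borel"
    and Q[measurable]: "Q \<in> borel \<Otimes>\<^sub>M borel \<rightarrow>\<^sub>M prob_algebra (borel \<Otimes>\<^sub>M borel)"
    and QK: "\<And>x y. Q (x, y) \<in> couplings (K x) (K y)"
  shows "(\<pi> \<bind> Q) \<in> couplings (\<nu>1 \<bind> K) (\<nu>2 \<bind> K)"
proof -
  have s[measurable_cong]: "sets \<pi> = sets (borel \<Otimes>\<^sub>M borel)" and p: "prob_space \<pi>"
    and m: "distr \<pi> borel fst = \<nu>1" "distr \<pi> borel snd = \<nu>2"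
    using \<pi> by (auto simp: couplings_def)
  interpret prob_space \<pi> by fact
  have sp: "space \<pi> = UNIV" using sets_eq_imp_space_eq[OF s] by (simp add: space_pair_measure)
  have Q'[measurable]: "Q \<in> \<pi> \<rightarrow>\<^sub>M prob_algebra (borel \<Otimes>\<^sub>M borel)" by measurable
  have Qs: "Q \<in> \<pi> \<rightarrow>\<^sub>M subprob_algebra (borel \<Otimes>\<^sub>M borel)" by (rule measurable_prob_algebraD) measurable
  have Ks: "K \<in> borel \<rightarrow>\<^sub>M subprob_algebra borel" by (rule measurable_prob_algebraD) measurable
  have pr: "\<pi> \<in> space (prob_algebra (borel \<Otimes>\<^sub>M borel))"
    using p s by (auto simp: space_prob_algebra)
  have Qm: "distr (Q z) borel fst = K (fst z)" "distr (Q z) borel snd = K (snd z)" for z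
    using QK[of "fst z" "snd z"] by (auto simp: couplings_def)
  have "distr (\<pi> \<bind> Q) borel fst = \<pi> \<bind> (\<lambda>z. distr (Q z) borel fst)"
    by (rule distr_bind[OF Qs]) (auto simp: not_empty)
  also have "\<dots> = \<nu>1 \<bind> K"
    unfolding Qm m(1)[symmetric] by (rule bind_distr[OF _ Ks, symmetric]) (auto simp: not_empty)
  finally have 1: "distr (\<pi> \<bind> Q) borel fst = \<nu>1 \<bind> K" .
  have "distr (\<pi> \<bind> Q) borel snd = \<pi> \<bind> (\<lambda>z. distr (Q z) borel snd)"
    by (rule distr_bind[OF Qs]) (auto simp: not_empty)
  also have "\<dots> = \<nu>2 \<bind> K"
    unfolding Qm m(2)[symmetric] by (rule bind_distr[OF _ Ks, symmetric]) (auto simp: not_empty)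
  finally have 2: "distr (\<pi> \<bind> Q) borel snd = \<nu>2 \<bind> K" .
  have "sets (\<pi> \<bind> Q) = sets (borel \<Otimes>\<^sub>M borel)" by (rule sets_bind[OF sets_kernel[OF Qs]]) (auto simp: not_empty)
  moreover have "prob_space (\<pi> \<bind> Q)" by (rule prob_space_bind'[OF pr Q])
  ultimately show ?thesis using 1 2 by (simp add: couplings_def)
qed

text \<open>
  Applying the coupling kernel \<open>Q\<close> again and again to a given coupling of the initial laws produces couplings of the
  iterated laws whose cost has decayed geometrically.
\<close>

lemma couplings_kernel_power:
  fixes P :: "'a::topological_space \<Rightarrow> 'a measure"
  assumes P[measurable]: "P \<in> borel \<rightarrow>\<^sub>M prob_algebra borel"
    and Q[measurable]: "Q \<in> borel \<Otimes>\<^sub>M borel \<rightarrow>\<^sub>M prob_algebra (borel \<Otimes>\<^sub>M borel)"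
    and QP: "\<And>x y. Q (x, y) \<in> couplings (P x) (P y)"
    and D[measurable]: "D \<in> borel_measurable (borel \<Otimes>\<^sub>M borel)"
    and contr: "\<And>x y. (\<integral>\<^sup>+z. D z \<partial>Q (x, y)) \<le> a * D (x, y)"
    and \<nu>: "sets \<nu>1 = sets borel" "sets \<nu>2 = sets borel" and \<pi>: "\<pi> \<in> couplings \<nu>1 \<nu>2"
  shows "\<exists>\<pi>'\<in>couplings (\<nu>1 \<bind> kernel_power P n) (\<nu>2 \<bind> kernel_power P n). (\<integral>\<^sup>+z. D z \<partial>\<pi>') \<le> a ^ n * (\<integral>\<^sup>+z. D z \<partial>\<pi>)"
proof (induction n)
  case 0
  have "\<nu> \<bind> kernel_power P 0 = \<nu>" if "sets \<nu> = sets borel" for \<nu>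
  proof -
    have "kernel_power P 0 = return borel" by (rule ext) simp
    then show ?thesis using bind_return''[OF that] by simp
  qed
  then show ?case using \<pi> \<nu> by (intro bexI[of _ \<pi>]) (simp_all del: kernel_power.simps)
next
  case (Suc n)
  have kp: "kernel_power P n \<in> borel \<rightarrow>\<^sub>M prob_algebra borel"
    by (induction n) (auto intro!: measurable_bind_prob_space[OF _ P] measurable_return_prob_space)
  have Ps: "P \<in> borel \<rightarrow>\<^sub>M subprob_algebra borel" by (rule measurable_prob_algebraD) measurable
  have step: "\<nu> \<bind> kernel_power P (Suc n) = (\<nu> \<bind> kernel_power P n) \<bind> P" if [measurable_cong]: "sets \<nu> = sets borel" for \<nu>
  proof -
    have "kernel_power P n \<in> \<nu> \<rightarrow>\<^sub>M subprob_algebra borel" using measurable_prob_algebraD[OF kp] by measurable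
    moreover have "kernel_power P (Suc n) = (\<lambda>x. kernel_power P n x \<bind> P)" by (rule ext) simp
    ultimately show ?thesis using bind_assoc[OF _ Ps] by metis
  qed
  obtain \<pi>' where \<pi>': "\<pi>' \<in> couplings (\<nu>1 \<bind> kernel_power P n) (\<nu>2 \<bind> kernel_power P n)"
    "(\<integral>\<^sup>+z. D z \<partial>\<pi>') \<le> a ^ n * (\<integral>\<^sup>+z. D z \<partial>\<pi>)" using Suc by blast
  have s[measurable_cong]: "sets \<pi>' = sets (borel \<Otimes>\<^sub>M borel)" using \<pi>' by (auto simp: couplings_def)
  have Qs: "Q \<in> \<pi>' \<rightarrow>\<^sub>M subprob_algebra (borel \<Otimes>\<^sub>M borel)" by (rule measurable_prob_algebraD) measurable
  have "(\<integral>\<^sup>+z. D z \<partial>(\<pi>' \<bind> Q)) = (\<integral>\<^sup>+z. \<integral>\<^sup>+z'. D z' \<partial>Q z \<partial>\<pi>')"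
    by (rule nn_integral_bind[OF D Qs])
  also have "\<dots> \<le> (\<integral>\<^sup>+z. a * D z \<partial>\<pi>')"
    using contr by (intro nn_integral_mono) (metis surj_pair)
  also have "\<dots> = a * (\<integral>\<^sup>+z. D z \<partial>\<pi>')" by (rule nn_integral_cmult) measurable
  also have "\<dots> \<le> a * (a ^ n * (\<integral>\<^sup>+z. D z \<partial>\<pi>))" by (intro mult_left_mono \<pi>') simp
  finally have "(\<integral>\<^sup>+z. D z \<partial>(\<pi>' \<bind> Q)) \<le> a ^ Suc n * (\<integral>\<^sup>+z. D z \<partial>\<pi>)" by (simp add: mult_ac)
  then show ?case unfolding step[OF \<nu>(1)] step[OF \<nu>(2)] using couplings_bind[OF \<pi>'(1) P Q QP] by blast
qed

text \<open>
  Passing from \<open>d\<close> to \<open>D\<close> and back costs the factor \<open>A * B\<close>, whatever the number of steps. It is absorbed by enlarging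
  the rate \<open>\<alpha>\<close> to \<open>(1 + \<alpha>) / 2\<close>, from the index on where \<open>A * B * (\<alpha> / l) ^ n < 1\<close>.
\<close>

lemma wasserstein_geometric_decay:
  fixes P :: "'a::topological_space \<Rightarrow> 'a measure" and d D :: "'a \<Rightarrow> 'a \<Rightarrow> real"
  assumes P[measurable]: "P \<in> borel \<rightarrow>\<^sub>M prob_algebra borel"
    and Q[measurable]: "Q \<in> borel \<Otimes>\<^sub>M borel \<rightarrow>\<^sub>M prob_algebra (borel \<Otimes>\<^sub>M borel)"
    and QP: "\<And>x y. Q (x, y) \<in> couplings (P x) (P y)"
    and D[measurable]: "(\<lambda>(x, y). D x y) \<in> borel_measurable (borel \<Otimes>\<^sub>M borel)"
    and d[measurable]: "(\<lambda>(x, y). d x y) \<in> borel_measurable (borel \<Otimes>\<^sub>M borel)"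
    and contr: "\<And>x y. (\<integral>\<^sup>+(x', y'). ennreal (D x' y') \<partial>Q (x, y)) \<le> ennreal \<alpha> * ennreal (D x y)"
    and \<alpha>: "0 < \<alpha>" "\<alpha> < 1" and AB: "0 < A" "0 < B" "\<And>x y. d x y \<le> A * D x y" "\<And>x y. D x y \<le> B * d x y"
  shows "\<exists>l n1. 0 < l \<and> l < 1 \<and> (\<forall>\<nu>1 \<nu>2. sets \<nu>1 = sets borel \<and> sets \<nu>2 = sets borel \<longrightarrow>
    (\<forall>n\<ge>n1. wasserstein d (\<nu>1 \<bind> kernel_power P n) (\<nu>2 \<bind> kernel_power P n) \<le> ennreal (l ^ n) * wasserstein d \<nu>1 \<nu>2))"
proof -
  define l where "l = (1 + \<alpha>) / 2"
  have l: "0 < l" "l < 1" "\<alpha> < l" using \<alpha> by (auto simp: l_def)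
  have "(\<lambda>n. (A * B) * (\<alpha> / l) ^ n) \<longlonglongrightarrow> (A * B) * 0"
    using l \<alpha> by (intro tendsto_intros LIMSEQ_power_zero) auto
  then have "\<forall>\<^sub>F n in sequentially. (A * B) * (\<alpha> / l) ^ n < 1"
    by (rule order_tendstoD) simp
  then obtain n1 where n1: "\<And>n. n \<ge> n1 \<Longrightarrow> (A * B) * (\<alpha> / l) ^ n < 1"
    by (auto simp: eventually_sequentially)
  have main: "wasserstein d (\<nu>1 \<bind> kernel_power P n) (\<nu>2 \<bind> kernel_power P n) \<le> ennreal (l ^ n) * wasserstein d \<nu>1 \<nu>2"
    if \<nu>: "sets \<nu>1 = sets borel" "sets \<nu>2 = sets borel" and n: "n \<ge> n1" for \<nu>1 \<nu>2 n
  proof -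
    let ?W = "wasserstein d (\<nu>1 \<bind> kernel_power P n) (\<nu>2 \<bind> kernel_power P n)"
    have *: "?W \<le> ennreal (l ^ n) * (\<integral>\<^sup>+p. ennreal (d (fst p) (snd p)) \<partial>\<pi>)" if \<pi>: "\<pi> \<in> couplings \<nu>1 \<nu>2" for \<pi>
    proof -
      obtain \<pi>' where \<pi>': "\<pi>' \<in> couplings (\<nu>1 \<bind> kernel_power P n) (\<nu>2 \<bind> kernel_power P n)"
        "(\<integral>\<^sup>+(x, y). ennreal (D x y) \<partial>\<pi>') \<le> ennreal \<alpha> ^ n * (\<integral>\<^sup>+(x, y). ennreal (D x y) \<partial>\<pi>)"
      proof -
        have "(\<integral>\<^sup>+z. (case z of (x', y') \<Rightarrow> ennreal (D x' y')) \<partial>Q (x, y)) \<le> ennreal \<alpha> * (case (x, y) of (x', y') \<Rightarrow> ennreal (D x' y'))" for x y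
          using contr[of x y] by simp
        moreover have "(\<lambda>z. case z of (x', y') \<Rightarrow> ennreal (D x' y')) \<in> borel_measurable (borel \<Otimes>\<^sub>M borel)"
          by measurable
        ultimately show ?thesis using couplings_kernel_power[OF P Q QP _ _ \<nu> \<pi>, of "\<lambda>(x, y). ennreal (D x y)" "ennreal \<alpha>" n] that by blast
      qed
      have [measurable_cong]: "sets \<pi> = sets (borel \<Otimes>\<^sub>M borel)" "sets \<pi>' = sets (borel \<Otimes>\<^sub>M borel)"
        using \<pi> \<pi>' by (auto simp: couplings_def)
      have "?W \<le> (\<integral>\<^sup>+p. ennreal (d (fst p) (snd p)) \<partial>\<pi>')"
        unfolding wasserstein_def using \<pi>' by (intro INF_lower)
      also have "\<dots> \<le> (\<integral>\<^sup>+p. ennreal A * ennreal (D (fst p) (snd p)) \<partial>\<pi>')"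
        using AB by (intro nn_integral_mono) (simp add: ennreal_leI flip: ennreal_mult')
      also have "\<dots> = ennreal A * (\<integral>\<^sup>+(x, y). ennreal (D x y) \<partial>\<pi>')"
        by (subst nn_integral_cmult[symmetric]) (auto simp: case_prod_beta)
      also have "\<dots> \<le> ennreal A * (ennreal \<alpha> ^ n * (\<integral>\<^sup>+(x, y). ennreal (D x y) \<partial>\<pi>))"
        by (intro mult_left_mono \<pi>') simp
      also have "\<dots> \<le> ennreal A * (ennreal \<alpha> ^ n * (\<integral>\<^sup>+p. ennreal B * ennreal (d (fst p) (snd p)) \<partial>\<pi>))"
        using AB by (intro mult_left_mono nn_integral_mono) (auto simp: case_prod_beta ennreal_leI simp flip: ennreal_mult')
      also have "\<dots> = ennreal A * (ennreal \<alpha> ^ n * (ennreal B * (\<integral>\<^sup>+p. ennreal (d (fst p) (snd p)) \<partial>\<pi>)))"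
        by (subst nn_integral_cmult) auto
      also have "\<dots> = ennreal (A * B * \<alpha> ^ n) * (\<integral>\<^sup>+p. ennreal (d (fst p) (snd p)) \<partial>\<pi>)"
        using AB \<alpha> by (simp add: ennreal_mult ennreal_power mult_ac)
      also have "\<dots> \<le> ennreal (l ^ n) * (\<integral>\<^sup>+p. ennreal (d (fst p) (snd p)) \<partial>\<pi>)"
        using n1[OF n] l by (intro mult_right_mono ennreal_leI) (auto simp: power_divide field_simps)
      finally show ?thesis .
    qed
    have lpos: "0 < l ^ n" using l by simp
    have "ennreal (1 / l ^ n) * ?W \<le> wasserstein d \<nu>1 \<nu>2"
      unfolding wasserstein_def[of d \<nu>1 \<nu>2]
    proof (rule INF_greatest)
      fix \<pi> assume "\<pi> \<in> couplings \<nu>1 \<nu>2"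
      from * [OF this] have "ennreal (1 / l ^ n) * ?W \<le> ennreal (1 / l ^ n) * (ennreal (l ^ n) * (\<integral>\<^sup>+p. ennreal (d (fst p) (snd p)) \<partial>\<pi>))"
        by (rule mult_left_mono) simp
      also have "\<dots> = (\<integral>\<^sup>+p. ennreal (d (fst p) (snd p)) \<partial>\<pi>)"
        using lpos l by (simp add: mult.assoc[symmetric] ennreal_mult[symmetric])
      finally show "ennreal (1 / l ^ n) * ?W \<le> (\<integral>\<^sup>+p. ennreal (d (fst p) (snd p)) \<partial>\<pi>)" .
    qed
    then have "ennreal (l ^ n) * (ennreal (1 / l ^ n) * ?W) \<le> ennreal (l ^ n) * wasserstein d \<nu>1 \<nu>2"
      by (rule mult_left_mono) simp
    then show ?thesis using lpos l by (simp add: mult.assoc[symmetric] ennreal_mult[symmetric])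
  qed
  show ?thesis using l main by blast
qed

section \<open>Coupling of a contraction with state-dependent innovations\<close>

text \<open>
  The Markov chain \<open>x \<mapsto> \<rho> x + T w\<close>, where the innovation \<open>w\<close> has density \<open>p x\<close> with respect to \<open>G\<close>. The
  comparability of the densities says that innovations from different starting points can be made equal
  with probability \<open>exp (- c \<parallel>x - y\<parallel>)\<close>.
\<close>

locale comparable_shift_kernel = G: prob_space G for G :: "'w measure" +
  fixes T :: "'w \<Rightarrow> 'a::{real_normed_vector, second_countable_topology}"
    and p :: "'a \<Rightarrow> 'w \<Rightarrow> real" and \<rho> c :: real
  assumes T[measurable]: "T \<in> borel_measurable G"
    and p[measurable]: "(\<lambda>(x, w). p x w) \<in> borel_measurable (borel \<Otimes>\<^sub>M G)"
    and p_nonneg: "0 \<le> p x w"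
    and p_int: "(\<integral>\<^sup>+w. ennreal (p x w) \<partial>G) = 1"
    and comparable: "exp (- c * norm (x - y)) * p x w \<le> p y w"
    and \<rho>: "0 \<le> \<rho>" "\<rho> < 1" and c: "0 < c"
begin

definition shift_kernel :: "'a \<Rightarrow> 'a measure" where
  "shift_kernel x = distr (density G (\<lambda>w. ennreal (p x w))) borel (\<lambda>w. \<rho> *\<^sub>R x + T w)"

definition overlap :: "'a \<Rightarrow> 'a \<Rightarrow> real" where
  "overlap x y = exp (- c * norm (x - y))"

text \<open>
  The flag \<open>b\<close> records whether the two chains share the innovation \<open>w\<close>. If not, \<open>w\<close> and \<open>w'\<close> are independent
  with densities \<open>p x\<close> and \<open>p y - a p x\<close>, \<open>a = overlap x y\<close>. The latter has mass \<open>1 - a\<close>, which is just the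
  probability of this case; multiplying by \<open>1 - a\<close> and normalizing cancel, also for \<open>a = 1\<close>.
\<close>

definition coupling_density :: "'a \<times> 'a \<Rightarrow> ('w \<times> 'w) \<times> bool \<Rightarrow> ennreal" where
  "coupling_density = (\<lambda>(x, y) ((w, w'), b).
     if b then ennreal (overlap x y * p x w)
     else ennreal (p x w * (p y w' - overlap x y * p x w')))"

definition coupling_step :: "'a \<times> 'a \<Rightarrow> ('w \<times> 'w) \<times> bool \<Rightarrow> 'a \<times> 'a" where
  "coupling_step = (\<lambda>(x, y) ((w, w'), b).
     (\<rho> *\<^sub>R x + T w, \<rho> *\<^sub>R y + T (if b then w else w')))"

abbreviation (input) innovations :: "(('w \<times> 'w) \<times> bool) measure" where
  "innovations \<equiv> (G \<Otimes>\<^sub>M G) \<Otimes>\<^sub>M count_space UNIV"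

definition coupling_kernel :: "'a \<times> 'a \<Rightarrow> ('a \<times> 'a) measure" where
  "coupling_kernel z = distr (density innovations (coupling_density z)) (borel \<Otimes>\<^sub>M borel) (coupling_step z)"

lemma measurable_p[measurable (raw)]:
  "f \<in> borel_measurable M \<Longrightarrow> g \<in> M \<rightarrow>\<^sub>M G \<Longrightarrow> (\<lambda>x. p (f x) (g x)) \<in> borel_measurable M"
  using measurable_compose[OF measurable_Pair p, of f M g] by simp

lemma overlap_bounds: "0 < overlap x y" "overlap x y \<le> 1"
  using c by (auto simp: overlap_def)

lemma overlap_measurable[measurable (raw)]:
  "f \<in> borel_measurable M \<Longrightarrow> g \<in> borel_measurable M \<Longrightarrow> (\<lambda>x. overlap (f x) (g x)) \<in> borel_measurable M"
  unfolding overlap_def by measurable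

lemma remainder_nonneg: "0 \<le> p y w - overlap x y * p x w"
  using comparable by (simp add: overlap_def)

lemma remainder_integral:
  assumes [measurable]: "\<psi> \<in> borel_measurable G"
  shows "(\<integral>\<^sup>+w. ennreal (p y w - overlap x y * p x w) * \<psi> w \<partial>G) + ennreal (overlap x y) * (\<integral>\<^sup>+w. ennreal (p x w) * \<psi> w \<partial>G)
    = (\<integral>\<^sup>+w. ennreal (p y w) * \<psi> w \<partial>G)"
proof -
  have "(\<integral>\<^sup>+w. ennreal (p y w) * \<psi> w \<partial>G) =
    (\<integral>\<^sup>+w. ennreal (p y w - overlap x y * p x w) * \<psi> w + ennreal (overlap x y) * (ennreal (p x w) * \<psi> w) \<partial>G)"
  proof (intro nn_integral_cong)
    fix w
    have "ennreal (p y w) = ennreal (p y w - overlap x y * p x w) + ennreal (overlap x y * p x w)"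
      using overlap_bounds[of x y] p_nonneg[of x w] remainder_nonneg[of y w x]
      by (subst ennreal_plus[symmetric]) auto
    then show "ennreal (p y w) * \<psi> w = ennreal (p y w - overlap x y * p x w) * \<psi> w + ennreal (overlap x y) * (ennreal (p x w) * \<psi> w)"
      using overlap_bounds[of x y] p_nonneg[of x w] by (simp add: distrib_right ennreal_mult mult.assoc)
  qed
  also have "\<dots> = (\<integral>\<^sup>+w. ennreal (p y w - overlap x y * p x w) * \<psi> w \<partial>G) + ennreal (overlap x y) * (\<integral>\<^sup>+w. ennreal (p x w) * \<psi> w \<partial>G)"
    by (subst nn_integral_add) (auto simp: nn_integral_cmult)
  finally show ?thesis ..
qed

lemma remainder_mass: "(\<integral>\<^sup>+w. ennreal (p y w - overlap x y * p x w) \<partial>G) = ennreal (1 - overlap x y)"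
proof -
  have "(\<integral>\<^sup>+w. ennreal (p y w - overlap x y * p x w) \<partial>G) + ennreal (overlap x y) = 1"
    using remainder_integral[of "\<lambda>_. 1" y x] by (simp add: p_int)
  then have "(\<integral>\<^sup>+w. ennreal (p y w - overlap x y * p x w) \<partial>G) = 1 - ennreal (overlap x y)"
    by (metis ennreal_add_diff_cancel_right ennreal_neq_top)
  then show ?thesis using overlap_bounds[of x y] by (simp add: ennreal_minus flip: ennreal_1)
qed

lemma sigma_finite_innovations: "sigma_finite_measure innovations"
proof -
  interpret pair_prob_space G G ..
  interpret sigma_finite_measure "count_space (UNIV :: bool set)"
    by (rule sigma_finite_measure_count_space_finite) simp
  interpret pair_sigma_finite "G \<Otimes>\<^sub>M G" "count_space (UNIV :: bool set)" ..
  show ?thesis by (rule sigma_finite_measure_axioms)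
qed

lemma nn_integral_innovations:
  assumes [measurable]: "F \<in> borel_measurable innovations"
  shows "(\<integral>\<^sup>+n. F n \<partial>innovations) = (\<integral>\<^sup>+w. \<integral>\<^sup>+w'. F ((w, w'), True) + F ((w, w'), False) \<partial>G \<partial>G)"
proof -
  interpret sigma_finite_measure "count_space (UNIV :: bool set)"
    by (rule sigma_finite_measure_count_space_finite) simp
  have "(\<integral>\<^sup>+n. F n \<partial>innovations) = (\<integral>\<^sup>+z. \<integral>\<^sup>+b. F (z, b) \<partial>count_space UNIV \<partial>(G \<Otimes>\<^sub>M G))"
    by (rule nn_integral_fst[symmetric]) simp
  also have "\<dots> = (\<integral>\<^sup>+z. F (z, True) + F (z, False) \<partial>(G \<Otimes>\<^sub>M G))"
    by (simp add: nn_integral_count_space_finite UNIV_bool add.commute)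
  also have "\<dots> = (\<integral>\<^sup>+w. \<integral>\<^sup>+w'. F ((w, w'), True) + F ((w, w'), False) \<partial>G \<partial>G)"
    by (subst G.nn_integral_fst[symmetric]) auto
  finally show ?thesis .
qed

lemma coupling_density_measurable[measurable]:
  "(\<lambda>(z, n). coupling_density z n) \<in> borel_measurable ((borel \<Otimes>\<^sub>M borel) \<Otimes>\<^sub>M innovations)"
  unfolding coupling_density_def case_prod_beta by measurable

lemma coupling_step_measurable[measurable]:
  "(\<lambda>(z, n). coupling_step z n) \<in> (borel \<Otimes>\<^sub>M borel) \<Otimes>\<^sub>M innovations \<rightarrow>\<^sub>M borel \<Otimes>\<^sub>M borel"
  unfolding coupling_step_def case_prod_beta by measurable

lemma coupling_density_measurable1[measurable]: "coupling_density z \<in> borel_measurable innovations"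
  using measurable_Pair2[OF coupling_density_measurable, of z] by (simp add: space_pair_measure)

lemma coupling_step_measurable1[measurable]: "coupling_step z \<in> innovations \<rightarrow>\<^sub>M borel \<Otimes>\<^sub>M borel"
  using measurable_Pair2[OF coupling_step_measurable, of z] by (simp add: space_pair_measure)

lemma nn_integral_coupling:
  assumes [measurable]: "F \<in> borel_measurable innovations"
  shows "(\<integral>\<^sup>+n. coupling_density (x, y) n * F n \<partial>innovations) =
    ennreal (overlap x y) * (\<integral>\<^sup>+w. \<integral>\<^sup>+w'. ennreal (p x w) * F ((w, w'), True) \<partial>G \<partial>G)
  + (\<integral>\<^sup>+w. ennreal (p x w) * (\<integral>\<^sup>+w'. ennreal (p y w' - overlap x y * p x w') * F ((w, w'), False) \<partial>G) \<partial>G)"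
proof -
  have "(\<integral>\<^sup>+n. coupling_density (x, y) n * F n \<partial>innovations) =
    (\<integral>\<^sup>+w. \<integral>\<^sup>+w'. ennreal (overlap x y) * (ennreal (p x w) * F ((w, w'), True))
      + ennreal (p x w) * (ennreal (p y w' - overlap x y * p x w') * F ((w, w'), False)) \<partial>G \<partial>G)"
    using overlap_bounds[of x y] p_nonneg remainder_nonneg
    by (subst nn_integral_innovations, measurable) (auto simp: coupling_density_def ennreal_mult mult.assoc intro!: nn_integral_cong)
  also have "\<dots> = (\<integral>\<^sup>+w. ennreal (overlap x y) * (\<integral>\<^sup>+w'. ennreal (p x w) * F ((w, w'), True) \<partial>G)
      + ennreal (p x w) * (\<integral>\<^sup>+w'. ennreal (p y w' - overlap x y * p x w') * F ((w, w'), False) \<partial>G) \<partial>G)"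
    by (intro nn_integral_cong) (simp add: nn_integral_add nn_integral_cmult)
  also have "\<dots> = ennreal (overlap x y) * (\<integral>\<^sup>+w. \<integral>\<^sup>+w'. ennreal (p x w) * F ((w, w'), True) \<partial>G \<partial>G)
  + (\<integral>\<^sup>+w. ennreal (p x w) * (\<integral>\<^sup>+w'. ennreal (p y w' - overlap x y * p x w') * F ((w, w'), False) \<partial>G) \<partial>G)"
    by (subst nn_integral_add) (auto simp: nn_integral_cmult)
  finally show ?thesis .
qed

lemma p_int_mult: "(\<integral>\<^sup>+w. ennreal (p x w) * k \<partial>G) = k"
  by (simp add: nn_integral_multc p_int)

lemma nn_integral_coupling_first:
  assumes [measurable]: "\<phi> \<in> borel_measurable G"
  shows "(\<integral>\<^sup>+n. coupling_density (x, y) n * \<phi> (fst (fst n)) \<partial>innovations) = (\<integral>\<^sup>+w. ennreal (p x w) * \<phi> w \<partial>G)"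
proof -
  have "(\<integral>\<^sup>+n. coupling_density (x, y) n * \<phi> (fst (fst n)) \<partial>innovations) =
    ennreal (overlap x y) * (\<integral>\<^sup>+w. ennreal (p x w) * \<phi> w \<partial>G)
    + (\<integral>\<^sup>+w. ennreal (p x w) * (ennreal (1 - overlap x y) * \<phi> w) \<partial>G)"
    by (subst nn_integral_coupling) (auto simp: nn_integral_multc remainder_mass G.emeasure_space_1)
  also have "(\<integral>\<^sup>+w. ennreal (p x w) * (ennreal (1 - overlap x y) * \<phi> w) \<partial>G) =
    ennreal (1 - overlap x y) * (\<integral>\<^sup>+w. ennreal (p x w) * \<phi> w \<partial>G)"
    by (subst nn_integral_cmult[symmetric]) (auto simp: mult_ac)
  also have "ennreal (overlap x y) * (\<integral>\<^sup>+w. ennreal (p x w) * \<phi> w \<partial>G) + \<dots> =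
    ennreal (overlap x y + (1 - overlap x y)) * (\<integral>\<^sup>+w. ennreal (p x w) * \<phi> w \<partial>G)"
    using overlap_bounds[of x y] by (subst ennreal_plus) (auto simp: distrib_right)
  finally show ?thesis by simp
qed

lemma nn_integral_coupling_second:
  assumes [measurable]: "\<psi> \<in> borel_measurable G"
  shows "(\<integral>\<^sup>+n. coupling_density (x, y) n * \<psi> (if snd n then fst (fst n) else snd (fst n)) \<partial>innovations) = (\<integral>\<^sup>+w. ennreal (p y w) * \<psi> w \<partial>G)"
  by (subst nn_integral_coupling)
     (auto simp: p_int_mult G.emeasure_space_1 remainder_integral[symmetric, of \<psi> y x] add.commute)

lemma coupling_density_mass: "(\<integral>\<^sup>+n. coupling_density z n \<partial>innovations) = 1"
  using nn_integral_coupling_first[of "\<lambda>_. 1" "fst z" "snd z"] by (simp add: p_int)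

lemma shift_kernel_measurable: "shift_kernel \<in> borel \<rightarrow>\<^sub>M prob_algebra borel"
  unfolding shift_kernel_def
  by (rule density_distr_kernel_measurable) (auto simp: p_int G.sigma_finite_measure_axioms)

lemma coupling_kernel_measurable: "coupling_kernel \<in> borel \<Otimes>\<^sub>M borel \<rightarrow>\<^sub>M prob_algebra (borel \<Otimes>\<^sub>M borel)"
  unfolding coupling_kernel_def
  by (rule density_distr_kernel_measurable) (auto simp: coupling_density_mass sigma_finite_innovations)

lemma nn_integral_shift_kernel:
  assumes [measurable]: "f \<in> borel_measurable borel"
  shows "(\<integral>\<^sup>+y. f y \<partial>shift_kernel x) = (\<integral>\<^sup>+w. ennreal (p x w) * f (\<rho> *\<^sub>R x + T w) \<partial>G)"
  unfolding shift_kernel_def by (simp add: nn_integral_distr nn_integral_density)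

lemma nn_integral_coupling_kernel:
  assumes [measurable]: "f \<in> borel_measurable (borel \<Otimes>\<^sub>M borel)"
  shows "(\<integral>\<^sup>+z'. f z' \<partial>coupling_kernel z) = (\<integral>\<^sup>+n. coupling_density z n * f (coupling_step z n) \<partial>innovations)"
  unfolding coupling_kernel_def by (simp add: nn_integral_distr nn_integral_density)

lemma nn_integral_coupling_kernel_fst:
  assumes [measurable]: "f \<in> borel_measurable borel"
  shows "(\<integral>\<^sup>+z. f (fst z) \<partial>coupling_kernel (x, y)) = (\<integral>\<^sup>+y. f y \<partial>shift_kernel x)"
  using nn_integral_coupling_first[of "\<lambda>w. f (\<rho> *\<^sub>R x + T w)" x y]
  by (simp add: nn_integral_coupling_kernel nn_integral_shift_kernel coupling_step_def case_prod_beta)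

lemma nn_integral_coupling_kernel_snd:
  assumes [measurable]: "f \<in> borel_measurable borel"
  shows "(\<integral>\<^sup>+z. f (snd z) \<partial>coupling_kernel (x, y)) = (\<integral>\<^sup>+y. f y \<partial>shift_kernel y)"
  using nn_integral_coupling_second[of "\<lambda>w. f (\<rho> *\<^sub>R y + T w)" x y]
  by (simp add: nn_integral_coupling_kernel nn_integral_shift_kernel coupling_step_def case_prod_beta)

lemma sets_coupling_kernel[measurable_cong]: "sets (coupling_kernel z) = sets (borel \<Otimes>\<^sub>M borel)"
  by (simp add: coupling_kernel_def)

lemma prob_space_coupling_kernel: "prob_space (coupling_kernel z)"
  using measurable_space[OF coupling_kernel_measurable, of z] by (simp add: space_prob_algebra space_pair_measure)

lemma coupling_kernel_couples: "coupling_kernel (x, y) \<in> couplings (shift_kernel x) (shift_kernel y)"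
proof -
  have "distr (coupling_kernel (x, y)) borel fst = shift_kernel x"
  proof (rule measure_eqI)
    fix A assume "A \<in> sets (distr (coupling_kernel (x, y)) borel fst)"
    then have [measurable]: "A \<in> sets borel" by simp
    have "emeasure (distr (coupling_kernel (x, y)) borel fst) A = (\<integral>\<^sup>+z. indicator A (fst z) \<partial>coupling_kernel (x, y))"
      by (subst nn_integral_indicator[symmetric], simp, subst nn_integral_distr) auto
    also have "\<dots> = emeasure (shift_kernel x) A"
      by (subst nn_integral_coupling_kernel_fst) (auto simp: shift_kernel_def)
    finally show "emeasure (distr (coupling_kernel (x, y)) borel fst) A = emeasure (shift_kernel x) A" .
  qed (simp add: shift_kernel_def)
  moreover have "distr (coupling_kernel (x, y)) borel snd = shift_kernel y"
  proof (rule measure_eqI)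
    fix A assume "A \<in> sets (distr (coupling_kernel (x, y)) borel snd)"
    then have [measurable]: "A \<in> sets borel" by simp
    have "emeasure (distr (coupling_kernel (x, y)) borel snd) A = (\<integral>\<^sup>+z. indicator A (snd z) \<partial>coupling_kernel (x, y))"
      by (subst nn_integral_indicator[symmetric], simp, subst nn_integral_distr) auto
    also have "\<dots> = emeasure (shift_kernel y) A"
      by (subst nn_integral_coupling_kernel_snd) (auto simp: shift_kernel_def)
    finally show "emeasure (distr (coupling_kernel (x, y)) borel snd) A = emeasure (shift_kernel y) A" .
  qed (simp add: shift_kernel_def)
  ultimately show ?thesis
    using prob_space_coupling_kernel sets_coupling_kernel by (simp add: couplings_def)
qed

text \<open>
  If the innovation is shared it cancels in the difference of the two chains, and \<open>H \<le> 1\<close> bounds the other case.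
\<close>

lemma coupling_distance:
  assumes [measurable]: "H \<in> borel_measurable borel" and H: "\<And>u. 0 \<le> H u" "\<And>u. H u \<le> 1"
  shows "(\<integral>\<^sup>+z. ennreal (H (fst z - snd z)) \<partial>coupling_kernel (x, y)) \<le>
    ennreal (overlap x y * H (\<rho> *\<^sub>R (x - y)) + (1 - overlap x y))"
proof -
  have "(\<integral>\<^sup>+z. ennreal (H (fst z - snd z)) \<partial>coupling_kernel (x, y)) =
    ennreal (overlap x y) * (\<integral>\<^sup>+w. \<integral>\<^sup>+w'. ennreal (p x w) * ennreal (H (\<rho> *\<^sub>R (x - y))) \<partial>G \<partial>G)
    + (\<integral>\<^sup>+w. ennreal (p x w) * (\<integral>\<^sup>+w'. ennreal (p y w' - overlap x y * p x w') * ennreal (H ((\<rho> *\<^sub>R x + T w) - (\<rho> *\<^sub>R y + T w'))) \<partial>G) \<partial>G)"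
    by (subst nn_integral_coupling_kernel, measurable, subst nn_integral_coupling, measurable)
       (auto simp: coupling_step_def scaleR_diff_right)
  also have "\<dots> \<le> ennreal (overlap x y) * (\<integral>\<^sup>+w. \<integral>\<^sup>+w'. ennreal (p x w) * ennreal (H (\<rho> *\<^sub>R (x - y))) \<partial>G \<partial>G)
    + (\<integral>\<^sup>+w. ennreal (p x w) * (\<integral>\<^sup>+w'. ennreal (p y w' - overlap x y * p x w') * 1 \<partial>G) \<partial>G)"
    using H by (intro add_mono mult_left_mono nn_integral_mono order_refl) auto
  also have "\<dots> = ennreal (overlap x y) * ennreal (H (\<rho> *\<^sub>R (x - y))) + ennreal (1 - overlap x y)"
    by (simp add: remainder_mass p_int_mult G.emeasure_space_1)
  also have "\<dots> = ennreal (overlap x y * H (\<rho> *\<^sub>R (x - y)) + (1 - overlap x y))"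
    using H overlap_bounds[of x y] by (simp add: ennreal_mult)
  finally show ?thesis .
qed

end

section \<open>Contraction of the weighted distance\<close>

text \<open>
  The difference \<open>exp (- \<kappa> s) - exp (- s)\<close> is compared with \<open>1 - exp (- s) \<le> s\<close>. The bound is uniform for
  \<open>s\<close> in a bounded interval, including the limit \<open>s = 0\<close>, where both sides vanish.
\<close>

lemma exp_gap:
  fixes s S \<kappa> :: real
  assumes "0 \<le> s" "s \<le> S" "\<kappa> \<le> 1"
  shows "1 - exp (- \<kappa> * s) \<le> (1 - exp (- S) * (1 - \<kappa>)) * (1 - exp (- s))"
proof -
  have "exp (- S) * (1 - \<kappa>) * (1 - exp (- s)) \<le> exp (- s) * (1 - \<kappa>) * s"
    using assms exp_ge_add_one_self[of "- s"] by (intro mult_mono) auto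
  also have "\<dots> = exp (- s) * ((1 - \<kappa>) * s)" by simp
  also have "\<dots> \<le> exp (- s) * (exp ((1 - \<kappa>) * s) - 1)"
    using exp_ge_add_one_self[of "(1 - \<kappa>) * s"] by (intro mult_left_mono) (linarith, simp)
  also have "\<dots> = exp (- \<kappa> * s) - exp (- s)"
    by (simp add: algebra_simps flip: exp_add)
  finally show ?thesis by (simp add: algebra_simps)
qed

text \<open>
  Here \<open>S = V x + V y\<close>, and \<open>h\<close>, \<open>h'\<close> are the distances before and after a step. For \<open>S\<close> below the threshold \<open>M\<close> the
  distance has contracted by \<open>1 - \<delta>\<close>, and \<open>\<beta>\<close> is chosen so small that the additive constant \<open>2 \<beta> K\<close> of the
  drift uses up only half of \<open>\<delta>\<close>. For \<open>S\<close> above \<open>M\<close> half of the margin \<open>1 - r\<close> pays for the constant \<open>2 K\<close>,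
  and the remaining \<open>r' = (1 + r) / 2\<close> still yields a factor below \<open>1\<close>, because \<open>(1 + r' s) / (1 + s)\<close> decreases in \<open>s\<close>.
\<close>

lemma weighted_two_regimes:
  fixes r K M \<delta> \<beta> S h h' :: real
  assumes r: "0 \<le> r" "r < 1" and K: "0 \<le> K" and M: "M = 4 * K / (1 - r) + 1"
    and \<delta>: "0 < \<delta>" "\<delta> < 1" and \<beta>: "\<beta> = \<delta> / (4 * K + 1)" and S: "0 \<le> S"
    and h: "0 \<le> h'" "h' \<le> h" and small: "S \<le> M \<Longrightarrow> h' \<le> (1 - \<delta>) * h"
  shows "h' * (1 + \<beta> * (2 * K + r * S)) \<le>
    max (max (1 - \<delta> / 2) r) ((1 + (1 + r) / 2 * (\<beta> * M)) / (1 + \<beta> * M)) * (h * (1 + \<beta> * S))"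
    (is "_ \<le> ?q * _")
proof -
  have b: "0 < \<beta>" "4 * (\<beta> * K) \<le> \<delta>" using \<delta> K by (auto simp: \<beta> field_simps)
  have Mp: "0 < M" using K r by (simp add: M add_nonneg_pos)
  have hn: "0 \<le> h" using h by simp
  show ?thesis
  proof (cases "S \<le> M")
    case True
    have "h' * (1 + \<beta> * (2 * K + r * S)) \<le> ((1 - \<delta>) * h) * (1 + \<beta> * (2 * K + r * S))"
      using b K r S small[OF True] by (intro mult_right_mono) auto
    also have "\<dots> = h * ((1 - \<delta>) * (1 + 2 * (\<beta> * K)) + (1 - \<delta>) * (r * (\<beta> * S)))"
      by (simp add: algebra_simps)
    also have "\<dots> \<le> h * (?q + ?q * (\<beta> * S))"
    proof (intro mult_left_mono hn add_mono)
      have "(1 - \<delta>) * (1 + 2 * (\<beta> * K)) \<le> (1 - \<delta>) * (1 + \<delta> / 2)"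
        using b \<delta> by (intro mult_left_mono) auto
      also have "\<dots> \<le> 1 - \<delta> / 2" using \<delta> by (simp add: algebra_simps)
      finally show "(1 - \<delta>) * (1 + 2 * (\<beta> * K)) \<le> ?q" by simp
      have "(1 - \<delta>) * (r * (\<beta> * S)) \<le> 1 * (r * (\<beta> * S))"
        using \<delta> b r S by (intro mult_right_mono) auto
      also have "\<dots> \<le> ?q * (\<beta> * S)"
        using b S by (simp only: mult_1) (intro mult_right_mono; simp)
      finally show "(1 - \<delta>) * (r * (\<beta> * S)) \<le> ?q * (\<beta> * S)" .
    qed
    finally show ?thesis by (simp add: algebra_simps)
  next
    case False
    define s where "s = \<beta> * S"
    define m where "m = \<beta> * M"
    define r' where "r' = (1 + r) / 2"
    have sm: "m \<le> s" "0 < m" using False b Mp by (auto simp: s_def m_def)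
    have r': "r' < 1" using r by (simp add: r'_def)
    have "2 * K + r * S \<le> r' * S"
    proof -
      have "4 * K / (1 - r) \<le> S" using False by (simp add: M)
      then have "4 * K \<le> (1 - r) * S" using r by (simp add: field_simps)
      then show ?thesis by (simp add: r'_def field_simps)
    qed
    then have "1 + \<beta> * (2 * K + r * S) \<le> 1 + r' * s"
      using mult_left_mono[of "2 * K + r * S" "r' * S" \<beta>] b by (simp add: s_def mult_ac)
    also have "\<dots> \<le> (1 + r' * m) / (1 + m) * (1 + s)"
    proof -
      have "0 \<le> (1 - r') * (s - m)" using sm r' by simp
      then have "(1 + r' * s) * (1 + m) \<le> (1 + r' * m) * (1 + s)" by (simp add: algebra_simps)
      then show ?thesis using sm by (simp add: pos_le_divide_eq)
    qed
    also have "\<dots> \<le> ?q * (1 + s)"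
      using sm by (intro mult_right_mono) (auto simp: r'_def m_def)
    finally have "1 + \<beta> * (2 * K + r * S) \<le> ?q * (1 + s)" .
    then have "h' * (1 + \<beta> * (2 * K + r * S)) \<le> h * (?q * (1 + s))"
      using h b K r S by (intro mult_mono) auto
    then show ?thesis by (simp add: s_def mult_ac)
  qed
qed

lemma ennreal_le_sqrtI:
  assumes "X\<^sup>2 \<le> ennreal a"
  shows "X \<le> ennreal (sqrt a)"
proof (cases X rule: ennreal_cases)
  case (real x)
  then have "ennreal (x\<^sup>2) \<le> ennreal a" using assms by (simp add: ennreal_power)
  then have "x\<^sup>2 \<le> max 0 a" by (metis ennreal_le_iff2 max.cobounded1 max.coboundedI2 order.trans zero_le_power2 order_antisym_conv)
  then have "x \<le> sqrt (max 0 a)" by (rule real_le_rsqrt)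
  then show ?thesis using real by (auto simp: ennreal_leI max_def split: if_splits)
next
  case top
  then show ?thesis using assms by (simp add: power2_eq_square top_unique)
qed

context comparable_shift_kernel
begin

text \<open>
  The exponent \<open>rate\<close> exceeds the fixed point \<open>c / (1 - \<rho>)\<close> of \<open>k \<mapsto> c + \<rho> k\<close>, for which the mean of
  \<open>1 - exp (- k r)\<close> would merely be preserved by the coupling.
\<close>

definition rate :: real where
  "rate = 2 * c / (1 - \<rho>)"

lemma rate_pos: "0 < rate"
  using c \<rho> by (simp add: rate_def)

definition gap :: "real \<Rightarrow> real" where
  "gap t = 1 - exp (- rate * t)"

definition weighted_gap :: "('a \<Rightarrow> real) \<Rightarrow> real \<Rightarrow> 'a \<Rightarrow> 'a \<Rightarrow> real" where
  "weighted_gap V \<beta> x y = sqrt (gap (norm (x - y)) * (1 + \<beta> * (V x + V y)))"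

lemma gap_bounds: "0 \<le> t \<Longrightarrow> 0 \<le> gap t" "gap t \<le> 1"
  using rate_pos by (auto simp: gap_def)

lemma gap_measurable[measurable]: "gap \<in> borel_measurable borel"
  unfolding gap_def by measurable

lemma gap_mono: "s \<le> t \<Longrightarrow> gap s \<le> gap t"
  using rate_pos by (auto simp: gap_def)

lemma coupling_gap:
  "(\<integral>\<^sup>+z. ennreal (gap (norm (fst z - snd z))) \<partial>coupling_kernel (x, y)) \<le> ennreal (gap ((1 + \<rho>) / 2 * norm (x - y)))"
proof -
  have "overlap x y * gap (norm (\<rho> *\<^sub>R (x - y))) + (1 - overlap x y) = gap ((1 + \<rho>) / 2 * norm (x - y))"
  proof -
    let ?r = "norm (x - y)"
    have "- c * ?r + - rate * (\<rho> * ?r) = - rate * ((1 + \<rho>) / 2 * ?r)"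
      using \<rho> by (simp add: rate_def field_simps)
    then show ?thesis
      using \<rho> by (simp add: overlap_def gap_def right_diff_distrib flip: exp_add)
  qed
  then show ?thesis
    using coupling_distance[of "\<lambda>u. gap (norm u)" x y] gap_bounds by simp
qed

text \<open>
  On the sublevel set of \<open>V\<close> at \<open>M\<close> the points have bounded distance, which determines the contraction \<open>\<delta>\<close> there;
  \<open>\<beta>\<close> is chosen afterwards. The geometric mean in the weighted distance is separated by the Cauchy-Schwarz
  inequality under the coupling of a single pair of points.
\<close>

theorem weighted_gap_contraction:
  assumes V[measurable]: "V \<in> borel_measurable borel" and V0: "\<And>x. 0 \<le> V x"
    and drift: "\<And>x. (\<integral>\<^sup>+y. ennreal (V y) \<partial>shift_kernel x) \<le> ennreal (r * V x + K)"
    and r: "0 \<le> r" "r < 1" and K: "0 \<le> K"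
    and sublevel: "\<And>M. \<exists>R. \<forall>x. V x \<le> M \<longrightarrow> norm x \<le> R"
  shows "\<exists>\<beta> \<alpha>. 0 < \<beta> \<and> \<beta> \<le> 1 \<and> 0 < \<alpha> \<and> \<alpha> < 1 \<and>
    (\<forall>x y. (\<integral>\<^sup>+(x', y'). ennreal (weighted_gap V \<beta> x' y') \<partial>coupling_kernel (x, y)) \<le> ennreal \<alpha> * ennreal (weighted_gap V \<beta> x y))"
proof -
  define M where "M = 4 * K / (1 - r) + 1"
  obtain R where R: "\<And>x. V x \<le> M \<Longrightarrow> norm x \<le> R" using sublevel by blast
  define \<delta> where "\<delta> = exp (- (rate * (2 * max R 0))) * (1 - (1 + \<rho>) / 2)"
  have \<delta>: "0 < \<delta>" "\<delta> < 1"
  proof -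
    show "0 < \<delta>" using \<rho> by (simp add: \<delta>_def)
    have "\<delta> \<le> 1 * (1 - (1 + \<rho>) / 2)"
      unfolding \<delta>_def using \<rho> c by (intro mult_right_mono) (auto simp: rate_pos less_imp_le)
    also have "\<dots> < 1" using \<rho> by (simp add: field_simps)
    finally show "\<delta> < 1" .
  qed
  define \<beta> where "\<beta> = \<delta> / (4 * K + 1)"
  have \<beta>: "0 < \<beta>" "\<beta> \<le> 1" using \<delta> K by (auto simp: \<beta>_def)
  define q where "q = max (max (1 - \<delta> / 2) r) ((1 + (1 + r) / 2 * (\<beta> * M)) / (1 + \<beta> * M))"
  have q: "0 < q" "q < 1"
  proof -
    have "0 < M" using K r by (simp add: M_def add_nonneg_pos)
    then have "0 < \<beta> * M" using \<beta> by simp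
    moreover from this have "(1 + r) / 2 * (\<beta> * M) < 1 * (\<beta> * M)"
      by (intro mult_strict_right_mono) (use r in simp_all)
    ultimately have "(1 + (1 + r) / 2 * (\<beta> * M)) / (1 + \<beta> * M) < 1"
      by (subst pos_divide_less_eq) simp_all
    then show "0 < q" "q < 1" using \<delta> r by (auto simp: q_def)
  qed
  have "(\<integral>\<^sup>+(x', y'). ennreal (weighted_gap V \<beta> x' y') \<partial>coupling_kernel (x, y)) \<le> ennreal (sqrt q) * ennreal (weighted_gap V \<beta> x y)" for x y
  proof -
    let ?Q = "coupling_kernel (x, y)" and ?S = "V x + V y" and ?r = "norm (x - y)"
    let ?f = "\<lambda>z. ennreal (sqrt (gap (norm (fst z - snd z))))"
    let ?g = "\<lambda>z. ennreal (sqrt (1 + \<beta> * (V (fst z) + V (snd z))))"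
    have g0: "0 \<le> gap (norm u)" for u :: 'a using gap_bounds by simp
    have w0: "0 \<le> 1 + \<beta> * (V a + V b)" for a b using V0 \<beta> by (simp add: add_nonneg_nonneg)
    have S0: "0 \<le> ?S" using V0 by simp
    have "(\<integral>\<^sup>+(x', y'). ennreal (weighted_gap V \<beta> x' y') \<partial>?Q) = (\<integral>\<^sup>+z. ?f z * ?g z \<partial>?Q)"
      using g0 w0 by (intro nn_integral_cong) (auto simp: weighted_gap_def real_sqrt_mult ennreal_mult)
    also have "\<dots> \<le> ennreal (sqrt (q * (gap ?r * (1 + \<beta> * ?S))))"
    proof (rule ennreal_le_sqrtI)
      have "(\<integral>\<^sup>+z. ?f z * ?g z \<partial>?Q)\<^sup>2 \<le> (\<integral>\<^sup>+z. (?f z)\<^sup>2 \<partial>?Q) * (\<integral>\<^sup>+z. (?g z)\<^sup>2 \<partial>?Q)"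
        by (rule Cauchy_Schwarz_nn_integral) measurable
      also have "(\<integral>\<^sup>+z. (?f z)\<^sup>2 \<partial>?Q) = (\<integral>\<^sup>+z. ennreal (gap (norm (fst z - snd z))) \<partial>?Q)"
        using g0 by (simp add: ennreal_power)
      also have "\<dots> \<le> ennreal (gap ((1 + \<rho>) / 2 * ?r))" by (rule coupling_gap)
      also have "(\<integral>\<^sup>+z. (?g z)\<^sup>2 \<partial>?Q) = (\<integral>\<^sup>+z. 1 + (ennreal \<beta> * ennreal (V (fst z)) + ennreal \<beta> * ennreal (V (snd z))) \<partial>?Q)"
        using w0 V0 \<beta> by (intro nn_integral_cong) (simp add: ennreal_power distrib_left ennreal_mult add_nonneg_nonneg)
      also have "\<dots> = 1 + (ennreal \<beta> * (\<integral>\<^sup>+y. ennreal (V y) \<partial>shift_kernel x) + ennreal \<beta> * (\<integral>\<^sup>+y. ennreal (V y) \<partial>shift_kernel y))"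
        using prob_space.emeasure_space_1[OF prob_space_coupling_kernel, of "(x, y)"]
        by (simp add: nn_integral_add nn_integral_cmult nn_integral_coupling_kernel_fst[of "\<lambda>y. ennreal (V y)"] nn_integral_coupling_kernel_snd[of "\<lambda>y. ennreal (V y)"])
      also have "\<dots> \<le> 1 + (ennreal \<beta> * ennreal (r * V x + K) + ennreal \<beta> * ennreal (r * V y + K))"
        by (intro add_mono mult_left_mono drift) auto
      also have "\<dots> = ennreal (1 + \<beta> * (2 * K + r * ?S))"
        using \<beta> r V0 K by (simp add: add_nonneg_nonneg algebra_simps flip: ennreal_mult ennreal_plus ennreal_1)
      finally have "(\<integral>\<^sup>+z. ?f z * ?g z \<partial>?Q)\<^sup>2 \<le> ennreal (gap ((1 + \<rho>) / 2 * ?r)) * ennreal (1 + \<beta> * (2 * K + r * ?S))"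
        by (simp add: mult_mono)
      also have "\<dots> = ennreal (gap ((1 + \<rho>) / 2 * ?r) * (1 + \<beta> * (2 * K + r * ?S)))"
        using \<beta> r V0 K \<rho> by (intro ennreal_mult[symmetric] gap_bounds add_nonneg_nonneg mult_nonneg_nonneg) auto
      also have "\<dots> \<le> ennreal (q * (gap ?r * (1 + \<beta> * ?S)))"
        unfolding q_def
      proof (intro ennreal_leI weighted_two_regimes[OF r K M_def \<delta> \<beta>_def S0])
        show "0 \<le> gap ((1 + \<rho>) / 2 * ?r)" using \<rho> by (intro gap_bounds) simp
        show "gap ((1 + \<rho>) / 2 * ?r) \<le> gap ?r" using \<rho> by (intro gap_mono mult_left_le_one_le) auto
        assume "?S \<le> M"
        then have "norm x \<le> R" "norm y \<le> R" using R[of x] R[of y] V0[of x] V0[of y] by auto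
        then have "?r \<le> 2 * max R 0" using norm_triangle_ineq4[of x y] by simp
        then have "rate * ?r \<le> rate * (2 * max R 0)"
          using rate_pos by (intro mult_left_mono) auto
        from exp_gap[OF _ this, of "(1 + \<rho>) / 2"]
        show "gap ((1 + \<rho>) / 2 * ?r) \<le> (1 - \<delta>) * gap ?r"
          using rate_pos \<rho> unfolding gap_def \<delta>_def by (simp add: mult_ac)
      qed
      finally show "(\<integral>\<^sup>+z. ?f z * ?g z \<partial>?Q)\<^sup>2 \<le> ennreal (q * (gap ?r * (1 + \<beta> * ?S)))" .
    qed
    also have "\<dots> = ennreal (sqrt q) * ennreal (weighted_gap V \<beta> x y)"
      using q g0 w0 by (simp add: weighted_gap_def real_sqrt_mult ennreal_mult)
    finally show ?thesis .
  qed
  then show ?thesis using \<beta> q by (intro exI[of _ \<beta>] exI[of _ "sqrt q"]) auto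
qed

text \<open>
  Below \<open>\<epsilon>\<close> the concave function \<open>gap\<close> lies between its chord and its tangent at \<open>0\<close>; beyond \<open>\<epsilon>\<close> both distances are bounded
  above and away from \<open>0\<close>.
\<close>

lemma gap_equivalent_d_eps:
  assumes "0 < \<epsilon>"
  shows "d_eps \<epsilon> x y \<le> gap (norm (x - y)) / gap \<epsilon>"
    "gap (norm (x - y)) \<le> max 1 (rate * \<epsilon>) * d_eps \<epsilon> x y"
proof -
  let ?r = "norm (x - y)" and ?k = "rate"
  have k: "0 < ?k" by (rule rate_pos)
  have g: "0 < gap \<epsilon>" using k assms by (simp add: gap_def)
  show "d_eps \<epsilon> x y \<le> gap ?r / gap \<epsilon>"
  proof (cases "\<epsilon> \<le> ?r")
    case True
    then show ?thesis using gap_mono[OF True] g assms by (simp add: d_eps_def min_def field_simps)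
  next
    case False
    define t where "t = ?r / \<epsilon>"
    have t: "0 \<le> t" "t \<le> 1" "?r = t * \<epsilon>" using False assms by (auto simp: t_def)
    have "exp ((1 - t) *\<^sub>R 0 + t *\<^sub>R (- ?k * \<epsilon>)) \<le> (1 - t) * exp 0 + t * exp (- ?k * \<epsilon>)"
      using t by (intro convex_onD[OF exp_convex]) auto
    then have "t * gap \<epsilon> \<le> gap ?r" using t(3) by (simp add: gap_def algebra_simps)
    then show ?thesis using g t assms by (simp add: d_eps_def t_def[symmetric] field_simps)
  qed
  show "gap ?r \<le> max 1 (?k * \<epsilon>) * d_eps \<epsilon> x y"
  proof (cases "\<epsilon> \<le> ?r")
    case True
    then show ?thesis using gap_bounds(2)[of ?r] assms by (simp add: d_eps_def min_def field_simps)
  next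
    case False
    have "gap ?r \<le> ?k * ?r" using exp_ge_add_one_self[of "- ?k * ?r"] by (simp add: gap_def)
    also have "\<dots> = (?k * \<epsilon>) * (?r / \<epsilon>)" using assms by simp
    also have "\<dots> \<le> max 1 (?k * \<epsilon>) * (?r / \<epsilon>)" using assms by (intro mult_right_mono) auto
    finally show ?thesis using False assms by (simp add: d_eps_def min_def)
  qed
qed

theorem wasserstein_decay:
  assumes V[measurable]: "V \<in> borel_measurable borel" and V0: "\<And>x. 0 \<le> V x"
    and drift: "\<And>x. (\<integral>\<^sup>+y. ennreal (V y) \<partial>shift_kernel x) \<le> ennreal (r * V x + K)"
    and r: "0 \<le> r" "r < 1" and K: "0 \<le> K"
    and sublevel: "\<And>M. \<exists>R. \<forall>x. V x \<le> M \<longrightarrow> norm x \<le> R"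
    and \<epsilon>: "0 < \<epsilon>"
  shows "\<exists>l n1. 0 < l \<and> l < 1 \<and> (\<forall>\<nu>1 \<nu>2. sets \<nu>1 = sets borel \<and> sets \<nu>2 = sets borel \<longrightarrow>
    (\<forall>n\<ge>n1. wasserstein (d_tilde V \<epsilon>) (\<nu>1 \<bind> kernel_power shift_kernel n) (\<nu>2 \<bind> kernel_power shift_kernel n)
      \<le> ennreal (l ^ n) * wasserstein (d_tilde V \<epsilon>) \<nu>1 \<nu>2))"
proof -
  obtain \<beta> \<alpha> where \<beta>: "0 < \<beta>" "\<beta> \<le> 1" and \<alpha>: "0 < \<alpha>" "\<alpha> < 1"
    and contr: "\<And>x y. (\<integral>\<^sup>+(x', y'). ennreal (weighted_gap V \<beta> x' y') \<partial>coupling_kernel (x, y)) \<le> ennreal \<alpha> * ennreal (weighted_gap V \<beta> x y)"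
    using weighted_gap_contraction[OF V V0 drift r K sublevel] by blast
  have g: "0 < gap \<epsilon>" using rate_pos \<epsilon> by (simp add: gap_def)
  define B where "B = max 1 (rate * \<epsilon>)"
  have B: "0 < B" by (simp add: B_def)
  have g0: "0 \<le> gap (norm u)" for u :: 'a using gap_bounds by simp
  have d0: "0 \<le> d_eps \<epsilon> x y" for x y :: 'a using \<epsilon> by (simp add: d_eps_def)
  note eq = gap_equivalent_d_eps[OF \<epsilon>, folded B_def]
  show ?thesis
  proof (rule wasserstein_geometric_decay[OF shift_kernel_measurable coupling_kernel_measurable coupling_kernel_couples _ _ contr \<alpha>])
    show "(\<lambda>(x, y). weighted_gap V \<beta> x y) \<in> borel_measurable (borel \<Otimes>\<^sub>M borel)"
      unfolding weighted_gap_def by measurable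
    show "(\<lambda>(x, y). d_tilde V \<epsilon> x y) \<in> borel_measurable (borel \<Otimes>\<^sub>M borel)"
      unfolding d_tilde_def d_eps_def by measurable
    show "0 < sqrt (1 / (gap \<epsilon> * \<beta>))" "0 < sqrt B" using g \<beta> B by auto
    show "d_tilde V \<epsilon> x y \<le> sqrt (1 / (gap \<epsilon> * \<beta>)) * weighted_gap V \<beta> x y" for x y
    proof -
      have S: "0 \<le> V x + V y" using V0 by simp
      have "1 + V x + V y \<le> (1 + \<beta> * (V x + V y)) / \<beta>"
        using \<beta> S by (simp add: field_simps)
      then have "d_eps \<epsilon> x y * (1 + V x + V y) \<le> (gap (norm (x - y)) / gap \<epsilon>) * ((1 + \<beta> * (V x + V y)) / \<beta>)"
        using eq(1)[of x y] d0[of x y] g g0[of "x - y"] S by (intro mult_mono) auto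
      then show ?thesis unfolding d_tilde_def weighted_gap_def real_sqrt_mult[symmetric]
        by (intro real_sqrt_le_mono) (simp add: mult_ac)
    qed
    show "weighted_gap V \<beta> x y \<le> sqrt B * d_tilde V \<epsilon> x y" for x y
    proof -
      have S: "0 \<le> V x + V y" using V0 by simp
      have "gap (norm (x - y)) * (1 + \<beta> * (V x + V y)) \<le> (B * d_eps \<epsilon> x y) * (1 + V x + V y)"
        using eq(2)[of x y] d0[of x y] g0[of "x - y"] S \<beta> B mult_left_le_one_le[of "V x + V y" \<beta>]
        by (intro mult_mono) auto
      then show ?thesis unfolding d_tilde_def weighted_gap_def real_sqrt_mult[symmetric]
        by (intro real_sqrt_le_mono) (simp add: mult_ac)
    qed
  qed
qed

end

section \<open>The tilted proposals\<close>

lemma linear_le_square: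
  fixes a v t :: real
  assumes "0 < v"
  shows "a * t \<le> a\<^sup>2 / (4 * v) + v * t\<^sup>2"
proof -
  define b where "b = a / (2 * v)"
  have a: "a = 2 * v * b" using assms by (simp add: b_def)
  have "0 \<le> v * (t - b)\<^sup>2" using assms by simp
  also have "\<dots> = v * b\<^sup>2 + v * t\<^sup>2 - a * t" by (simp add: a power2_eq_square algebra_simps)
  also have "v * b\<^sup>2 = a\<^sup>2 / (4 * v)" using assms by (simp add: a power2_eq_square)
  finally show ?thesis by simp
qed

locale tilted_proposal = \<gamma>: prob_space \<gamma> for \<gamma> :: "'a::{real_inner, polish_space} measure" +
  fixes \<tau> L \<rho>1 \<rho>2 :: real and \<Phi> :: "'a \<Rightarrow> real"
  assumes sets_\<gamma>[simp, measurable_cong]: "sets \<gamma> = sets borel"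
    and \<tau>: "0 < \<tau>" "(\<integral>\<^sup>+x. ennreal (exp (\<tau> * (norm x)\<^sup>2)) \<partial>\<gamma>) < \<infinity>"
    and lip: "L-lipschitz_on UNIV \<Phi>"
    and \<rho>1: "0 \<le> \<rho>1" "\<rho>1 < 1" and \<rho>2: "0 \<le> \<rho>2" "\<rho>2 < 1"
begin

definition propose :: "real \<Rightarrow> 'a \<Rightarrow> 'a \<Rightarrow> 'a" where
  "propose \<rho> x \<xi> = \<rho> *\<^sub>R x + sqrt (1 - \<rho>\<^sup>2) *\<^sub>R \<xi>"

definition normalization :: "'a \<Rightarrow> ennreal" where
  "normalization z = (\<integral>\<^sup>+\<xi>. ennreal (exp (- \<Phi> (propose \<rho>1 z \<xi>))) \<partial>\<gamma>)"

definition weight :: "'a \<Rightarrow> 'a \<Rightarrow> real" where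
  "weight z \<xi> = exp (- \<Phi> (propose \<rho>1 z \<xi>)) / enn2real (normalization z)"

lemma L_nonneg: "0 \<le> L"
  using lip by (rule lipschitz_on_nonneg)

lemma \<Phi>_measurable[measurable]: "\<Phi> \<in> borel_measurable borel"
  by (rule borel_measurable_continuous_onI[OF lipschitz_on_continuous_on[OF lip]])

lemma \<Phi>_diff: "\<Phi> x - \<Phi> y \<le> L * norm (x - y)"
  using lipschitz_onD[OF lip, of x y] by (simp add: dist_norm)

lemma propose_measurable[measurable (raw)]:
  assumes [measurable]: "f \<in> borel_measurable M" "g \<in> borel_measurable M"
  shows "(\<lambda>x. propose \<rho> (f x) (g x)) \<in> borel_measurable M"
  unfolding propose_def by measurable

lemma normalization_measurable[measurable]: "normalization \<in> borel_measurable borel"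
  unfolding normalization_def by (rule \<gamma>.borel_measurable_nn_integral) measurable

lemma weight_measurable[measurable (raw)]:
  assumes [measurable]: "f \<in> borel_measurable M" "g \<in> borel_measurable M"
  shows "(\<lambda>x. weight (f x) (g x)) \<in> borel_measurable M"
  unfolding weight_def by measurable

lemma exp_moment: "(\<integral>\<^sup>+\<xi>. ennreal (exp (a * norm \<xi>)) \<partial>\<gamma>) < \<infinity>"
proof -
  have "(\<integral>\<^sup>+\<xi>. ennreal (exp (a * norm \<xi>)) \<partial>\<gamma>) \<le> (\<integral>\<^sup>+\<xi>. ennreal (exp (a\<^sup>2 / (4 * \<tau>))) * ennreal (exp (\<tau> * (norm \<xi>)\<^sup>2)) \<partial>\<gamma>)"
  proof (intro nn_integral_mono)
    fix \<xi>
    have "a * norm \<xi> \<le> a\<^sup>2 / (4 * \<tau>) + \<tau> * (norm \<xi>)\<^sup>2"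
      by (rule linear_le_square[OF \<tau>(1)])
    then show "ennreal (exp (a * norm \<xi>)) \<le> ennreal (exp (a\<^sup>2 / (4 * \<tau>))) * ennreal (exp (\<tau> * (norm \<xi>)\<^sup>2))"
      by (simp add: ennreal_leI flip: ennreal_mult exp_add)
  qed
  also have "\<dots> = ennreal (exp (a\<^sup>2 / (4 * \<tau>))) * (\<integral>\<^sup>+\<xi>. ennreal (exp (\<tau> * (norm \<xi>)\<^sup>2)) \<partial>\<gamma>)"
    by (rule nn_integral_cmult) measurable
  also have "\<dots> < \<infinity>" using \<tau> by (simp add: ennreal_mult_less_top)
  finally show ?thesis .
qed

lemma noise_scale: "0 \<le> \<rho> \<Longrightarrow> \<rho> < 1 \<Longrightarrow> 0 \<le> sqrt (1 - \<rho>\<^sup>2) \<and> sqrt (1 - \<rho>\<^sup>2) \<le> 1"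
  by (simp add: power_le_one)

lemma \<Phi>_propose:
  "\<Phi> (\<rho>1 *\<^sub>R z) - L * norm \<xi> \<le> \<Phi> (propose \<rho>1 z \<xi>)" "\<Phi> (propose \<rho>1 z \<xi>) \<le> \<Phi> (\<rho>1 *\<^sub>R z) + L * norm \<xi>"
proof -
  have "norm (sqrt (1 - \<rho>1\<^sup>2) *\<^sub>R \<xi>) \<le> norm \<xi>"
    using noise_scale[OF \<rho>1] by (simp add: mult_left_le_one_le)
  then have "L * norm (sqrt (1 - \<rho>1\<^sup>2) *\<^sub>R \<xi>) \<le> L * norm \<xi>" by (rule mult_left_mono[OF _ L_nonneg])
  then show "\<Phi> (\<rho>1 *\<^sub>R z) - L * norm \<xi> \<le> \<Phi> (propose \<rho>1 z \<xi>)" "\<Phi> (propose \<rho>1 z \<xi>) \<le> \<Phi> (\<rho>1 *\<^sub>R z) + L * norm \<xi>"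
    using \<Phi>_diff[of "\<rho>1 *\<^sub>R z" "propose \<rho>1 z \<xi>"] \<Phi>_diff[of "propose \<rho>1 z \<xi>" "\<rho>1 *\<^sub>R z"]
    by (auto simp: propose_def)
qed

definition mass_floor :: real where
  "mass_floor = (LINT \<xi>|\<gamma>. exp (- L * norm \<xi>))"

lemma mass_floor: "0 < mass_floor" "(\<integral>\<^sup>+\<xi>. ennreal (exp (- L * norm \<xi>)) \<partial>\<gamma>) = ennreal mass_floor"
proof -
  have i: "integrable \<gamma> (\<lambda>\<xi>. exp (- L * norm \<xi>))"
    using L_nonneg by (intro \<gamma>.integrable_const_bound[where B=1]) auto
  then show "(\<integral>\<^sup>+\<xi>. ennreal (exp (- L * norm \<xi>)) \<partial>\<gamma>) = ennreal mass_floor"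
    unfolding mass_floor_def by (intro nn_integral_eq_integral) auto
  have "mass_floor \<noteq> 0"
    using integral_nonneg_eq_0_iff_AE[OF i] \<gamma>.prob_space by (auto simp: mass_floor_def)
  moreover have "0 \<le> mass_floor" unfolding mass_floor_def by simp
  ultimately show "0 < mass_floor" by simp
qed

lemma normalization_ge: "ennreal (exp (- \<Phi> (\<rho>1 *\<^sub>R z)) * mass_floor) \<le> normalization z"
proof -
  have "ennreal (exp (- \<Phi> (\<rho>1 *\<^sub>R z)) * mass_floor) = (\<integral>\<^sup>+\<xi>. ennreal (exp (- \<Phi> (\<rho>1 *\<^sub>R z))) * ennreal (exp (- L * norm \<xi>)) \<partial>\<gamma>)"
    using mass_floor by (subst nn_integral_cmult) (auto simp: ennreal_mult)
  also have "\<dots> \<le> normalization z"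
  proof -
    have "- \<Phi> (\<rho>1 *\<^sub>R z) - L * norm \<xi> \<le> - \<Phi> (propose \<rho>1 z \<xi>)" for \<xi>
      using \<Phi>_propose(2)[of z \<xi>] by linarith
    then show ?thesis unfolding normalization_def
      by (intro nn_integral_mono) (simp add: ennreal_leI flip: ennreal_mult exp_add)
  qed
  finally show ?thesis .
qed

lemma normalization_finite: "normalization z < \<infinity>"
proof -
  have "normalization z \<le> (\<integral>\<^sup>+\<xi>. ennreal (exp (- \<Phi> (\<rho>1 *\<^sub>R z))) * ennreal (exp (L * norm \<xi>)) \<partial>\<gamma>)"
    unfolding normalization_def using \<Phi>_propose[of z]
    by (intro nn_integral_mono) (simp add: ennreal_leI algebra_simps flip: ennreal_mult exp_add)
  also have "\<dots> = ennreal (exp (- \<Phi> (\<rho>1 *\<^sub>R z))) * (\<integral>\<^sup>+\<xi>. ennreal (exp (L * norm \<xi>)) \<partial>\<gamma>)"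
    by (rule nn_integral_cmult) measurable
  also have "\<dots> < \<infinity>" using exp_moment by (simp add: ennreal_mult_less_top)
  finally show ?thesis .
qed

lemma normalization_real:
  "normalization z = ennreal (enn2real (normalization z))" "exp (- \<Phi> (\<rho>1 *\<^sub>R z)) * mass_floor \<le> enn2real (normalization z)"
  "0 < enn2real (normalization z)"
proof -
  show e: "normalization z = ennreal (enn2real (normalization z))"
    using normalization_finite[of z] by simp
  show le: "exp (- \<Phi> (\<rho>1 *\<^sub>R z)) * mass_floor \<le> enn2real (normalization z)"
    using normalization_ge[of z] by (subst (asm) e) (simp add: ennreal_le_iff)
  show "0 < enn2real (normalization z)" by (rule less_le_trans[OF _ le]) (simp add: mass_floor)
qed

lemma weight_nonneg: "0 \<le> weight z \<xi>"
  by (simp add: weight_def)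

lemma weight_ennreal: "ennreal (weight z \<xi>) = ennreal (exp (- \<Phi> (propose \<rho>1 z \<xi>))) / normalization z"
  unfolding weight_def using normalization_real[of z] by (metis divide_ennreal exp_ge_zero)

lemma weight_mass: "(\<integral>\<^sup>+\<xi>. ennreal (weight z \<xi>) \<partial>\<gamma>) = 1"
proof -
  have "(\<integral>\<^sup>+\<xi>. ennreal (weight z \<xi>) \<partial>\<gamma>) = normalization z / normalization z"
    unfolding weight_ennreal by (subst nn_integral_divide) (auto simp: normalization_def)
  also have "\<dots> = 1"
    using normalization_real[of z] by (metis divide_ennreal divide_self_if ennreal_1 less_irrefl less_imp_le)
  finally show ?thesis .
qed

text \<open>
  Moving \<open>z\<close> to \<open>z'\<close> changes \<open>\<Phi>\<close> at the proposed point by at most \<open>L * \<rho>1 * norm (z - z')\<close>. This affects the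
  density once directly and once through its normalization, whence the factor \<open>2\<close>.
\<close>

lemma weight_comparable: "exp (- 2 * L * \<rho>1 * norm (z - z')) * weight z \<xi> \<le> weight z' \<xi>"
proof -
  let ?d = "L * \<rho>1 * norm (z - z')"
  let ?N = "\<lambda>z. enn2real (normalization z)"
  have *: "exp (- \<Phi> (propose \<rho>1 a \<xi>)) \<le> exp (L * \<rho>1 * norm (a - b)) * exp (- \<Phi> (propose \<rho>1 b \<xi>))" for a b \<xi>
  proof -
    have "propose \<rho>1 b \<xi> - propose \<rho>1 a \<xi> = \<rho>1 *\<^sub>R (b - a)" by (simp add: propose_def scaleR_diff_right)
    then show ?thesis using \<Phi>_diff[of "propose \<rho>1 b \<xi>" "propose \<rho>1 a \<xi>"] \<rho>1
      by (simp add: norm_minus_commute mult.assoc flip: exp_add)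
  qed
  have "normalization z' \<le> (\<integral>\<^sup>+\<xi>. ennreal (exp ?d) * ennreal (exp (- \<Phi> (propose \<rho>1 z \<xi>))) \<partial>\<gamma>)"
    unfolding normalization_def using *[of z' _ z]
    by (intro nn_integral_mono) (simp add: ennreal_leI norm_minus_commute flip: ennreal_mult)
  also have "\<dots> = ennreal (exp ?d) * normalization z"
    unfolding normalization_def by (rule nn_integral_cmult) measurable
  also have "\<dots> = ennreal (exp ?d * ?N z)"
    using normalization_real[of z] by (simp add: ennreal_mult)
  finally have N: "?N z' \<le> exp ?d * ?N z"
    by (subst (asm) normalization_real(1)[of z']) (simp add: ennreal_le_iff)
  have "exp (- 2 * L * \<rho>1 * norm (z - z')) * weight z \<xi> = exp (- ?d) * exp (- \<Phi> (propose \<rho>1 z \<xi>)) / (exp ?d * ?N z)"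
    by (simp add: weight_def exp_minus field_simps flip: exp_add)
  also have "\<dots> \<le> exp (- \<Phi> (propose \<rho>1 z' \<xi>)) / ?N z'"
  proof (intro frac_le N)
    show "exp (- ?d) * exp (- \<Phi> (propose \<rho>1 z \<xi>)) \<le> exp (- \<Phi> (propose \<rho>1 z' \<xi>))"
      using *[of z \<xi> z'] by (simp add: exp_minus field_simps)
  qed (use normalization_real in auto)
  finally show ?thesis by (simp add: weight_def)
qed

text \<open>
  Numerator and normalization are both compared with \<open>exp (- \<Phi> (\<rho>1 *\<^sub>R z))\<close>, which cancels; the bound does not
  depend on \<open>z\<close>.
\<close>

lemma weight_bound: "weight z \<xi> \<le> 1 / mass_floor * exp (L * norm \<xi>)"
proof -
  have "weight z \<xi> \<le> exp (- \<Phi> (\<rho>1 *\<^sub>R z) + L * norm \<xi>) / (exp (- \<Phi> (\<rho>1 *\<^sub>R z)) * mass_floor)"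
    unfolding weight_def using \<Phi>_propose[of z \<xi>] mass_floor normalization_real[of z]
    by (intro frac_le) auto
  also have "\<dots> = 1 / mass_floor * exp (L * norm \<xi>)" by (subst exp_add) simp
  finally show ?thesis .
qed

lemma tilted_propose:
  "tilted \<Phi> (distr \<gamma> borel (propose \<rho>1 z)) = distr (density \<gamma> (\<lambda>\<xi>. ennreal (weight z \<xi>))) borel (propose \<rho>1 z)"
proof -
  have "(\<integral>\<^sup>+u. ennreal (exp (- \<Phi> u)) \<partial>distr \<gamma> borel (propose \<rho>1 z)) = normalization z"
    unfolding normalization_def by (subst nn_integral_distr) auto
  then show ?thesis unfolding tilted_def
    by (subst density_distr) (auto simp: weight_ennreal)
qed

abbreviation innovation :: "('a \<times> 'a) measure" where "innovation \<equiv> \<gamma> \<Otimes>\<^sub>M \<gamma>"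

definition shift :: "'a \<times> 'a \<Rightarrow> 'a" where
  "shift w = (\<rho>1 * sqrt (1 - \<rho>2\<^sup>2)) *\<^sub>R fst w + sqrt (1 - \<rho>1\<^sup>2) *\<^sub>R snd w"

definition pair_weight :: "'a \<Rightarrow> 'a \<times> 'a \<Rightarrow> real" where
  "pair_weight x w = weight (propose \<rho>2 x (fst w)) (snd w)"

lemma product_lt_1: "\<rho>1 * \<rho>2 < 1"
  using mult_left_le_one_le[of \<rho>2 \<rho>1] \<rho>1 \<rho>2 by simp

text \<open>
  The summand \<open>1\<close> in the exponent only keeps it positive when \<open>L\<close>, \<open>\<rho>1\<close> or \<open>\<rho>2\<close> is \<open>0\<close>.
\<close>

sublocale comparable_shift_kernel innovation shift pair_weight "\<rho>1 * \<rho>2" "2 * L * \<rho>1 * \<rho>2 + 1"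
proof (intro comparable_shift_kernel.intro comparable_shift_kernel_axioms.intro)
  interpret pair_prob_space \<gamma> \<gamma> ..
  show "prob_space innovation" by (rule prob_space_axioms)
  show "shift \<in> borel_measurable innovation" unfolding shift_def by measurable
  show "(\<lambda>(x, w). pair_weight x w) \<in> borel_measurable (borel \<Otimes>\<^sub>M innovation)"
    unfolding pair_weight_def by measurable
  show "0 \<le> pair_weight x w" for x w by (simp add: pair_weight_def weight_nonneg)
  show "(\<integral>\<^sup>+w. ennreal (pair_weight x w) \<partial>innovation) = 1" for x
    unfolding pair_weight_def
    by (subst \<gamma>.nn_integral_fst[symmetric]) (auto simp: weight_mass \<gamma>.emeasure_space_1)
  show "exp (- (2 * L * \<rho>1 * \<rho>2 + 1) * norm (x - y)) * pair_weight x w \<le> pair_weight y w" for x y w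
  proof -
    let ?z = "propose \<rho>2 x (fst w)" and ?z' = "propose \<rho>2 y (fst w)"
    have "norm (?z - ?z') = \<rho>2 * norm (x - y)"
      using \<rho>2 by (simp add: propose_def flip: scaleR_diff_right)
    then have "exp (- (2 * L * \<rho>1 * \<rho>2 + 1) * norm (x - y)) \<le> exp (- 2 * L * \<rho>1 * norm (?z - ?z'))"
      by (simp add: algebra_simps)
    then have "exp (- (2 * L * \<rho>1 * \<rho>2 + 1) * norm (x - y)) * pair_weight x w \<le> exp (- 2 * L * \<rho>1 * norm (?z - ?z')) * pair_weight x w"
      by (rule mult_right_mono) (simp add: pair_weight_def weight_nonneg)
    also have "\<dots> \<le> pair_weight y w" unfolding pair_weight_def by (rule weight_comparable)
    finally show ?thesis .
  qed
qed (use \<rho>1 \<rho>2 L_nonneg product_lt_1 in \<open>auto intro!: add_nonneg_pos mult_nonneg_nonneg\<close>)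

lemma shift_propose: "propose \<rho>1 (propose \<rho>2 x \<eta>) \<xi> = (\<rho>1 * \<rho>2) *\<^sub>R x + shift (\<eta>, \<xi>)"
  by (simp add: propose_def shift_def scaleR_add_right)

text \<open>
  The intermediate state \<open>z\<close> is a function of \<open>x\<close> and the first innovation, so by Fubini its integration can be
  replaced by drawing both innovations at once, with the density of the second one depending on the first.
\<close>

lemma pcn_infinity_shift_kernel:
  assumes pcn: "\<And>\<rho> x. 0 \<le> \<rho> \<Longrightarrow> \<rho> < 1 \<Longrightarrow> pcn_proposal C \<rho> x = distr \<gamma> borel (\<lambda>\<xi>. \<rho> *\<^sub>R x + sqrt (1 - \<rho>\<^sup>2) *\<^sub>R \<xi>)"
  shows "pcn_infinity C \<Phi> \<rho>1 \<rho>2 = shift_kernel"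
proof
  fix x
  let ?k = "\<lambda>z. distr (density \<gamma> (\<lambda>\<xi>. ennreal (weight z \<xi>))) borel (propose \<rho>1 z)"
  have "?k \<in> borel \<rightarrow>\<^sub>M prob_algebra borel"
    by (rule density_distr_kernel_measurable) (auto simp: weight_mass \<gamma>.sigma_finite_measure_axioms)
  then have k[measurable]: "?k \<in> borel \<rightarrow>\<^sub>M subprob_algebra borel" by (rule measurable_prob_algebraD)
  have e: "pcn_infinity C \<Phi> \<rho>1 \<rho>2 x = distr \<gamma> borel (propose \<rho>2 x) \<bind> ?k"
    unfolding pcn_infinity_def tilted_propose[symmetric]
    by (simp add: pcn[OF \<rho>1] pcn[OF \<rho>2] propose_def[abs_def])
  show "pcn_infinity C \<Phi> \<rho>1 \<rho>2 x = shift_kernel x"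
    unfolding e
  proof (rule measure_eqI)
    show "sets (distr \<gamma> borel (propose \<rho>2 x) \<bind> ?k) = sets (shift_kernel x)"
      by (subst sets_bind) (auto simp: shift_kernel_def)
    fix A assume "A \<in> sets (distr \<gamma> borel (propose \<rho>2 x) \<bind> ?k)"
    then have [measurable]: "A \<in> sets borel" by (subst (asm) sets_bind) auto
    have "emeasure (distr \<gamma> borel (propose \<rho>2 x) \<bind> ?k) A = (\<integral>\<^sup>+z. emeasure (?k z) A \<partial>distr \<gamma> borel (propose \<rho>2 x))"
      by (subst emeasure_bind[where N=borel]) (use k in auto)
    also have "\<dots> = (\<integral>\<^sup>+\<eta>. emeasure (?k (propose \<rho>2 x \<eta>)) A \<partial>\<gamma>)"
      by (subst nn_integral_distr) auto
    also have "\<dots> = (\<integral>\<^sup>+\<eta>. \<integral>\<^sup>+\<xi>. ennreal (weight (propose \<rho>2 x \<eta>) \<xi>) * indicator A (propose \<rho>1 (propose \<rho>2 x \<eta>) \<xi>) \<partial>\<gamma> \<partial>\<gamma>)"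
    proof (intro nn_integral_cong)
      fix \<eta>
      let ?z = "propose \<rho>2 x \<eta>"
      have "emeasure (?k ?z) A = (\<integral>\<^sup>+y. indicator A y \<partial>?k ?z)" by (subst nn_integral_indicator) auto
      also have "\<dots> = (\<integral>\<^sup>+\<xi>. ennreal (weight ?z \<xi>) * indicator A (propose \<rho>1 ?z \<xi>) \<partial>\<gamma>)"
        by (subst nn_integral_distr, measurable, subst nn_integral_density) auto
      finally show "emeasure (?k ?z) A = \<dots>" .
    qed
    also have "\<dots> = (\<integral>\<^sup>+w. ennreal (pair_weight x w) * indicator A ((\<rho>1 * \<rho>2) *\<^sub>R x + shift w) \<partial>innovation)"
      by (subst \<gamma>.nn_integral_fst[symmetric]) (auto simp: pair_weight_def shift_propose shift_def)
    also have "\<dots> = (\<integral>\<^sup>+y. indicator A y \<partial>shift_kernel x)"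
      by (rule nn_integral_shift_kernel[symmetric]) auto
    also have "\<dots> = emeasure (shift_kernel x) A"
      by (subst nn_integral_indicator) (auto simp: shift_kernel_def)
    finally show "emeasure (distr \<gamma> borel (propose \<rho>2 x) \<bind> ?k) A = emeasure (shift_kernel x) A" .
  qed
qed

text \<open>
  The constant \<open>v\<close> is tuned so that the quadratic term takes half of the available exponential moment of
  each innovation; the other half absorbs the factor \<open>exp (L * norm (snd w))\<close> from the bound on the weight.
\<close>

lemma shift_exp_square:
  fixes v :: real
  defines "v \<equiv> \<tau> * (1 - \<rho>1 * \<rho>2)\<^sup>2 / 4"
  shows "exp (L * norm (snd w)) * exp (v * (norm (shift w) / (1 - \<rho>1 * \<rho>2))\<^sup>2)
    \<le> exp (L\<^sup>2 / (2 * \<tau>)) * (exp (\<tau> * (norm (fst w))\<^sup>2) * exp (\<tau> * (norm (snd w))\<^sup>2))"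
proof -
  let ?a = "norm (fst w)" and ?b = "norm (snd w)"
  have "norm (shift w) \<le> (\<rho>1 * sqrt (1 - \<rho>2\<^sup>2)) * ?a + sqrt (1 - \<rho>1\<^sup>2) * ?b"
    unfolding shift_def using noise_scale[OF \<rho>1] noise_scale[OF \<rho>2] \<rho>1
    by (intro norm_triangle_le) (simp add: abs_mult)
  also have "\<dots> \<le> 1 * ?a + 1 * ?b"
    using noise_scale[OF \<rho>1] noise_scale[OF \<rho>2] \<rho>1
    by (intro add_mono mult_right_mono mult_le_one) auto
  finally have "(norm (shift w))\<^sup>2 \<le> (?a + ?b)\<^sup>2" by (intro power_mono) auto
  also have "\<dots> \<le> 2 * (?a\<^sup>2 + ?b\<^sup>2)"
    using sum_squares_bound[of ?a ?b] by (simp add: power2_sum)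
  finally have s: "(norm (shift w))\<^sup>2 \<le> 2 * (?a\<^sup>2 + ?b\<^sup>2)" .
  have "v * (norm (shift w) / (1 - \<rho>1 * \<rho>2))\<^sup>2 = \<tau> / 4 * (norm (shift w))\<^sup>2"
    using product_lt_1 by (simp add: v_def power_divide)
  also have "\<dots> \<le> \<tau> / 4 * (2 * (?a\<^sup>2 + ?b\<^sup>2))" using s \<tau> by (intro mult_left_mono) auto
  finally have 1: "v * (norm (shift w) / (1 - \<rho>1 * \<rho>2))\<^sup>2 \<le> \<tau> / 2 * ?a\<^sup>2 + \<tau> / 2 * ?b\<^sup>2"
    by (simp add: algebra_simps)
  have 2: "L * ?b \<le> L\<^sup>2 / (2 * \<tau>) + \<tau> / 2 * ?b\<^sup>2"
    using linear_le_square[of "\<tau> / 2" L ?b] \<tau> by simp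
  have 3: "0 \<le> \<tau> / 2 * ?a\<^sup>2" using \<tau> by simp
  show ?thesis using 1 2 3 unfolding exp_add[symmetric] by simp
qed

text \<open>
  Convexity of \<open>f\<close> splits \<open>\<rho> \<parallel>x\<parallel> + \<parallel>T w\<parallel>\<close>, with \<open>\<rho> = \<rho>1 * \<rho>2\<close>, as the convex combination of \<open>\<parallel>x\<parallel>\<close> and
  \<open>\<parallel>T w\<parallel> / (1 - \<rho>)\<close>; the drift rate is therefore \<open>\<rho>\<close> itself, for each \<open>f\<close>.
\<close>

lemma radial_drift:
  fixes f :: "real \<Rightarrow> real" and A v :: real
  defines "v \<equiv> \<tau> * (1 - \<rho>1 * \<rho>2)\<^sup>2 / 4"
  assumes [measurable]: "f \<in> borel_measurable borel" and f0: "\<And>t. 0 \<le> t \<Longrightarrow> 0 \<le> f t"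
    and mono: "\<And>s t. 0 \<le> s \<Longrightarrow> s \<le> t \<Longrightarrow> f s \<le> f t"
    and conv: "\<And>q s t. 0 \<le> q \<Longrightarrow> q \<le> 1 \<Longrightarrow> 0 \<le> s \<Longrightarrow> 0 \<le> t \<Longrightarrow> f (q * s + (1 - q) * t) \<le> q * f s + (1 - q) * f t"
    and growth: "\<And>t. 0 \<le> t \<Longrightarrow> f t \<le> A * exp (v * t\<^sup>2)" and A: "0 \<le> A"
  shows "\<exists>K\<ge>0. \<forall>x. (\<integral>\<^sup>+y. ennreal (f (norm y)) \<partial>shift_kernel x) \<le> ennreal (\<rho>1 * \<rho>2 * f (norm x) + K)"
proof -
  let ?q = "\<rho>1 * \<rho>2"
  let ?E = "\<integral>\<^sup>+x. ennreal (exp (\<tau> * (norm x)\<^sup>2)) \<partial>\<gamma>"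
  let ?B = "A / mass_floor * exp (L\<^sup>2 / (2 * \<tau>))"
  have q: "0 \<le> ?q" "?q < 1" using \<rho>1 \<rho>2 product_lt_1 by auto
  have B: "0 \<le> ?B" using A mass_floor by (simp add: less_imp_le)
  define K where "K = enn2real (ennreal ?B * (?E * ?E))"
  have K: "ennreal K = ennreal ?B * (?E * ?E)"
    unfolding K_def using \<tau> by (subst ennreal_enn2real) (auto simp: ennreal_mult_less_top)
  have T[measurable]: "shift \<in> borel_measurable innovation" by (rule T)
  have noise: "(\<integral>\<^sup>+w. ennreal (pair_weight x w) * ennreal (f (norm (shift w) / (1 - ?q))) \<partial>innovation) \<le> ennreal K" for x
  proof -
    have "(\<integral>\<^sup>+w. ennreal (pair_weight x w) * ennreal (f (norm (shift w) / (1 - ?q))) \<partial>innovation)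
      \<le> (\<integral>\<^sup>+w. ennreal ?B * (ennreal (exp (\<tau> * (norm (fst w))\<^sup>2)) * ennreal (exp (\<tau> * (norm (snd w))\<^sup>2))) \<partial>innovation)"
    proof (intro nn_integral_mono)
      fix w
      let ?t = "norm (shift w) / (1 - ?q)"
      have t: "0 \<le> ?t" using q by simp
      have "pair_weight x w * f ?t \<le> (1 / mass_floor * exp (L * norm (snd w))) * (A * exp (v * ?t\<^sup>2))"
        unfolding pair_weight_def using weight_bound growth[OF t] f0[OF t] weight_nonneg mass_floor
        by (intro mult_mono) (auto simp: less_imp_le)
      also have "\<dots> = A / mass_floor * (exp (L * norm (snd w)) * exp (v * ?t\<^sup>2))" by simp
      also have "\<dots> \<le> A / mass_floor * (exp (L\<^sup>2 / (2 * \<tau>)) * (exp (\<tau> * (norm (fst w))\<^sup>2) * exp (\<tau> * (norm (snd w))\<^sup>2)))"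
        unfolding v_def using A mass_floor by (intro mult_left_mono shift_exp_square) (auto simp: less_imp_le)
      finally have "pair_weight x w * f ?t \<le> ?B * (exp (\<tau> * (norm (fst w))\<^sup>2) * exp (\<tau> * (norm (snd w))\<^sup>2))"
        by (simp only: mult.assoc)
      then have "ennreal (pair_weight x w * f ?t) \<le> ennreal (?B * (exp (\<tau> * (norm (fst w))\<^sup>2) * exp (\<tau> * (norm (snd w))\<^sup>2)))"
        by (rule ennreal_leI)
      then show "ennreal (pair_weight x w) * ennreal (f ?t) \<le> ennreal ?B * (ennreal (exp (\<tau> * (norm (fst w))\<^sup>2)) * ennreal (exp (\<tau> * (norm (snd w))\<^sup>2)))"
        using B by (simp only: ennreal_mult[OF B] ennreal_mult[OF p_nonneg f0[OF t]] ennreal_mult exp_ge_zero mult_nonneg_nonneg)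
    qed
    also have "\<dots> = ennreal ?B * (\<integral>\<^sup>+\<eta>. \<integral>\<^sup>+\<xi>. ennreal (exp (\<tau> * (norm \<eta>)\<^sup>2)) * ennreal (exp (\<tau> * (norm \<xi>)\<^sup>2)) \<partial>\<gamma> \<partial>\<gamma>)"
      by (subst nn_integral_cmult, measurable, subst \<gamma>.nn_integral_fst[symmetric]) auto
    also have "\<dots> = ennreal K"
      unfolding K by (simp add: nn_integral_cmult nn_integral_multc)
    finally show ?thesis .
  qed
  show ?thesis
  proof (intro exI[of _ K] conjI allI)
    show "0 \<le> K" by (simp add: K_def)
    fix x
    have pwm[measurable]: "pair_weight x \<in> borel_measurable innovation" unfolding pair_weight_def by measurable
    have fx: "0 \<le> f (norm x)" by (rule f0) simp
    have "(\<integral>\<^sup>+y. ennreal (f (norm y)) \<partial>shift_kernel x) = (\<integral>\<^sup>+w. ennreal (pair_weight x w) * ennreal (f (norm (?q *\<^sub>R x + shift w))) \<partial>innovation)"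
      by (rule nn_integral_shift_kernel) measurable
    also have "\<dots> \<le> (\<integral>\<^sup>+w. ennreal (pair_weight x w) * ennreal (?q * f (norm x)) + ennreal (pair_weight x w) * ennreal (f (norm (shift w) / (1 - ?q))) \<partial>innovation)"
    proof (intro nn_integral_mono)
      fix w
      let ?t = "norm (shift w) / (1 - ?q)"
      have t: "0 \<le> ?t" using q by simp
      have "norm (?q *\<^sub>R x + shift w) \<le> ?q * norm x + (1 - ?q) * ?t"
        using norm_triangle_ineq[of "?q *\<^sub>R x" "shift w"] q \<rho>1 \<rho>2 by (simp add: abs_mult)
      then have "f (norm (?q *\<^sub>R x + shift w)) \<le> f (?q * norm x + (1 - ?q) * ?t)" by (rule mono[rotated]) simp
      also have "\<dots> \<le> ?q * f (norm x) + (1 - ?q) * f ?t" using q t by (intro conv) auto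
      also have "\<dots> \<le> ?q * f (norm x) + f ?t" using q f0[OF t] by (simp add: mult_left_le_one_le)
      finally have "ennreal (f (norm (?q *\<^sub>R x + shift w))) \<le> ennreal (?q * f (norm x)) + ennreal (f ?t)"
        using q fx f0[OF t] by (simp add: ennreal_leI flip: ennreal_plus)
      then have "ennreal (pair_weight x w) * ennreal (f (norm (?q *\<^sub>R x + shift w))) \<le> ennreal (pair_weight x w) * (ennreal (?q * f (norm x)) + ennreal (f ?t))"
        by (rule mult_left_mono) simp
      then show "ennreal (pair_weight x w) * ennreal (f (norm (?q *\<^sub>R x + shift w))) \<le> ennreal (pair_weight x w) * ennreal (?q * f (norm x)) + ennreal (pair_weight x w) * ennreal (f ?t)"
        by (simp only: distrib_left)
    qed
    also have "\<dots> = ennreal (?q * f (norm x)) + (\<integral>\<^sup>+w. ennreal (pair_weight x w) * ennreal (f (norm (shift w) / (1 - ?q))) \<partial>innovation)"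
      by (subst nn_integral_add) (auto simp: p_int_mult)
    also have "\<dots> \<le> ennreal (?q * f (norm x)) + ennreal K" by (intro add_left_mono noise)
    also have "\<dots> = ennreal (?q * f (norm x) + K)"
      using \<rho>1 \<rho>2 fx by (intro ennreal_plus[symmetric] mult_nonneg_nonneg) (auto simp: K_def)
    finally show "(\<integral>\<^sup>+y. ennreal (f (norm y)) \<partial>shift_kernel x) \<le> ennreal (?q * f (norm x) + K)" .
  qed
qed

theorem radial_wasserstein_decay:
  fixes f :: "real \<Rightarrow> real"
  assumes f: "f \<in> borel_measurable borel" "\<And>t. 0 \<le> t \<Longrightarrow> 0 \<le> f t"
    "\<And>s t. 0 \<le> s \<Longrightarrow> s \<le> t \<Longrightarrow> f s \<le> f t"
    "\<And>q s t. 0 \<le> q \<Longrightarrow> q \<le> 1 \<Longrightarrow> 0 \<le> s \<Longrightarrow> 0 \<le> t \<Longrightarrow> f (q * s + (1 - q) * t) \<le> q * f s + (1 - q) * f t"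
    "\<And>t. 0 \<le> t \<Longrightarrow> f t \<le> A * exp (\<tau> * (1 - \<rho>1 * \<rho>2)\<^sup>2 / 4 * t\<^sup>2)" "0 \<le> A"
    and sublevel: "\<And>M. \<exists>R. \<forall>t\<ge>0. f t \<le> M \<longrightarrow> t \<le> R" and \<epsilon>: "0 < \<epsilon>"
  shows "\<exists>l n1. 0 < l \<and> l < 1 \<and> (\<forall>\<nu>1 \<nu>2. sets \<nu>1 = sets borel \<and> sets \<nu>2 = sets borel \<longrightarrow>
    (\<forall>n\<ge>n1. wasserstein (d_tilde (\<lambda>x. f (norm x)) \<epsilon>) (\<nu>1 \<bind> kernel_power shift_kernel n) (\<nu>2 \<bind> kernel_power shift_kernel n)
      \<le> ennreal (l ^ n) * wasserstein (d_tilde (\<lambda>x. f (norm x)) \<epsilon>) \<nu>1 \<nu>2))"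
proof -
  note [measurable] = f(1)
  obtain K where K: "0 \<le> K" and drift: "\<And>x. (\<integral>\<^sup>+y. ennreal (f (norm y)) \<partial>shift_kernel x) \<le> ennreal (\<rho>1 * \<rho>2 * f (norm x) + K)"
    using radial_drift[OF f] by blast
  have "\<exists>R. \<forall>x::'a. f (norm x) \<le> M \<longrightarrow> norm x \<le> R" for M
    using sublevel[of M] by (metis norm_ge_zero)
  from wasserstein_decay[of "\<lambda>x. f (norm x)", OF _ _ drift \<rho> K this \<epsilon>] f(2) show ?thesis by simp
qed

end

section \<open>Geometric decay for the admissible weights\<close>

lemma exp_convex_compose:
  fixes g :: "real \<Rightarrow> real"
  assumes "0 \<le> q" "q \<le> 1" "g (q * s + (1 - q) * t) \<le> q * g s + (1 - q) * g t"
  shows "exp (g (q * s + (1 - q) * t)) \<le> q * exp (g s) + (1 - q) * exp (g t)"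
proof -
  have "exp (g (q * s + (1 - q) * t)) \<le> exp ((1 - (1 - q)) *\<^sub>R g s + (1 - q) *\<^sub>R g t)" using assms by simp
  also have "\<dots> \<le> (1 - (1 - q)) * exp (g s) + (1 - q) * exp (g t)"
    using assms by (intro convex_onD[OF exp_convex]) auto
  finally show ?thesis by simp
qed

text \<open>
  By induction: the defect in the step is \<open>q (1 - q) (s - t) (s\<^sup>k - t\<^sup>k)\<close>, which is nonnegative.
\<close>

lemma power_convex_nonneg:
  fixes s t :: real
  assumes "0 \<le> q" "q \<le> 1" "0 \<le> s" "0 \<le> t"
  shows "(q * s + (1 - q) * t) ^ k \<le> q * s ^ k + (1 - q) * t ^ k"
proof (induction k)
  case (Suc k)
  have c: "0 \<le> (s - t) * (s ^ k - t ^ k)"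
    using assms power_mono[of s t k] power_mono[of t s k]
    by (cases "s \<le> t") (auto intro: mult_nonneg_nonneg mult_nonpos_nonpos)
  have "(q * s + (1 - q) * t) ^ Suc k \<le> (q * s + (1 - q) * t) * (q * s ^ k + (1 - q) * t ^ k)"
    using assms Suc by (simp add: mult_left_mono)
  also have "\<dots> = q * s ^ Suc k + (1 - q) * t ^ Suc k - q * (1 - q) * ((s - t) * (s ^ k - t ^ k))"
    by (simp add: algebra_simps)
  also have "\<dots> \<le> q * s ^ Suc k + (1 - q) * t ^ Suc k"
    using c assms by simp
  finally show ?case .
qed simp

theorem theorem3p2:
  fixes C :: "'a::{real_inner, polish_space} \<Rightarrow> 'a"
    and \<Phi> :: "'a \<Rightarrow> real"
    and L\<Phi> \<rho>1 \<rho>2 :: real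
  assumes "symmetric_operator C"
    and "strictly_positive_operator C"
    and "positive_trace_class C"
    and "0 \<le> \<rho>1" "\<rho>1 < 1"
    and "0 \<le> \<rho>2" "\<rho>2 < 1"
    and "L\<Phi>-lipschitz_on UNIV \<Phi>"
  shows "\<exists>v0>0. \<forall>V :: 'a \<Rightarrow> real.
    (\<exists>k::nat. 1 \<le> k \<and> V = (\<lambda>x. norm x ^ k)) \<or>
    (\<exists>v>0. V = (\<lambda>x. exp (v * norm x))) \<or>
    (\<exists>v. 0 < v \<and> v \<le> v0 \<and> V = (\<lambda>x. exp (v * (norm x)\<^sup>2))) \<longrightarrow>
    (\<exists>\<epsilon>star. 0 < \<epsilon>star \<and> \<epsilon>star < 1 \<and>
      (\<forall>\<epsilon>. 0 < \<epsilon> \<and> \<epsilon> < \<epsilon>star \<longrightarrow>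
        (\<exists>l n1. 0 < l \<and> l < 1 \<and>
          (\<forall>\<nu>1 \<nu>2. prob_space \<nu>1 \<and> sets \<nu>1 = sets borel \<and>
                    prob_space \<nu>2 \<and> sets \<nu>2 = sets borel \<longrightarrow>
            (\<forall>n\<ge>n1.
              wasserstein (d_tilde V \<epsilon>)
                (\<nu>1 \<bind> kernel_power (pcn_infinity C \<Phi> \<rho>1 \<rho>2) n)
                (\<nu>2 \<bind> kernel_power (pcn_infinity C \<Phi> \<rho>1 \<rho>2) n)
              \<le> ennreal (l ^ n) * wasserstein (d_tilde V \<epsilon>) \<nu>1 \<nu>2)))))"
proof -
  obtain \<gamma> :: "'a measure" and \<tau> where \<gamma>: "prob_space \<gamma>" "sets \<gamma> = sets borel" "0 < \<tau>"
      "(\<integral>\<^sup>+x. ennreal (exp (\<tau> * (norm x)\<^sup>2)) \<partial>\<gamma>) < \<infinity>"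
    and pcn: "\<And>\<rho> x. 0 \<le> \<rho> \<Longrightarrow> \<rho> < 1 \<Longrightarrow> pcn_proposal C \<rho> x = distr \<gamma> borel (\<lambda>\<xi>. \<rho> *\<^sub>R x + sqrt (1 - \<rho>\<^sup>2) *\<^sub>R \<xi>)"
    using reference_gaussian_exists[OF assms(1-3)] by blast
  interpret tilted_proposal \<gamma> \<tau> L\<Phi> \<rho>1 \<rho>2 \<Phi>
    by (intro tilted_proposal.intro tilted_proposal_axioms.intro \<gamma> assms)
  define v0 where "v0 = \<tau> * (1 - \<rho>1 * \<rho>2)\<^sup>2 / 4"
  have v0: "0 < v0" using \<gamma>(3) product_lt_1 by (simp add: v0_def)
  have kernel: "pcn_infinity C \<Phi> \<rho>1 \<rho>2 = shift_kernel"
    by (rule pcn_infinity_shift_kernel) (rule pcn)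
  note decay = radial_wasserstein_decay[folded v0_def kernel]
  have main: "\<exists>l n1. 0 < l \<and> l < 1 \<and>
          (\<forall>\<nu>1 \<nu>2. sets \<nu>1 = sets borel \<and> sets \<nu>2 = sets borel \<longrightarrow>
            (\<forall>n\<ge>n1.
              wasserstein (d_tilde V \<epsilon>)
                (\<nu>1 \<bind> kernel_power (pcn_infinity C \<Phi> \<rho>1 \<rho>2) n)
                (\<nu>2 \<bind> kernel_power (pcn_infinity C \<Phi> \<rho>1 \<rho>2) n)
              \<le> ennreal (l ^ n) * wasserstein (d_tilde V \<epsilon>) \<nu>1 \<nu>2))"
    if V: "(\<exists>k::nat. 1 \<le> k \<and> V = (\<lambda>x. norm x ^ k)) \<or>
    (\<exists>v>0. V = (\<lambda>x. exp (v * norm x))) \<or>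
    (\<exists>v. 0 < v \<and> v \<le> v0 \<and> V = (\<lambda>x. exp (v * (norm x)\<^sup>2)))" and \<epsilon>: "0 < \<epsilon>" for V :: "'a \<Rightarrow> real" and \<epsilon>
    using V
  proof (elim disjE exE conjE)
    fix k :: nat assume k: "1 \<le> k" and V: "V = (\<lambda>x. norm x ^ k)"
    show ?thesis unfolding V
    proof (rule decay[of "\<lambda>t. t ^ k" "exp ((real k)\<^sup>2 / (4 * v0))", OF _ _ _ _ _ _ _ \<epsilon>])
      show "t ^ k \<le> exp ((real k)\<^sup>2 / (4 * v0)) * exp (v0 * t\<^sup>2)" if t: "0 \<le> t" for t
      proof -
        have "t ^ k \<le> exp t ^ k" using t exp_ge_add_one_self[of t] by (intro power_mono) linarith+
        also have "\<dots> = exp (k * t)" by (simp add: exp_of_nat_mult)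
        also have "\<dots> \<le> exp ((real k)\<^sup>2 / (4 * v0) + v0 * t\<^sup>2)" using linear_le_square[OF v0] by simp
        finally show ?thesis by (simp add: exp_add)
      qed
      show "\<exists>R. \<forall>t\<ge>0. t ^ k \<le> M \<longrightarrow> t \<le> R" for M :: real
      proof (intro exI allI impI)
        fix t :: real assume t: "0 \<le> t" "t ^ k \<le> M"
        show "t \<le> max 1 M"
        proof (cases "t \<le> 1")
          case False
          then have "t ^ 1 \<le> t ^ k" using k by (intro power_increasing) auto
          then show ?thesis using t by simp
        qed auto
      qed
    qed (auto intro: power_mono power_convex_nonneg)
  next
    fix v :: real assume v: "0 < v" and V: "V = (\<lambda>x. exp (v * norm x))"
    show ?thesis unfolding V
    proof (rule decay[of "\<lambda>t. exp (v * t)" "exp (v\<^sup>2 / (4 * v0))", OF _ _ _ _ _ _ _ \<epsilon>])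
      show "exp (v * t) \<le> exp (v\<^sup>2 / (4 * v0)) * exp (v0 * t\<^sup>2)" for t
        using linear_le_square[OF v0, of v t] by (simp flip: exp_add)
      show "exp (v * (q * s + (1 - q) * t)) \<le> q * exp (v * s) + (1 - q) * exp (v * t)"
        if "0 \<le> q" "q \<le> 1" for q s t
        using that by (intro exp_convex_compose[where g="\<lambda>t. v * t"]) (auto simp: algebra_simps)
      show "\<exists>R. \<forall>t\<ge>0. exp (v * t) \<le> M \<longrightarrow> t \<le> R" for M
      proof (intro exI allI impI)
        fix t :: real assume t: "0 \<le> t" "exp (v * t) \<le> M"
        then have "v * t \<le> M" using exp_ge_add_one_self[of "v * t"] by linarith
        then show "t \<le> M / v" using v by (simp add: field_simps)
      qed
    qed (use v in auto)
  next
    fix v :: real assume v: "0 < v" "v \<le> v0" and V: "V = (\<lambda>x. exp (v * (norm x)\<^sup>2))"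
    show ?thesis unfolding V
    proof (rule decay[of "\<lambda>t. exp (v * t\<^sup>2)" 1, OF _ _ _ _ _ _ _ \<epsilon>])
      show "exp (v * t\<^sup>2) \<le> 1 * exp (v0 * t\<^sup>2)" for t
        using v by (simp add: mult_right_mono)
      show "exp (v * (q * s + (1 - q) * t)\<^sup>2) \<le> q * exp (v * s\<^sup>2) + (1 - q) * exp (v * t\<^sup>2)"
        if "0 \<le> q" "q \<le> 1" "0 \<le> s" "0 \<le> t" for q s t
      proof (rule exp_convex_compose[where g="\<lambda>t. v * t\<^sup>2"])
        show "v * (q * s + (1 - q) * t)\<^sup>2 \<le> q * (v * s\<^sup>2) + (1 - q) * (v * t\<^sup>2)"
          using mult_left_mono[OF power_convex_nonneg[OF that, of 2], of v] v by (simp add: algebra_simps)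
      qed (use that in auto)
      show "\<exists>R. \<forall>t\<ge>0. exp (v * t\<^sup>2) \<le> M \<longrightarrow> t \<le> R" for M
      proof (intro exI allI impI)
        fix t :: real assume t: "0 \<le> t" "exp (v * t\<^sup>2) \<le> M"
        then have "v * t\<^sup>2 \<le> M" using exp_ge_add_one_self[of "v * t\<^sup>2"] by linarith
        then have "t\<^sup>2 \<le> M / v" using v by (simp add: field_simps)
        then show "t \<le> sqrt (M / v)" by (rule real_le_rsqrt)
      qed
      show "exp (v * s\<^sup>2) \<le> exp (v * t\<^sup>2)" if "0 \<le> s" "s \<le> t" for s t
        using that v by (simp add: power_mono)
    qed auto
  qed
  show ?thesis
  proof (rule exI[of _ v0], intro conjI v0 allI impI)
    fix V :: "'a \<Rightarrow> real"
    assume V: "(\<exists>k::nat. 1 \<le> k \<and> V = (\<lambda>x. norm x ^ k)) \<or>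
      (\<exists>v>0. V = (\<lambda>x. exp (v * norm x))) \<or>
      (\<exists>v. 0 < v \<and> v \<le> v0 \<and> V = (\<lambda>x. exp (v * (norm x)\<^sup>2)))"
    show "\<exists>\<epsilon>star. 0 < \<epsilon>star \<and> \<epsilon>star < 1 \<and>
      (\<forall>\<epsilon>. 0 < \<epsilon> \<and> \<epsilon> < \<epsilon>star \<longrightarrow>
        (\<exists>l n1. 0 < l \<and> l < 1 \<and>
          (\<forall>\<nu>1 \<nu>2. prob_space \<nu>1 \<and> sets \<nu>1 = sets borel \<and>
                    prob_space \<nu>2 \<and> sets \<nu>2 = sets borel \<longrightarrow>
            (\<forall>n\<ge>n1.
              wasserstein (d_tilde V \<epsilon>)
                (\<nu>1 \<bind> kernel_power (pcn_infinity C \<Phi> \<rho>1 \<rho>2) n)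
                (\<nu>2 \<bind> kernel_power (pcn_infinity C \<Phi> \<rho>1 \<rho>2) n)
              \<le> ennreal (l ^ n) * wasserstein (d_tilde V \<epsilon>) \<nu>1 \<nu>2))))"
    \<comment> \<open>The decay holds for every positive \<open>\<epsilon>\<close>, so any threshold in \<open>(0, 1)\<close> will do.\<close>
    proof (rule exI[of _ "1/2"], intro conjI allI impI)
      fix \<epsilon> :: real assume \<epsilon>: "0 < \<epsilon> \<and> \<epsilon> < 1/2"
      then have "0 < \<epsilon>" by simp
      then have "0 < \<epsilon>" by simp
      from main[OF V this] obtain l n1 where l: "0 < l" "l < 1" and
        decay: "\<forall>\<nu>1 \<nu>2. sets \<nu>1 = sets borel \<and> sets \<nu>2 = sets borel \<longrightarrow>
          (\<forall>n\<ge>n1.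
            wasserstein (d_tilde V \<epsilon>)
              (\<nu>1 \<bind> kernel_power (pcn_infinity C \<Phi> \<rho>1 \<rho>2) n)
              (\<nu>2 \<bind> kernel_power (pcn_infinity C \<Phi> \<rho>1 \<rho>2) n)
            \<le> ennreal (l ^ n) * wasserstein (d_tilde V \<epsilon>) \<nu>1 \<nu>2)"
        by (elim exE conjE) (rule that)
      show "\<exists>l n1. 0 < l \<and> l < 1 \<and>
          (\<forall>\<nu>1 \<nu>2. prob_space \<nu>1 \<and> sets \<nu>1 = sets borel \<and>
                    prob_space \<nu>2 \<and> sets \<nu>2 = sets borel \<longrightarrow>
            (\<forall>n\<ge>n1.
              wasserstein (d_tilde V \<epsilon>)
                (\<nu>1 \<bind> kernel_power (pcn_infinity C \<Phi> \<rho>1 \<rho>2) n)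
                (\<nu>2 \<bind> kernel_power (pcn_infinity C \<Phi> \<rho>1 \<rho>2) n)
              \<le> ennreal (l ^ n) * wasserstein (d_tilde V \<epsilon>) \<nu>1 \<nu>2))"
        by (intro exI[of _ l] exI[of _ n1] conjI l allI impI) (elim conjE, rule decay[rule_format], simp_all)
    qed simp_all
  qed
qed

end
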